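(* Let $K$ be a field, let $\mathcal{C}$ be a finite, non-empty, weakly connected collection of cells in $\mathbb{Z}^2$, let $S_{\mathcal{C}}=K[x_v \mid v\in V(\mathcal{C})]$, and let $I_{\mathrm{adj}}(\mathcal{C})\subset S_{\mathcal{C}}$ be the adjacent $2$-minor ideal of $\mathcal{C}$. Then the following conditions are equivalent: (1) $I_{\mathrm{adj}}(\mathcal{C})$ is a complete intersection; (2) $S_{\mathcal{C}}/I_{\mathrm{adj}}(\mathcal{C})$ is Gorenstein; (3) $S_{\mathcal{C}}/I_{\mathrm{adj}}(\mathcal{C})$ is level; (4) $S_{\mathcal{C}}/I_{\mathrm{adj}}(\mathcal{C})$ is Cohen--Macaulay; (5) $I_{\mathrm{adj}}(\mathcal{C})$ is unmixed. Moreover, if $I_{\mathrm{adj}}(\mathcal{C})$ satisfies these conditions, then $\mathrm{ht}(I_{\mathrm{adj}}(\mathcal{C}))=|\mathcal{C}|$.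
   Context: A cell of $\mathbb{Z}^2$ is a set $C=[a,b]=\{a,b,c,d\}$ with $a=(i,j)$, $b=a+(1,1)$, $c=(i,j+1)$, $d=(i+1,j)$; $a,b$ are its diagonal corners, $c,d$ its anti-diagonal corners, $V(C)=\{a,b,c,d\}$ its vertices, and $\{a,c\},\{c,b\},\{b,d\},\{a,d\}$ its edges. For a set $\mathcal{C}$ of cells, $V(\mathcal{C})=\bigcup_{C\in\mathcal{C}}V(C)$ and $|\mathcal{C}|$ is the number of cells. $\mathcal{C}$ is weakly connected if any two cells of $\mathcal{C}$ can be joined by a sequence of cells of $\mathcal{C}$ in which consecutive cells share an edge or a vertex. $I_{\mathrm{adj}}(\mathcal{C})$ is the ideal of $S_{\mathcal{C}}$ generated by the adjacent $2$-minors $x_ax_b-x_cx_d$, one for each cell of $\mathcal{C}$ (with diagonal corners $a,b$ and anti-diagonal corners $c,d$). An ideal is called unmixed if all its minimal primes have the same height. A homogeneous ideal is a complete intersection if it is generated by a regular sequence (equivalently here, its minimal number of generators equals its height). A standard graded Cohen--Macaulay $K$-algebra is level if its canonical module is generated in a single degree. *)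

theory Defs
  imports "HOL-Algebra.Algebra" "HOL-Library.Poly_Mapping" "HOL-Library.Extended_Nat"
begin

section \<open>Chains of primes, height, dimension\<close>

definition prime_chain :: "('a, 'm) ring_scheme \<Rightarrow> nat \<Rightarrow> (nat \<Rightarrow> 'a set) \<Rightarrow> bool" where
  "prime_chain R n P \<longleftrightarrow> (\<forall>i\<le>n. primeideal (P i) R) \<and> (\<forall>i<n. P i \<subset> P (Suc i))"

definition krull_dim :: "('a, 'm) ring_scheme \<Rightarrow> enat" where
  "krull_dim R = Sup {enat n | n. \<exists>P. prime_chain R n P}"

definition prime_height :: "('a, 'm) ring_scheme \<Rightarrow> 'a set \<Rightarrow> enat" where
  "prime_height R Q = Sup {enat n | n. \<exists>P. prime_chain R n P \<and> P n = Q}"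

definition height :: "('a, 'm) ring_scheme \<Rightarrow> 'a set \<Rightarrow> enat" where
  "height R I = (INF Q \<in> {Q. primeideal Q R \<and> I \<subseteq> Q}. prime_height R Q)"

definition minimal_prime :: "('a, 'm) ring_scheme \<Rightarrow> 'a set \<Rightarrow> 'a set \<Rightarrow> bool" where
  "minimal_prime R I P \<longleftrightarrow> primeideal P R \<and> I \<subseteq> P \<and>
     (\<forall>Q. primeideal Q R \<and> I \<subseteq> Q \<and> Q \<subseteq> P \<longrightarrow> Q = P)"

definition unmixed :: "('a, 'm) ring_scheme \<Rightarrow> 'a set \<Rightarrow> bool" where
  "unmixed R I \<longleftrightarrow>
     (\<forall>P Q. minimal_prime R I P \<and> minimal_prime R I Q \<longrightarrow> prime_height R P = prime_height R Q)"


section \<open>Regular sequences\<close>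

definition regular_sequence :: "('a, 'm) ring_scheme \<Rightarrow> 'a list \<Rightarrow> bool" where
  "regular_sequence R fs \<longleftrightarrow>
     set fs \<subseteq> carrier R \<and>
     (\<forall>i<length fs. \<forall>r\<in>carrier R.
        (fs ! i) \<otimes>\<^bsub>R\<^esub> r \<in> genideal R (set (take i fs)) \<longrightarrow> r \<in> genideal R (set (take i fs))) \<and>
     genideal R (set fs) \<noteq> carrier R"

definition complete_intersection :: "('a, 'm) ring_scheme \<Rightarrow> 'a set \<Rightarrow> bool" where
  "complete_intersection R I \<longleftrightarrow> (\<exists>fs. regular_sequence R fs \<and> I = genideal R (set fs))"

definition depth :: "('a, 'm) ring_scheme \<Rightarrow> 'a set \<Rightarrow> enat" where
  "depth R \<mm> = Sup {enat (length fs) | fs. regular_sequence R fs \<and> set fs \<subseteq> \<mm>}"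


section \<open>Polynomial rings and their standard grading\<close>

type_synonym ('v, 'k) mpoly = "('v \<Rightarrow>\<^sub>0 nat) \<Rightarrow>\<^sub>0 'k"

definition mpoly_ring :: "'v set \<Rightarrow> ('v, 'k::field) mpoly ring" where
  "mpoly_ring V =
     \<lparr>carrier = {p. \<forall>m\<in>Poly_Mapping.keys p. Poly_Mapping.keys m \<subseteq> V},
      monoid.mult = (*), one = 1, ring.zero = 0, ring.add = (+)\<rparr>"

definition mvar :: "'v \<Rightarrow> ('v, 'k::field) mpoly" where
  "mvar v = Poly_Mapping.single (Poly_Mapping.single v 1) 1"

definition monom_deg :: "('v \<Rightarrow>\<^sub>0 nat) \<Rightarrow> nat" where
  "monom_deg m = (\<Sum>v\<in>Poly_Mapping.keys m. Poly_Mapping.lookup m v)"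

text \<open>Degrees are integers so that shifted gradings can be expressed; a polynomial that is
  homogeneous of negative degree is zero.\<close>

definition homogeneous :: "int \<Rightarrow> ('v, 'k::field) mpoly \<Rightarrow> bool" where
  "homogeneous d p \<longleftrightarrow> (\<forall>m\<in>Poly_Mapping.keys p. int (monom_deg m) = d)"

lemma cring_mpoly_ring: "cring (mpoly_ring V :: ('v, 'k::field) mpoly ring)"
proof -
  let ?P = "{p :: ('v, 'k) mpoly. \<forall>m\<in>Poly_Mapping.keys p. Poly_Mapping.keys m \<subseteq> V}"
  have add_closed: "p + q \<in> ?P" if "p \<in> ?P" "q \<in> ?P" for p q
    using that Poly_Mapping.keys_add[of p q] by blast
  have neg: "- p \<in> ?P" if "p \<in> ?P" for p
    using that by simp
  have mult_closed: "p * q \<in> ?P" if pq: "p \<in> ?P" "q \<in> ?P" for p q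
  proof -
    have "Poly_Mapping.keys m \<subseteq> V" if m: "m \<in> Poly_Mapping.keys (p * q)" for m
    proof -
      from m keys_mult[of p q] obtain a b where ab: "m = a + b"
        "a \<in> Poly_Mapping.keys p" "b \<in> Poly_Mapping.keys q" by blast
      with pq have "Poly_Mapping.keys a \<subseteq> V" "Poly_Mapping.keys b \<subseteq> V"
        by blast+
      then show ?thesis unfolding ab(1) using Poly_Mapping.keys_add[of a b] by blast
    qed
    then show ?thesis by blast
  qed
  have zero: "0 \<in> ?P" and one: "1 \<in> ?P" by simp_all
  note sel = mpoly_ring_def partial_object.simps monoid.simps ring.simps
  have "abelian_group (mpoly_ring V :: ('v, 'k) mpoly ring)"
    apply (rule abelian_groupI; simp only: sel)
         apply (erule (1) add_closed)
        apply (rule zero)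
       apply (simp only: add.assoc)
      apply (simp only: add.commute)
     apply (simp only: add_0_left)
    subgoal for p by (rule bexI[of _ "- p"], simp only: add.left_inverse, erule neg)
    done
  moreover have "Group.comm_monoid (mpoly_ring V :: ('v, 'k) mpoly ring)"
    apply (rule comm_monoidI; simp only: sel)
        apply (erule (1) mult_closed)
       apply (rule one)
      apply (simp only: mult.assoc)
     apply (simp only: mult_1_left)
    apply (simp only: mult.commute)
    done
  ultimately show ?thesis
    by (rule cringI) (simp only: sel distrib_right)
qed

text \<open>The component of degree \<open>d\<close> of the standard graded algebra \<open>S/I\<close>, and its irrelevant
  maximal ideal, for a homogeneous ideal \<open>I\<close> of \<open>S = K[x\<^sub>v | v \<in> V]\<close>.\<close>

definition quot_component :: "'v set \<Rightarrow> ('v, 'k::field) mpoly set \<Rightarrow> int \<Rightarrow> ('v, 'k) mpoly set set" where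
  "quot_component V I d =
     {I +>\<^bsub>mpoly_ring V\<^esub> p | p. p \<in> carrier (mpoly_ring V) \<and> homogeneous d p}"

definition irrelevant_ideal :: "'v set \<Rightarrow> ('v, 'k::field) mpoly set \<Rightarrow> ('v, 'k) mpoly set set" where
  "irrelevant_ideal V I =
     {I +>\<^bsub>mpoly_ring V\<^esub> p | p. p \<in> carrier (mpoly_ring V) \<and> Poly_Mapping.lookup p 0 = 0}"

text \<open>The graded notion: \<open>depth (S/I) = dim (S/I)\<close>, the depth being taken with respect to the
  irrelevant maximal ideal.\<close>

definition cohen_macaulay :: "'v set \<Rightarrow> ('v, 'k::field) mpoly set \<Rightarrow> bool" where
  "cohen_macaulay V I \<longleftrightarrow>
     depth (mpoly_ring V Quot I) (irrelevant_ideal V I) = krull_dim (mpoly_ring V Quot I)"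


section \<open>Modules\<close>

text \<open>The fields \<open>mult\<close> and \<open>one\<close> are present only because the library's module record extends
  the ring record; no module notion refers to them.\<close>

definition free_module :: "'v set \<Rightarrow> nat \<Rightarrow> (('v, 'k::field) mpoly, nat \<Rightarrow> ('v, 'k) mpoly) module" where
  "free_module V b =
     \<lparr>carrier = {..<b} \<rightarrow>\<^sub>E carrier (mpoly_ring V), monoid.mult = undefined, one = undefined,
      ring.zero = (\<lambda>j\<in>{..<b}. 0), ring.add = (\<lambda>u v. \<lambda>j\<in>{..<b}. u j + v j),
      smult = (\<lambda>r u. \<lambda>j\<in>{..<b}. r * u j)\<rparr>"

definition quot_module :: "('a, 'b) module \<Rightarrow> 'b set \<Rightarrow> ('a, 'b set) module" where
  "quot_module M N =
     \<lparr>carrier = a_rcosets\<^bsub>M\<^esub> N, monoid.mult = undefined, one = undefined,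
      ring.zero = N, ring.add = set_add M,
      smult = (\<lambda>r A. \<Union>x\<in>A. N +>\<^bsub>M\<^esub> (r \<odot>\<^bsub>M\<^esub> x))\<rparr>"

definition mat_apply :: "nat \<Rightarrow> nat \<Rightarrow> (nat \<Rightarrow> nat \<Rightarrow> 'a::comm_ring_1) \<Rightarrow> (nat \<Rightarrow> 'a) \<Rightarrow> nat \<Rightarrow> 'a" where
  "mat_apply m n A v = (\<lambda>j\<in>{..<m}. \<Sum>k<n. A j k * v k)"


section \<open>Graded free resolutions and Ext\<close>

text \<open>A complex \<open>\<dots> \<rightarrow> F\<^sub>1 \<rightarrow> F\<^sub>0\<close> of graded free modules of finite rank: \<open>F\<^sub>i\<close> has \<open>rk i\<close> basis
  elements, the \<open>j\<close>-th of degree \<open>gdeg i j\<close>, and \<open>diff i\<close> is the matrix of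
  \<open>F\<^bsub>i+1\<^esub> \<rightarrow> F\<^sub>i\<close>, with rows indexed by the basis of \<open>F\<^sub>i\<close>.\<close>

record 'a free_complex =
  rk :: "nat \<Rightarrow> nat"
  gdeg :: "nat \<Rightarrow> nat \<Rightarrow> int"
  diff :: "nat \<Rightarrow> nat \<Rightarrow> nat \<Rightarrow> 'a"

definition differential :: "('v, 'k::field) mpoly free_complex \<Rightarrow> nat \<Rightarrow>
    (nat \<Rightarrow> ('v, 'k) mpoly) \<Rightarrow> nat \<Rightarrow> ('v, 'k) mpoly" where
  "differential F i = mat_apply (rk F i) (rk F (Suc i)) (diff F i)"

definition codifferential :: "('v, 'k::field) mpoly free_complex \<Rightarrow> nat \<Rightarrow>
    (nat \<Rightarrow> ('v, 'k) mpoly) \<Rightarrow> nat \<Rightarrow> ('v, 'k) mpoly" where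
  "codifferential F i = mat_apply (rk F (Suc i)) (rk F i) (\<lambda>k j. diff F i j k)"

text \<open>Graded free resolutions of \<open>S/I\<close> that start with \<open>F\<^sub>0 = S\<close>.\<close>

definition graded_free_resolution ::
    "'v set \<Rightarrow> ('v, 'k::field) mpoly set \<Rightarrow> ('v, 'k) mpoly free_complex \<Rightarrow> bool" where
  "graded_free_resolution V I F \<longleftrightarrow>
     (\<forall>i. \<forall>j<rk F i. \<forall>k<rk F (Suc i).
        diff F i j k \<in> carrier (mpoly_ring V) \<and>
        homogeneous (gdeg F (Suc i) k - gdeg F i j) (diff F i j k)) \<and>
     rk F 0 = 1 \<and> gdeg F 0 0 = 0 \<and>
     differential F 0 ` carrier (free_module V (rk F (Suc 0))) =
       {v \<in> carrier (free_module V 1). v 0 \<in> I} \<and>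
     (\<forall>i. differential F (Suc i) ` carrier (free_module V (rk F (Suc (Suc i)))) =
       {v \<in> carrier (free_module V (rk F (Suc i))).
          differential F i v = \<zero>\<^bsub>free_module V (rk F i)\<^esub>})"

definition ext_cocycles :: "'v set \<Rightarrow> ('v, 'k::field) mpoly free_complex \<Rightarrow> nat \<Rightarrow>
    (nat \<Rightarrow> ('v, 'k) mpoly) set" where
  "ext_cocycles V F c =
     {u \<in> carrier (free_module V (rk F c)).
        codifferential F c u = \<zero>\<^bsub>free_module V (rk F (Suc c))\<^esub>}"

definition ext_coboundaries :: "'v set \<Rightarrow> ('v, 'k::field) mpoly free_complex \<Rightarrow> nat \<Rightarrow>
    (nat \<Rightarrow> ('v, 'k) mpoly) set" where
  "ext_coboundaries V F c =
     (case c of 0 \<Rightarrow> {\<zero>\<^bsub>free_module V (rk F 0)\<^esub>}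
      | Suc i \<Rightarrow> codifferential F i ` carrier (free_module V (rk F i)))"

definition ext_module :: "'v set \<Rightarrow> ('v, 'k::field) mpoly free_complex \<Rightarrow> nat \<Rightarrow>
    (('v, 'k) mpoly, (nat \<Rightarrow> ('v, 'k) mpoly) set) module" where
  "ext_module V F c =
     quot_module ((free_module V (rk F c))\<lparr>carrier := ext_cocycles V F c\<rparr>) (ext_coboundaries V F c)"

text \<open>The component of degree \<open>t\<close> of \<open>Ext\<^sup>c(S/I, S(-n))\<close>: the basis element of
  \<open>Hom(F\<^sub>c, S(-n))\<close> dual to a basis element of degree \<open>a\<close> of \<open>F\<^sub>c\<close> has degree \<open>n - a\<close>.\<close>

definition ext_component :: "'v set \<Rightarrow> ('v, 'k::field) mpoly free_complex \<Rightarrow> nat \<Rightarrow> nat \<Rightarrow> int \<Rightarrow>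
    (nat \<Rightarrow> ('v, 'k) mpoly) set set" where
  "ext_component V F n c t =
     {ext_coboundaries V F c +>\<^bsub>free_module V (rk F c)\<^esub> u | u.
        u \<in> ext_cocycles V F c \<and>
        (\<forall>j<rk F c. homogeneous (t - (int n - gdeg F c j)) (u j))}"


section \<open>Canonical module, Gorenstein and level algebras\<close>

text \<open>\<open>\<omega>\<close>, with components \<open>\<omega>\<^sub>t = g t\<close>, is the graded canonical module
  \<open>Ext\<^sup>c(S/I, S(-n))\<close> of \<open>S/I\<close>, where \<open>n = |V|\<close> and \<open>c = n - dim (S/I)\<close>, computed from some
  graded free resolution of \<open>S/I\<close>; up to graded isomorphism the choice of the resolution does
  not matter.\<close>

definition canonical_module :: "'v set \<Rightarrow> ('v, 'k::field) mpoly set \<Rightarrow>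
    (('v, 'k) mpoly, (nat \<Rightarrow> ('v, 'k) mpoly) set) module \<Rightarrow>
    (int \<Rightarrow> (nat \<Rightarrow> ('v, 'k) mpoly) set set) \<Rightarrow> bool" where
  "canonical_module V I \<omega> g \<longleftrightarrow>
     (\<exists>F c. graded_free_resolution V I F \<and>
        enat c + krull_dim (mpoly_ring V Quot I) = enat (card V) \<and>
        \<omega> = ext_module V F c \<and> g = ext_component V F (card V) c)"

text \<open>Cohen--Macaulay with \<open>\<omega> \<cong> R(a)\<close> for some \<open>a\<close>, where \<open>R = S/I\<close> and
  \<open>R(a)\<^sub>t = R\<^bsub>a+t\<^esub>\<close>; \<open>S\<close> acts on \<open>R\<close> through the residue map.\<close>

definition gorenstein :: "'v set \<Rightarrow> ('v, 'k::field) mpoly set \<Rightarrow> bool" where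
  "gorenstein V I \<longleftrightarrow> cohen_macaulay V I \<and>
     (let S = mpoly_ring V; R = S Quot I in
      \<exists>\<omega> g a \<phi>. canonical_module V I \<omega> g \<and>
        bij_betw \<phi> (carrier R) (carrier \<omega>) \<and>
        (\<forall>x\<in>carrier R. \<forall>y\<in>carrier R. \<phi> (x \<oplus>\<^bsub>R\<^esub> y) = \<phi> x \<oplus>\<^bsub>\<omega>\<^esub> \<phi> y) \<and>
        (\<forall>s\<in>carrier S. \<forall>x\<in>carrier R. \<phi> ((I +>\<^bsub>S\<^esub> s) \<otimes>\<^bsub>R\<^esub> x) = s \<odot>\<^bsub>\<omega>\<^esub> \<phi> x) \<and>
        (\<forall>t. \<phi> ` quot_component V I (a + t) = g t))"

definition level :: "'v set \<Rightarrow> ('v, 'k::field) mpoly set \<Rightarrow> bool" where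
  "level V I \<longleftrightarrow> cohen_macaulay V I \<and>
     (\<exists>\<omega> g t. canonical_module V I \<omega> g \<and>
        (\<forall>N. submodule N (mpoly_ring V) \<omega> \<and> g t \<subseteq> N \<longrightarrow> N = carrier \<omega>))"


section \<open>Collections of cells and adjacent 2-minors\<close>

type_synonym point = "int \<times> int"

text \<open>A cell is identified with its vertex set; \<open>cell i j\<close> has lower left corner \<open>(i, j)\<close>, and
  is determined by it.\<close>

definition cell :: "int \<Rightarrow> int \<Rightarrow> point set" where
  "cell i j = {(i, j), (i + 1, j + 1), (i, j + 1), (i + 1, j)}"

definition is_cell :: "point set \<Rightarrow> bool" where
  "is_cell C \<longleftrightarrow> (\<exists>i j. C = cell i j)"

definition cell_edges :: "point set \<Rightarrow> point set set" where
  "cell_edges C = {e. \<exists>i j. C = cell i j \<and>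
     e \<in> {{(i, j), (i, j + 1)}, {(i, j + 1), (i + 1, j + 1)},
          {(i + 1, j + 1), (i + 1, j)}, {(i, j), (i + 1, j)}}}"

definition vertices :: "point set set \<Rightarrow> point set" where
  "vertices \<C> = \<Union>\<C>"

definition weakly_connected :: "point set set \<Rightarrow> bool" where
  "weakly_connected \<C> \<longleftrightarrow>
     (\<forall>C\<in>\<C>. \<forall>D\<in>\<C>. (C, D) \<in>
        {(A, B). A \<in> \<C> \<and> B \<in> \<C> \<and> (cell_edges A \<inter> cell_edges B \<noteq> {} \<or> A \<inter> B \<noteq> {})}\<^sup>*)"

definition adjacent_minor :: "int \<Rightarrow> int \<Rightarrow> (point, 'k::field) mpoly" where
  "adjacent_minor i j = mvar (i, j) * mvar (i + 1, j + 1) - mvar (i, j + 1) * mvar (i + 1, j)"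

definition adjacent_ideal :: "point set set \<Rightarrow> (point, 'k::field) mpoly set" where
  "adjacent_ideal \<C> =
     genideal (mpoly_ring (vertices \<C>)) {adjacent_minor i j | i j. cell i j \<in> \<C>}"

end

theory Submission
  imports Defs "HOL-Library.Product_Lexorder"
begin

text \<open>Let \<open>n = |V|\<close> and \<open>r = |\<C>|\<close>. All conditions turn out to be equivalent to \<open>dim S/I + r \<le> n\<close>.

  Order the cells lexicographically. The upper right corner of a cell occurs in no earlier minor, so
  a prime minimal over the earlier minors is homogeneous for the grading by the degree in that
  corner. Hence a minimal prime \<open>P\<close> of \<open>I\<close> that contains no monomial (it exists because \<open>I\<close> vanishes
  at \<open>(1, \<dots>, 1)\<close>) sits at the end of a chain of \<open>r\<close> proper inclusions of primes, and
  \<open>dim S/P \<le> n - r\<close>. If \<open>I\<close> is unmixed, all minimal primes have height at least \<open>r\<close>; if \<open>S/I\<close> is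
  Cohen--Macaulay, all minimal primes have the dimension of \<open>P\<close>; and if \<open>I\<close> is generated by a regular
  sequence of length \<open>s\<close>, then \<open>dim S/I \<le> n - s\<close>, where \<open>s \<ge> r\<close> because the minors are linearly
  independent quadrics.

  Conversely, \<open>dim S/I \<le> n - r\<close> makes the minors a regular sequence and \<open>S/I\<close> Cohen--Macaulay. Then the
  iterated mapping cone resolves \<open>S/I\<close> and its last cohomology is \<open>S/I\<close> up to a shift.\<close>

section \<open>Polynomials and weights\<close>

text \<open>The conditions speak of primes, of regular sequences with arbitrary elements and of
  resolutions, so the inequality they are compared with must be readable in all three settings.
  Dimension is therefore measured by sets of variables independent modulo \<open>J\<close>, which
  matches the growth of \<open>S/J\<close>, the number of polynomials needed to span those of degree
  at most \<open>t\<close> modulo \<open>J\<close>. Growth yields the two basic estimates: a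
  nonzerodivisor lowers the dimension by at least one, and a form of positive degree lowers that of
  a proper homogeneous ideal by at most one. The comparisons with chains of primes and with depth
  rest on these.

  Depth is the main obstacle. Its regular sequences may contain inhomogeneous elements of the
  irrelevant ideal, for which exchange arguments hold only locally. Sequences of forms
  (\<open>hdep\<close>) therefore serve to produce depth, arbitrary ones (\<open>dep\<close>) to
  bound dimensions of primes from below, and the latter argument runs modulo the ideals
  \<open>loc J\<close>, which agree with \<open>J\<close> when \<open>J\<close> is homogeneous.

  The point (1, ..., 1) matters because no monomial vanishes there.\<close>

abbreviation supp :: "('a \<Rightarrow>\<^sub>0 'b::zero) \<Rightarrow> 'a set" where "supp \<equiv> Poly_Mapping.keys"
abbreviation cf :: "('a \<Rightarrow>\<^sub>0 'b::zero) \<Rightarrow> 'a \<Rightarrow> 'b" where "cf \<equiv> Poly_Mapping.lookup"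
abbreviation mon :: "('v \<Rightarrow>\<^sub>0 nat) \<Rightarrow> ('v, 'k::field) mpoly" where "mon m \<equiv> Poly_Mapping.single m 1"
abbreviation const :: "'k::field \<Rightarrow> ('v, 'k) mpoly" where "const c \<equiv> Poly_Mapping.single 0 c"

definition polys :: "'v set \<Rightarrow> ('v, 'k::field) mpoly set" where
  "polys V = {p. \<forall>m\<in>supp p. supp m \<subseteq> V}"

lemma polys_zero [simp]: "0 \<in> polys V" and polys_one [simp]: "1 \<in> polys V"
  by (auto simp: polys_def)

lemma polys_add [intro]: "p \<in> polys V \<Longrightarrow> q \<in> polys V \<Longrightarrow> p + q \<in> polys V"
  unfolding polys_def using Poly_Mapping.keys_add[of p q] by blast

lemma polys_uminus [intro]: "p \<in> polys V \<Longrightarrow> - p \<in> polys V"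
  by (simp add: polys_def)

lemma polys_diff [intro]: "p \<in> polys V \<Longrightarrow> q \<in> polys V \<Longrightarrow> p - q \<in> polys V"
  using polys_add[of p V "- q"] by auto

lemma keys_add_nat: "supp (a + b) = supp a \<union> supp (b :: 'v \<Rightarrow>\<^sub>0 nat)"
  by (auto simp: in_keys_iff lookup_add)

lemma polys_mult [intro]: "p \<in> polys V \<Longrightarrow> q \<in> polys V \<Longrightarrow> p * q \<in> polys V"
  unfolding polys_def using keys_mult[of p q] by (fastforce simp: keys_add_nat)

lemma polys_sum [intro]: "(\<And>i. i \<in> Z \<Longrightarrow> f i \<in> polys V) \<Longrightarrow> sum f Z \<in> polys V"
  by (induction Z rule: infinite_finite_induct) auto

lemma polys_power [intro]: "p \<in> polys V \<Longrightarrow> p ^ n \<in> polys V"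
  by (induction n) auto

lemma polys_single [simp]: "Poly_Mapping.single m c \<in> polys V \<longleftrightarrow> c = 0 \<or> supp m \<subseteq> V"
  by (auto simp: polys_def)

lemma polys_mono: "U \<subseteq> V \<Longrightarrow> polys U \<subseteq> polys V"
  by (auto simp: polys_def)

lemma poly_as_sum: "p = (\<Sum>m\<in>supp p. Poly_Mapping.single m (cf p m))"
proof (rule poly_mapping_eqI)
  fix k
  have "cf (\<Sum>m\<in>supp p. Poly_Mapping.single m (cf p m)) k = (\<Sum>m\<in>supp p. cf p m when m = k)"
    by (simp add: lookup_sum lookup_single)
  also have "\<dots> = (\<Sum>m\<in>supp p. if m = k then cf p k else 0)"
    by (rule sum.cong) auto
  also have "\<dots> = cf p k" by (simp add: sum.delta in_keys_iff)
  finally show "cf p k = cf (\<Sum>m\<in>supp p. Poly_Mapping.single m (cf p m)) k" by simp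
qed

lemma lookup_const_mult [simp]: "cf (const c * p) m = c * cf p m"
  by (simp add: mult_map_scale_conv_mult[symmetric] Poly_Mapping.map.rep_eq when_def)

lemma lookup_mult_zero [simp]: "cf (p * q) 0 = cf p 0 * cf q (0 :: 'v \<Rightarrow>\<^sub>0 nat)"
proof -
  have eq: "(0 = q + r) = (q = 0 \<and> r = 0)" for q r :: "'v \<Rightarrow>\<^sub>0 nat"
    by (auto simp: poly_mapping_eq_iff fun_eq_iff lookup_add)
  have "cf (p * q) 0 = Sum_any (\<lambda>l. cf p l * Sum_any (\<lambda>r. cf q r when l = 0 \<and> r = 0))"
    by (simp add: lookup_mult eq)
  also have "\<dots> = Sum_any (\<lambda>l. (cf p l * cf q 0) when l = 0)"
    by (rule Sum_any.cong) (auto simp: when_def)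
  finally show ?thesis by simp
qed

text \<open>Three weights occur later: the constant 1 gives the standard grading, the indicator of
  one corner of a cell gives the grading behind the height bound, and the constant 0 puts everything
  in degree 0, so that statements on graded ideals cover all ideals.\<close>

definition wdeg :: "('v \<Rightarrow> nat) \<Rightarrow> ('v \<Rightarrow>\<^sub>0 nat) \<Rightarrow> nat" where
  "wdeg w m = (\<Sum>v\<in>supp m. w v * cf m v)"

lemma wdeg_superset: "finite Z \<Longrightarrow> supp m \<subseteq> Z \<Longrightarrow> wdeg w m = (\<Sum>v\<in>Z. w v * cf m v)"
  unfolding wdeg_def by (rule sum.mono_neutral_left) (auto simp: in_keys_iff)

lemma wdeg_add [simp]: "wdeg w (a + b) = wdeg w a + wdeg w b"
proof -
  let ?Z = "supp a \<union> supp b"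
  have "wdeg w x = (\<Sum>v\<in>?Z. w v * cf x v)" if "x \<in> {a, b, a + b}" for x
    using that by (intro wdeg_superset) (auto simp: keys_add_nat)
  then show ?thesis by (simp add: lookup_add sum.distrib algebra_simps)
qed

lemma wdeg_zero [simp]: "wdeg w 0 = 0"
  by (simp add: wdeg_def)

lemma wdeg_single [simp]: "wdeg w (Poly_Mapping.single v k) = w v * k"
  by (simp add: wdeg_def)

definition unit_wt :: "'v \<Rightarrow> nat" where "unit_wt v = 1"

lemma unit_wt_mult [simp]: "unit_wt v * k = k"
  by (simp add: unit_wt_def)

abbreviation deg :: "('v \<Rightarrow>\<^sub>0 nat) \<Rightarrow> nat" where "deg \<equiv> wdeg unit_wt"

lemma monom_deg_eq: "monom_deg m = deg m"
  by (simp add: monom_deg_def wdeg_def)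

lemma deg_eq_0_iff [simp]: "deg m = 0 \<longleftrightarrow> m = 0"
  by (auto simp: wdeg_def in_keys_iff poly_mapping_eq_iff fun_eq_iff)

lemma lookup_le_deg: "cf m v \<le> deg m"
proof (cases "v \<in> supp m")
  case True
  then show ?thesis unfolding wdeg_def using member_le_sum[of v "supp m" "\<lambda>v. 1 * cf m v"] by simp
qed (simp add: in_keys_iff)

section \<open>Homogeneous components with respect to a weight\<close>

definition restr :: "(('v \<Rightarrow>\<^sub>0 nat) \<Rightarrow> bool) \<Rightarrow> ('v, 'k::field) mpoly \<Rightarrow> ('v, 'k) mpoly" where
  "restr Q p = Poly_Mapping.mapp (\<lambda>m c. if Q m then c else 0) p"

lemma lookup_restr: "cf (restr Q p) m = (if Q m then cf p m else 0)"
  by (simp add: restr_def lookup_mapp when_def in_keys_iff)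

lemma supp_restr: "supp (restr Q p) = {m \<in> supp p. Q m}"
  by (auto simp: in_keys_iff lookup_restr split: if_splits)

lemma restr_polys [intro]: "p \<in> polys V \<Longrightarrow> restr Q p \<in> polys V"
  by (auto simp: polys_def supp_restr)

lemma restr_add: "restr Q (p + q) = restr Q p + restr Q q"
  and restr_diff: "restr Q (p - q) = restr Q p - restr Q q"
  by (rule poly_mapping_eqI, simp add: lookup_restr lookup_add lookup_minus)+

lemma restr_zero [simp]: "restr Q 0 = 0"
  by (rule poly_mapping_eqI) (simp add: lookup_restr)

lemma restr_sum: "restr Q (sum f Z) = (\<Sum>i\<in>Z. restr Q (f i))"
  by (induction Z rule: infinite_finite_induct) (auto simp: restr_add)

lemma restr_id: "(\<And>m. m \<in> supp p \<Longrightarrow> Q m) \<Longrightarrow> restr Q p = p"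
  by (rule poly_mapping_eqI) (auto simp: lookup_restr in_keys_iff)

lemma restr_eq_0: "(\<And>m. m \<in> supp p \<Longrightarrow> \<not> Q m) \<Longrightarrow> restr Q p = 0"
  by (rule poly_mapping_eqI) (auto simp: lookup_restr in_keys_iff)

abbreviation wcomp :: "('v \<Rightarrow> nat) \<Rightarrow> nat \<Rightarrow> ('v, 'k::field) mpoly \<Rightarrow> ('v, 'k) mpoly" where
  "wcomp w k \<equiv> restr (\<lambda>m. wdeg w m = k)"

definition whom :: "('v \<Rightarrow> nat) \<Rightarrow> nat \<Rightarrow> ('v, 'k::field) mpoly \<Rightarrow> bool" where
  "whom w k p \<longleftrightarrow> (\<forall>m\<in>supp p. wdeg w m = k)"

lemma whom_zero [simp]: "whom w k 0"
  by (simp add: whom_def)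

lemma whom_one [simp]: "whom w 0 1"
  by (simp add: whom_def)

lemma whom_wcomp [simp]: "whom w k (wcomp w k p)"
  by (simp add: whom_def supp_restr)

lemma whom_add: "whom w k p \<Longrightarrow> whom w k q \<Longrightarrow> whom w k (p + q)"
  unfolding whom_def using Poly_Mapping.keys_add[of p q] by blast

lemma whom_uminus [simp]: "whom w k (- p) = whom w k p"
  by (simp add: whom_def)

lemma whom_diff: "whom w k p \<Longrightarrow> whom w k q \<Longrightarrow> whom w k (p - q)"
  using whom_add[of w k p "- q"] by simp

lemma whom_mult: "whom w i p \<Longrightarrow> whom w j q \<Longrightarrow> whom w (i + j) (p * q)"
  unfolding whom_def using keys_mult[of p q] by fastforce

lemma whom_power: "whom w i p \<Longrightarrow> whom w (i * n) (p ^ n)"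
  by (induction n) (auto intro: whom_mult simp: algebra_simps)

lemma whom_sum: "(\<And>i. i \<in> Z \<Longrightarrow> whom w k (f i)) \<Longrightarrow> whom w k (sum f Z)"
  by (induction Z rule: infinite_finite_induct) (auto intro: whom_add)

lemma whom_prod: "finite Z \<Longrightarrow> (\<And>i. i \<in> Z \<Longrightarrow> whom w (d i) (f i)) \<Longrightarrow> whom w (sum d Z) (prod f Z)"
  by (induction Z rule: finite_induct) (auto intro: whom_mult)

lemma wcomp_whom: "whom w j p \<Longrightarrow> wcomp w k p = (if k = j then p else 0)"
  by (auto simp: whom_def intro: restr_id restr_eq_0)

lemma wcomp_expand:
  assumes "\<And>m. m \<in> supp p \<Longrightarrow> wdeg w m \<le> B"
  shows "p = (\<Sum>i\<le>B. wcomp w i p)"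
proof (rule poly_mapping_eqI)
  fix m
  have "cf (\<Sum>i\<le>B. wcomp w i p) m = (\<Sum>i\<le>B. if i = wdeg w m then cf p m else 0)"
    unfolding lookup_sum by (rule sum.cong) (auto simp: lookup_restr)
  also have "\<dots> = (if wdeg w m \<le> B then cf p m else 0)" by simp
  also have "\<dots> = cf p m" using assms by (auto simp: in_keys_iff)
  finally show "cf p m = cf (\<Sum>i\<le>B. wcomp w i p) m" by simp
qed

lemma wcomp_bound_ex: "\<exists>B. \<forall>p\<in>Z. \<forall>m\<in>supp p. wdeg w m \<le> B" if "finite Z"
proof -
  have fin: "finite (\<Union>p\<in>Z. wdeg w ` supp p)" using that by auto
  then show ?thesis by (intro exI[of _ "Max (\<Union>p\<in>Z. wdeg w ` supp p)"]) (auto intro!: Max_ge)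
qed

lemma wcomp_mult: "wcomp w k (p * q) = (\<Sum>i\<le>k. wcomp w i p * wcomp w (k - i) q)"
proof -
  obtain B0 where B0: "\<forall>r\<in>{p,q}. \<forall>m\<in>supp r. wdeg w m \<le> B0"
    using wcomp_bound_ex[of "{p, q}" w] by auto
  \<comment> \<open>Raising the bound to at least \<open>k\<close> makes every index
    \<open>k - i\<close> occur in the inner sum.\<close>
  define B where "B = max B0 k"
  have B: "wdeg w m \<le> B" if "m \<in> supp p \<union> supp q" for m using B0 that unfolding B_def by force
  have "p * q = (\<Sum>i\<le>B. \<Sum>j\<le>B. wcomp w i p * wcomp w j q)"
    using wcomp_expand[of p w B] wcomp_expand[of q w B] B by (simp add: sum_product[symmetric])
  then have "wcomp w k (p * q) = (\<Sum>i\<le>B. \<Sum>j\<le>B. wcomp w k (wcomp w i p * wcomp w j q))"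
    by (simp add: restr_sum)
  also have "\<dots> = (\<Sum>i\<le>B. \<Sum>j\<le>B. if i \<le> k \<and> j = k - i then wcomp w i p * wcomp w (k - i) q else 0)"
  proof (intro sum.cong refl)
    fix i j
    have "whom w (i + j) (wcomp w i p * wcomp w j q)" by (intro whom_mult) auto
    from wcomp_whom[OF this, of k] show "wcomp w k (wcomp w i p * wcomp w j q)
        = (if i \<le> k \<and> j = k - i then wcomp w i p * wcomp w (k - i) q else 0)" by auto
  qed
  also have "\<dots> = (\<Sum>i\<le>B. if i \<le> k then wcomp w i p * wcomp w (k - i) q else 0)"
  proof (intro sum.cong refl)
    fix i
    have "k - i \<le> B" by (simp add: B_def)
    then show "(\<Sum>j\<le>B. if i \<le> k \<and> j = k - i then wcomp w i p * wcomp w (k - i) q else 0)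
       = (if i \<le> k then wcomp w i p * wcomp w (k - i) q else 0)"
      by (cases "i \<le> k") (simp_all add: sum.delta)
  qed
  also have "\<dots> = (\<Sum>i\<le>k. wcomp w i p * wcomp w (k - i) q)"
    by (rule sum.mono_neutral_cong_right) (auto simp: B_def)
  finally show ?thesis .
qed

lemma wcomp_mult_hom:
  assumes "whom w e q"
  shows "wcomp w k (p * q) = (if e \<le> k then wcomp w (k - e) p * q else 0)"
proof -
  have "wcomp w k (p * q) = (\<Sum>i\<le>k. wcomp w i p * (if k - i = e then q else 0))"
    unfolding wcomp_mult by (simp add: wcomp_whom[OF assms])
  also have "\<dots> = (\<Sum>i\<le>k. if i = k - e then (if e \<le> k then wcomp w (k - e) p * q else 0) else 0)"
    by (rule sum.cong) auto
  also have "\<dots> = (if e \<le> k then wcomp w (k - e) p * q else 0)" by simp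
  finally show ?thesis .
qed

lemma single_eq_0_iff [simp]: "Poly_Mapping.single m c = 0 \<longleftrightarrow> c = 0"
  by (metis lookup_single_eq lookup_zero single_zero)

text \<open>The supremum of the empty set is 0, so for \<open>d = 0\<close> no value has to be
  attained. For \<open>d > 0\<close>, a set that misses \<open>d\<close> is bounded by
  \<open>d - 1\<close>.\<close>

lemma Sup_enat_eq_iff:
  assumes "\<And>x. x \<in> Z \<Longrightarrow> x \<le> enat d"
  shows "Sup Z = enat d \<longleftrightarrow> d = 0 \<or> enat d \<in> Z"
proof
  assume eq: "Sup Z = enat d"
  show "d = 0 \<or> enat d \<in> Z"
  proof (rule ccontr)
    assume n: "\<not> (d = 0 \<or> enat d \<in> Z)"
    have "x \<le> enat (d - 1)" if x: "x \<in> Z" for x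
    proof -
      have "x \<le> enat d" "x \<noteq> enat d" using assms x n by auto
      then show ?thesis using n by (cases x) auto
    qed
    then have "Sup Z \<le> enat (d - 1)" by (rule Sup_least)
    then have "d \<le> d - 1" using eq by simp
    then show False using n by (cases d) auto
  qed
next
  assume "d = 0 \<or> enat d \<in> Z"
  moreover have "Sup Z \<le> enat d" using assms by (rule Sup_least)
  ultimately show "Sup Z = enat d" using Sup_upper[of "enat d" Z] by (auto simp: zero_enat_def[symmetric])
qed

lemma sum_lessThan_add: "(\<Sum>k<a + b. g k) = (\<Sum>k<a. g k) + (\<Sum>k<b. g (a + k :: nat) :: 'c::comm_monoid_add)"
  by (induction b) (simp_all add: add.assoc)

lemma restrict_eq_iff: "restrict f Z = restrict g Z \<longleftrightarrow> (\<forall>x\<in>Z. f x = g x)"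
  by (auto simp: fun_eq_iff restrict_def)

text \<open>All dimension counts reduce to linear algebra over the coefficient field, namely to the
  bound for an independent set inside a finite span.\<close>

interpretation mpv: vector_space "\<lambda>(c :: 'k::field) (p :: ('v, 'k) mpoly). const c * p"
proof
  fix a b :: 'k and x y :: "('v, 'k) mpoly"
  show "const a * (const b * x) = const (a * b) * x"
    by (simp add: mult.assoc[symmetric] mult_single)
  show "const (a + b) * x = const a * x + const b * x"
    by (simp add: single_add distrib_right)
qed (simp_all add: distrib_left)

section \<open>Monomial order and Noetherianity\<close>

lemma lookup_single_mult: "cf (Poly_Mapping.single d c * p) (d + m) = c * cf p (m :: 'v \<Rightarrow>\<^sub>0 nat)"
proof -
  have "Poly_Mapping.single d c * p = (\<Sum>k\<in>supp p. Poly_Mapping.single (d + k) (c * cf p k))"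
    by (subst poly_as_sum) (simp add: sum_distrib_left mult_single)
  then have "cf (Poly_Mapping.single d c * p) (d + m) = (\<Sum>k\<in>supp p. if k = m then c * cf p m else 0)"
    by (simp add: lookup_sum lookup_single when_def if_distrib cong: if_cong)
  also have "\<dots> = c * cf p m" by (simp add: in_keys_iff)
  finally show ?thesis .
qed

lemma supp_single_mult: "supp (Poly_Mapping.single d c * p) \<subseteq> (\<lambda>m. d + m) ` supp (p :: ('v, 'k::field) mpoly)"
proof
  fix k assume "k \<in> supp (Poly_Mapping.single d c * p)"
  with keys_mult[of "Poly_Mapping.single d c" p] obtain a b
    where "k = a + b" "a \<in> supp (Poly_Mapping.single d c)" "b \<in> supp p" by blast
  then show "k \<in> (\<lambda>m. d + m) ` supp p" by (cases "c = 0") auto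
qed

text \<open>Comparing degrees before the lexicographic order leaves only finitely many monomials in
  finitely many variables below a given one. This makes \<open>rank\<close> a usable induction
  measure.\<close>

definition gkey :: "('v::linorder \<Rightarrow>\<^sub>0 nat) \<Rightarrow> nat \<times> ('v \<Rightarrow>\<^sub>0 nat)" where
  "gkey m = (deg m, m)"

lemma inj_gkey: "gkey a = gkey b \<longleftrightarrow> a = b"
  by (auto simp: gkey_def)

lemma gkey_add_mono: "gkey a < gkey b \<Longrightarrow> gkey (c + a) < gkey (c + b)"
  by (auto simp: gkey_def less_prod_def)

lemma gkey_less_deg: "gkey a < gkey b \<Longrightarrow> deg a \<le> deg b"
  by (auto simp: gkey_def less_prod_def)

definition lm :: "('v::linorder, 'k::field) mpoly \<Rightarrow> 'v \<Rightarrow>\<^sub>0 nat" where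
  "lm p = snd (Max (gkey ` supp p))"

lemma lm:
  assumes "p \<noteq> 0"
  shows lm_in: "lm p \<in> supp p" and lm_max: "m \<in> supp p \<Longrightarrow> m \<noteq> lm p \<Longrightarrow> gkey m < gkey (lm p)"
proof -
  have "gkey ` supp p \<noteq> {}" using assms by simp
  then have "Max (gkey ` supp p) \<in> gkey ` supp p" by (intro Max_in) auto
  then obtain k where k: "k \<in> supp p" "Max (gkey ` supp p) = gkey k" by auto
  then have "lm p = k" by (simp add: lm_def gkey_def)
  then show "lm p \<in> supp p" using k by simp
  assume "m \<in> supp p" "m \<noteq> lm p"
  moreover have "gkey m \<le> Max (gkey ` supp p)" using \<open>m \<in> supp p\<close> by (intro Max_ge) auto
  ultimately show "gkey m < gkey (lm p)" using k \<open>lm p = k\<close> inj_gkey by (metis order_le_less)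
qed

text \<open>A monotone subsequence that is not increasing is decreasing, hence constant from the
  index \<open>N\<close> at which it takes its minimum.\<close>

lemma nat_seq_incseq_subseq: "\<exists>r :: nat \<Rightarrow> nat. strict_mono r \<and> incseq (\<lambda>i. f (r i) :: nat)"
proof -
  obtain r :: "nat \<Rightarrow> nat" where r: "strict_mono r" "monoseq (\<lambda>n. f (r n))"
    using seq_monosub by blast
  show ?thesis
  proof (cases "incseq (\<lambda>n. f (r n))")
    case True
    then show ?thesis using r by blast
  next
    case False
    then have dec: "decseq (\<lambda>n. f (r n))" using r(2) by (simp add: monoseq_iff)
    obtain N where N: "\<And>n. f (r N) \<le> f (r n)"
      using ex_has_least_nat[of "\<lambda>_. True" 0 "\<lambda>n. f (r n)"] by auto
    have "f (r (N + i)) = f (r N)" for i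
      using N[of "N + i"] decseqD[OF dec, of N "N + i"] by simp
    moreover have "strict_mono (\<lambda>i. r (N + i))"
      using r(1) by (simp add: strict_mono_def)
    ultimately show ?thesis by (intro exI[of _ "\<lambda>i. r (N + i)"]) (simp add: incseq_def)
  qed
qed

text \<open>Passing to a subsequence for one variable after another makes all exponents weakly
  increasing. The first two terms that remain then divide, and the truncated difference of exponents
  is the true one.\<close>

lemma dickson:
  fixes s :: "nat \<Rightarrow> 'v \<Rightarrow>\<^sub>0 nat"
  assumes "finite V" "\<And>i. supp (s i) \<subseteq> V"
  shows "\<exists>i j d. i < j \<and> s j = s i + d"
proof -
  have "\<exists>r :: nat \<Rightarrow> nat. strict_mono r \<and> (\<forall>v\<in>W. incseq (\<lambda>i. cf (s (r i)) v))" if "finite W" for W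
    using that
  proof (induction W rule: finite_induct)
    case empty
    show ?case by (intro exI[of _ id]) (simp add: strict_mono_def)
  next
    case (insert v W)
    then obtain r :: "nat \<Rightarrow> nat" where r: "strict_mono r" "\<forall>v\<in>W. incseq (\<lambda>i. cf (s (r i)) v)" by blast
    obtain r' :: "nat \<Rightarrow> nat" where r': "strict_mono r'" "incseq (\<lambda>i. cf (s (r (r' i))) v)"
      using nat_seq_incseq_subseq[of "\<lambda>i. cf (s (r i)) v"] by blast
    have "strict_mono (r \<circ> r')" using r(1) r'(1) by (rule strict_mono_o)
    moreover have "incseq (\<lambda>i. cf (s (r (r' i))) u)" if "u \<in> insert v W" for u
    proof (cases "u = v")
      case False
      then have inc: "incseq (\<lambda>i. cf (s (r i)) u)" using r that by auto
      show ?thesis unfolding incseq_def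
        using incseqD[OF inc] strict_mono_leD[OF r'(1)] by blast
    qed (use r' in simp)
    ultimately show ?case by (intro exI[of _ "r \<circ> r'"]) (simp add: o_def)
  qed
  from this[OF assms(1)] obtain r :: "nat \<Rightarrow> nat" where
    r: "strict_mono r" "\<forall>v\<in>V. incseq (\<lambda>i. cf (s (r i)) v)" by blast
  have "s (r 1) = s (r 0) + (s (r 1) - s (r 0))"
  proof (rule poly_mapping_eqI)
    fix v
    have "cf (s (r 0)) v \<le> cf (s (r 1)) v"
    proof (cases "v \<in> V")
      case True
      then show ?thesis using r(2) by (auto simp: incseq_def)
    next
      case False
      then have "cf (s (r 0)) v = 0" using assms(2)[of "r 0"] by (auto simp: in_keys_iff)
      then show ?thesis by simp
    qed
    then show "cf (s (r 1)) v = cf (s (r 0) + (s (r 1) - s (r 0))) v"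
      by (simp add: lookup_add lookup_minus)
  qed
  moreover have "r 0 < r 1" using r(1) by (simp add: strict_mono_def)
  ultimately show ?thesis by blast
qed

text \<open>The argument \<open>K\<close> only fixes the coefficient field as a type. The linear
  order on the variables provides the monomial order.\<close>

locale poly_vars =
  fixes V :: "'v::linorder set" and K :: "'k::field itself"
  assumes finite_V: "finite V"
begin

section \<open>Ideals, prime ideals and colon ideals of the polynomial ring\<close>

abbreviation A :: "('v, 'k) mpoly set" where "A \<equiv> polys V"

definition idl :: "('v, 'k) mpoly set \<Rightarrow> bool" where
  "idl J \<longleftrightarrow> J \<subseteq> A \<and> 0 \<in> J \<and> (\<forall>x\<in>J. \<forall>y\<in>J. x + y \<in> J) \<and> (\<forall>a\<in>A. \<forall>x\<in>J. a * x \<in> J)"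

definition prm :: "('v, 'k) mpoly set \<Rightarrow> bool" where
  "prm P \<longleftrightarrow> idl P \<and> 1 \<notin> P \<and> (\<forall>a\<in>A. \<forall>b\<in>A. a * b \<in> P \<longrightarrow> a \<in> P \<or> b \<in> P)"

definition adj :: "('v, 'k) mpoly set \<Rightarrow> ('v, 'k) mpoly \<Rightarrow> ('v, 'k) mpoly set" where
  "adj J g = {j + g * q | j q. j \<in> J \<and> q \<in> A}"

definition nzd :: "('v, 'k) mpoly set \<Rightarrow> ('v, 'k) mpoly \<Rightarrow> bool" where
  "nzd J g \<longleftrightarrow> (\<forall>u\<in>A. g * u \<in> J \<longrightarrow> u \<in> J)"

definition colon :: "('v, 'k) mpoly set \<Rightarrow> ('v, 'k) mpoly \<Rightarrow> ('v, 'k) mpoly set" where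
  "colon J u = {a \<in> A. a * u \<in> J}"

lemma idlI:
  assumes "J \<subseteq> A" "0 \<in> J" "\<And>x y. x \<in> J \<Longrightarrow> y \<in> J \<Longrightarrow> x + y \<in> J" "\<And>a x. a \<in> A \<Longrightarrow> x \<in> J \<Longrightarrow> a * x \<in> J"
  shows "idl J"
  using assms by (auto simp: idl_def)

lemma idl_sub: "idl J \<Longrightarrow> x \<in> J \<Longrightarrow> x \<in> A"
  and idl_zero: "idl J \<Longrightarrow> 0 \<in> J"
  and idl_add: "idl J \<Longrightarrow> x \<in> J \<Longrightarrow> y \<in> J \<Longrightarrow> x + y \<in> J"
  and idl_mult: "idl J \<Longrightarrow> a \<in> A \<Longrightarrow> x \<in> J \<Longrightarrow> a * x \<in> J"
  by (auto simp: idl_def)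

lemma idl_mult_right: "idl J \<Longrightarrow> a \<in> A \<Longrightarrow> x \<in> J \<Longrightarrow> x * a \<in> J"
  by (simp add: idl_mult mult.commute)

lemma idl_uminus: "idl J \<Longrightarrow> x \<in> J \<Longrightarrow> - x \<in> J"
  using idl_mult[of J "- 1" x] by (simp add: polys_uminus)

lemma idl_diff: "idl J \<Longrightarrow> x \<in> J \<Longrightarrow> y \<in> J \<Longrightarrow> x - y \<in> J"
  using idl_add[of J x "- y"] idl_uminus[of J y] by simp

lemma idl_sum: "idl J \<Longrightarrow> (\<And>i. i \<in> Z \<Longrightarrow> f i \<in> J) \<Longrightarrow> sum f Z \<in> J"
  by (induction Z rule: infinite_finite_induct) (auto intro: idl_add idl_zero)

lemma idl_add_cancel: "idl J \<Longrightarrow> x + y \<in> J \<Longrightarrow> y \<in> J \<Longrightarrow> x \<in> J"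
  using idl_diff[of J "x + y" y] by simp

lemma idl_diff_cancel: "idl J \<Longrightarrow> x - y \<in> J \<Longrightarrow> y \<in> J \<Longrightarrow> x \<in> J"
  using idl_add[of J "x - y" y] by simp

lemma idl_zero_ideal: "idl {0}"
  by (rule idlI) auto

lemma adj_idl: "idl J \<Longrightarrow> g \<in> A \<Longrightarrow> idl (adj J g)"
proof (rule idlI)
  assume J: "idl J" and g: "g \<in> A"
  show "adj J g \<subseteq> A" using J g by (auto simp: adj_def dest: idl_sub)
  show "0 \<in> adj J g" using idl_zero[OF J] by (force simp: adj_def)
  show "x + y \<in> adj J g" if "x \<in> adj J g" "y \<in> adj J g" for x y
  proof -
    from that obtain j q j' q' where "j \<in> J" "q \<in> A" "j' \<in> J" "q' \<in> A" "x = j + g * q" "y = j' + g * q'"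
      by (auto simp: adj_def)
    then show ?thesis unfolding adj_def using J
      by (intro CollectI exI[of _ "j + j'"] exI[of _ "q + q'"]) (auto simp: algebra_simps intro: idl_add)
  qed
  show "a * x \<in> adj J g" if "a \<in> A" "x \<in> adj J g" for a x
  proof -
    from that obtain j q where "j \<in> J" "q \<in> A" "x = j + g * q"
      by (auto simp: adj_def)
    then show ?thesis unfolding adj_def using J that
      by (intro CollectI exI[of _ "a * j"] exI[of _ "a * q"]) (auto simp: algebra_simps intro: idl_mult)
  qed
qed

lemma adj_sub: "idl J \<Longrightarrow> J \<subseteq> adj J g"
  unfolding adj_def by (force intro: exI[of _ 0])

lemma adj_mem: "idl J \<Longrightarrow> g \<in> adj J g"
  unfolding adj_def using idl_zero[of J] by (intro CollectI exI[of _ 0] exI[of _ 1]) auto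

lemma adj_least: "idl L \<Longrightarrow> J \<subseteq> L \<Longrightarrow> g \<in> L \<Longrightarrow> adj J g \<subseteq> L"
  by (auto simp: adj_def intro!: idl_add idl_mult_right)

lemma adj_mono: "J \<subseteq> L \<Longrightarrow> adj J g \<subseteq> adj L g"
  by (auto simp: adj_def)

lemma adj_comm: "idl J \<Longrightarrow> g \<in> A \<Longrightarrow> h \<in> A \<Longrightarrow> adj (adj J g) h = adj (adj J h) g"
proof -
  have "adj (adj J g) h \<subseteq> adj (adj J h) g" if "idl J" "g \<in> A" "h \<in> A" for g h
  proof -
    have J: "idl (adj J h)" "idl (adj (adj J h) g)" using that adj_idl by auto
    have "adj J g \<subseteq> adj (adj J h) g" using that by (intro adj_mono adj_sub)
    moreover have "h \<in> adj (adj J h) g" using adj_mem[OF that(1), of h] adj_sub[OF J(1)] by blast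
    ultimately show ?thesis using adj_least[OF J(2)] by blast
  qed
  then show "idl J \<Longrightarrow> g \<in> A \<Longrightarrow> h \<in> A \<Longrightarrow> ?thesis" by (meson subset_antisym)
qed

lemma colon_idl: "idl J \<Longrightarrow> u \<in> A \<Longrightarrow> idl (colon J u)"
  by (rule idlI) (auto simp: colon_def idl_zero distrib_right mult.assoc intro: idl_add idl_mult)

lemma colon_sub: "idl J \<Longrightarrow> u \<in> A \<Longrightarrow> J \<subseteq> colon J u"
  by (auto simp: colon_def intro: idl_mult_right idl_sub)

lemma idl_one_iff: "idl J \<Longrightarrow> 1 \<in> J \<longleftrightarrow> J = A"
  using idl_mult[of J _ 1] idl_sub[of J] by force

lemma prm_idl: "prm P \<Longrightarrow> idl P"
  and prm_one: "prm P \<Longrightarrow> 1 \<notin> P"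
  and prm_mult: "prm P \<Longrightarrow> a \<in> A \<Longrightarrow> b \<in> A \<Longrightarrow> a * b \<in> P \<Longrightarrow> a \<in> P \<or> b \<in> P"
  by (auto simp: prm_def)

lemma prm_nzd: "prm P \<Longrightarrow> g \<in> A \<Longrightarrow> g \<notin> P \<Longrightarrow> nzd P g"
  unfolding nzd_def using prm_mult by blast

lemma prm_prod:
  assumes "prm P" "finite Z" "\<And>i. i \<in> Z \<Longrightarrow> f i \<in> A \<and> f i \<notin> P"
  shows "prod f Z \<notin> P \<and> prod f Z \<in> A"
  using assms(2,3)
proof (induction Z rule: finite_induct)
  case (insert i Z)
  then show ?case using prm_mult[OF assms(1), of "f i" "prod f Z"] by auto
qed (use prm_one[OF assms(1)] in simp)

lemma prm_power: "prm P \<Longrightarrow> f \<in> A \<Longrightarrow> f \<notin> P \<Longrightarrow> f ^ n \<notin> P"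
  by (induction n) (auto dest: prm_one prm_mult)

definition mons :: "('v \<Rightarrow>\<^sub>0 nat) set" where
  "mons = {m. supp m \<subseteq> V}"

lemma mons_add [simp]: "a + b \<in> mons \<longleftrightarrow> a \<in> mons \<and> b \<in> mons"
  by (auto simp: mons_def keys_add_nat)

lemma polys_mons: "p \<in> A \<Longrightarrow> m \<in> supp p \<Longrightarrow> m \<in> mons"
  by (auto simp: polys_def mons_def)

lemma mon_mons [simp]: "m \<in> mons \<Longrightarrow> Poly_Mapping.single m c \<in> A"
  by (simp add: mons_def)

lemma inj_lookup_mons: "inj_on (\<lambda>m. restrict (cf m) V) mons"
proof (rule inj_onI)
  fix m m' assume m: "m \<in> mons" "m' \<in> mons" and eq: "restrict (cf m) V = restrict (cf m') V"
  show "m = m'"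
  proof (rule poly_mapping_eqI)
    fix v
    show "cf m v = cf m' v"
    proof (cases "v \<in> V")
      case True
      then show ?thesis using fun_cong[OF eq, of v] by simp
    next
      case False
      then have "v \<notin> supp m" "v \<notin> supp m'" using m by (auto simp: mons_def)
      then show ?thesis by (simp add: in_keys_iff)
    qed
  qed
qed

lemma card_mons_box:
  assumes "\<And>m. m \<in> N \<Longrightarrow> m \<in> mons"
    and "\<And>m v. m \<in> N \<Longrightarrow> v \<in> V \<Longrightarrow> cf m v \<le> b v"
  shows "finite N \<and> card N \<le> (\<Prod>v\<in>V. b v + 1)"
proof -
  let ?P = "PiE V (\<lambda>v. {..b v})"
  have sub: "(\<lambda>m. restrict (cf m) V) ` N \<subseteq> ?P" using assms(2) by auto
  have fin: "finite ?P" by (intro finite_PiE finite_V) auto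
  have inj: "inj_on (\<lambda>m. restrict (cf m) V) N"
    using inj_lookup_mons by (rule inj_on_subset) (use assms(1) in auto)
  have "finite N" using finite_imageD[OF finite_subset[OF sub fin] inj] .
  moreover have "card N \<le> card ?P"
    using card_mono[OF fin sub] card_image[OF inj] by simp
  moreover have "card ?P = (\<Prod>v\<in>V. b v + 1)" by (simp add: card_PiE finite_V)
  ultimately show ?thesis by simp
qed

lemma finite_mons_deg: "finite {m \<in> mons. deg m \<le> t}"
proof -
  have "cf m v \<le> t" if "deg m \<le> t" for m :: "'v \<Rightarrow>\<^sub>0 nat" and v
    using that lookup_le_deg[of m v] by linarith
  then show ?thesis using card_mons_box[of "{m \<in> mons. deg m \<le> t}" "\<lambda>_. t"] by blast
qed

definition rank :: "('v \<Rightarrow>\<^sub>0 nat) \<Rightarrow> nat" where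
  "rank m = card {k \<in> mons. gkey k < gkey m}"

lemma rank_less:
  assumes "a \<in> mons" "gkey a < gkey b"
  shows "rank a < rank b"
proof -
  have fin: "finite {k \<in> mons. gkey k < gkey b}"
    by (rule finite_subset[OF _ finite_mons_deg[of "deg b"]]) (use gkey_less_deg[of _ b] in blast)
  have sub: "{k \<in> mons. gkey k < gkey a} \<subseteq> {k \<in> mons. gkey k < gkey b}"
    using less_trans[OF _ assms(2)] by blast
  have "a \<in> {k \<in> mons. gkey k < gkey b}" "a \<notin> {k \<in> mons. gkey k < gkey a}"
    using assms by simp_all
  then have "{k \<in> mons. gkey k < gkey a} \<noteq> {k \<in> mons. gkey k < gkey b}" by metis
  with sub have "{k \<in> mons. gkey k < gkey a} \<subset> {k \<in> mons. gkey k < gkey b}" by (rule psubsetI)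
  from psubset_card_mono[OF fin this] show ?thesis by (simp only: rank_def)
qed

text \<open>Hilbert's basis theorem: choosing in each step of an ascending chain a new element with
  minimal leading monomial, Dickson's lemma yields two whose leading monomials divide, and the
  later one could be reduced.\<close>

lemma no_ascending_chain:
  assumes J: "\<And>i. idl (J i)" and asc: "\<And>i. J i \<subset> J (Suc i)"
  shows False
proof -
  have "\<exists>f. f \<in> J (Suc i) - J i \<and> (\<forall>g\<in>J (Suc i) - J i. rank (lm f) \<le> rank (lm g))" for i
  proof -
    obtain f0 where "f0 \<in> J (Suc i) - J i" using asc[of i] by blast
    from ex_has_least_nat[of "\<lambda>f. f \<in> J (Suc i) - J i", OF this, of "\<lambda>f. rank (lm f)"]
    show ?thesis by blast
  qed
  then have "\<exists>f. \<forall>i. f i \<in> J (Suc i) - J i \<and> (\<forall>g\<in>J (Suc i) - J i. rank (lm (f i)) \<le> rank (lm g))"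
    by (intro choice allI)
  then obtain f where f: "\<And>i. f i \<in> J (Suc i) - J i"
    and min: "\<And>i g. g \<in> J (Suc i) - J i \<Longrightarrow> rank (lm (f i)) \<le> rank (lm g)" by blast
  have nz: "f i \<noteq> 0" for i using f[of i] idl_zero[OF J, of i] by auto
  have fA: "f i \<in> A" for i using f[of i] idl_sub[OF J, of "f i"] by blast
  have lmm: "lm (f i) \<in> mons" for i using polys_mons[OF fA lm_in[OF nz]] .
  obtain i j d where ij: "i < j" and d: "lm (f j) = lm (f i) + d"
    using dickson[of V "\<lambda>i. lm (f i)"] finite_V lmm unfolding mons_def by blast
  have dm: "d \<in> mons" using lmm[of j] d by simp
  \<comment> \<open>The scalar for which the shifted multiple of \<open>f i\<close> has the same
    leading term as \<open>f j\<close>, so that \<open>g\<close> loses it.\<close>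
  define c where "c = cf (f j) (lm (f j)) / cf (f i) (lm (f i))"
  define h where "h = Poly_Mapping.single d c * f i"
  define g where "g = f j - h"
  have ci: "cf (f i) (lm (f i)) \<noteq> 0" using lm_in[OF nz[of i]] by (simp add: in_keys_iff)
  have step: "J n \<subseteq> J (Suc n)" for n using asc by blast
  have "J (Suc i) \<subseteq> J j" by (rule lift_Suc_mono_le[of J, OF step]) (use ij in simp)
  then have "f i \<in> J j" using f[of i] by blast
  then have "h \<in> J j" unfolding h_def by (rule idl_mult[OF J mon_mons[OF dm]])
  then have gJ: "g \<in> J (Suc j) - J j" unfolding g_def
    using f[of j] J asc[of j] idl_diff[OF J] idl_diff_cancel[OF J, of _ h j] by blast
  then have g0: "g \<noteq> 0" using idl_zero[OF J, of j] by auto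
  have lmg: "lm g \<in> supp g" using lm_in[OF g0] .
  have "cf h (lm (f j)) = cf (f j) (lm (f j))"
    using lookup_single_mult[of d c "f i" "lm (f i)"] ci
    by (simp add: h_def c_def d add.commute[of d])
  then have "cf g (lm (f j)) = 0" by (simp add: g_def lookup_minus)
  then have neq: "lm g \<noteq> lm (f j)" using lmg by (auto simp: in_keys_iff)
  have "lm g \<in> supp (f j) \<union> (\<lambda>m. d + m) ` supp (f i)"
    using lmg keys_diff[of "f j" h] supp_single_mult[of d c "f i"] unfolding g_def h_def by blast
  then have "gkey (lm g) < gkey (lm (f j))"
  proof
    assume "lm g \<in> supp (f j)"
    then show ?thesis using lm_max[OF nz] neq by blast
  next
    assume "lm g \<in> (\<lambda>m. d + m) ` supp (f i)"
    then obtain m where m: "m \<in> supp (f i)" "lm g = d + m" by blast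
    then have "m \<noteq> lm (f i)" using neq d by (auto simp: add.commute[of d])
    then show ?thesis using gkey_add_mono[OF lm_max[OF nz m(1)], of d] m(2) d by (simp add: add.commute[of d])
  qed
  moreover have "lm g \<in> mons" using polys_mons[OF idl_sub[OF J] lmg] gJ by blast
  ultimately have "rank (lm g) < rank (lm (f j))" by (intro rank_less)
  then show False using min[OF gJ] by simp
qed

lemma wf_ideals: "wf {(J', J). idl J \<and> idl J' \<and> J \<subset> J'}"
  unfolding wf_iff_no_infinite_down_chain using no_ascending_chain by blast

lemma noeth_max:
  assumes "J0 \<in> F" "\<And>J. J \<in> F \<Longrightarrow> idl J"
  shows "\<exists>J\<in>F. J0 \<subseteq> J \<and> (\<forall>L\<in>F. J \<subseteq> L \<longrightarrow> L = J)"
proof -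
  let ?F = "{J \<in> F. J0 \<subseteq> J}"
  have "J0 \<in> ?F" using assms by blast
  then obtain J where J: "J \<in> ?F" "\<And>L. (L, J) \<in> {(J', J). idl J \<and> idl J' \<and> J \<subset> J'} \<Longrightarrow> L \<notin> ?F"
    by (rule wfE_min[OF wf_ideals]) blast
  have "L = J" if "L \<in> F" "J \<subseteq> L" for L
  proof (rule ccontr)
    assume "L \<noteq> J"
    then have "(L, J) \<in> {(J', J). idl J \<and> idl J' \<and> J \<subset> J'}"
      using that J(1) assms(2) by blast
    with J that show False by blast
  qed
  with J(1) show ?thesis by blast
qed

section \<open>Dimension by counting\<close>

lemma const_A [simp]: "const c \<in> A"
  by simp

lemma idl_const: "idl J \<Longrightarrow> x \<in> J \<Longrightarrow> const c * x \<in> J"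
  by (rule idl_mult) simp_all

definition dbd :: "nat \<Rightarrow> ('v, 'k) mpoly set" where
  "dbd t = {p \<in> A. \<forall>m\<in>supp p. deg m \<le> t}"

lemma dbd_subspace: "mpv.subspace (dbd t)"
proof (rule mpv.subspaceI)
  show "x + y \<in> dbd t" if "x \<in> dbd t" "y \<in> dbd t" for x y
    using that Poly_Mapping.keys_add[of x y] by (fastforce simp: dbd_def)
  show "const c * x \<in> dbd t" if "x \<in> dbd t" for c x
    using that by (auto simp: dbd_def in_keys_iff)
qed (simp add: dbd_def)

lemma dbd_mult: "p \<in> dbd s \<Longrightarrow> q \<in> dbd t \<Longrightarrow> p * q \<in> dbd (s + t)"
  unfolding dbd_def using keys_mult[of p q] by (fastforce intro: add_mono)

lemma dbd_power: "p \<in> dbd s \<Longrightarrow> p ^ n \<in> dbd (n * s)"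
  by (induction n) (auto intro: dbd_mult, simp add: dbd_def)

lemma dbd_mono: "s \<le> t \<Longrightarrow> dbd s \<subseteq> dbd t"
  by (auto simp: dbd_def)

lemma dbd_ex: "p \<in> A \<Longrightarrow> \<exists>t. p \<in> dbd t"
  using wcomp_bound_ex[of "{p}" unit_wt] by (auto simp: dbd_def)

text \<open>The affine Hilbert function of \<open>S/J\<close> is at most \<open>C (t + 1)^d\<close>.\<close>

definition grow :: "(nat \<Rightarrow> ('v, 'k) mpoly set) \<Rightarrow> ('v, 'k) mpoly set \<Rightarrow> nat \<Rightarrow> nat \<Rightarrow> bool" where
  "grow D J C d \<longleftrightarrow> (\<forall>t. \<exists>Y. finite Y \<and> Y \<subseteq> D t \<and> card Y \<le> C * (t + 1) ^ d \<and>
     (\<forall>p\<in>dbd t. \<exists>y\<in>mpv.span Y. p - y \<in> J))"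

definition indep :: "'v set \<Rightarrow> ('v, 'k) mpoly set \<Rightarrow> bool" where
  "indep U J \<longleftrightarrow> U \<subseteq> V \<and> (\<forall>p\<in>J. p \<in> polys U \<longrightarrow> p = 0)"

text \<open>The dimension of \<open>S/J\<close>, as the largest number of variables that are algebraically
  independent modulo \<open>J\<close>; meaningless when \<open>J\<close> is the unit ideal.\<close>

definition pdim :: "('v, 'k) mpoly set \<Rightarrow> nat" where
  "pdim J = Max {card U | U. indep U J}"

text \<open>Lets representatives in the span of \<open>Y\<close> be searched for monomial by
  monomial.\<close>

lemma near_span_subspace: "idl J \<Longrightarrow> mpv.subspace {p. \<exists>y\<in>mpv.span Y. p - y \<in> J}"
proof (rule mpv.subspaceI)
  assume J: "idl J"
  show "0 \<in> {p. \<exists>y\<in>mpv.span Y. p - y \<in> J}"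
    using idl_zero[OF J] mpv.span_zero[of Y] by force
  show "p + q \<in> {p. \<exists>y\<in>mpv.span Y. p - y \<in> J}"
    if "p \<in> {p. \<exists>y\<in>mpv.span Y. p - y \<in> J}" "q \<in> {p. \<exists>y\<in>mpv.span Y. p - y \<in> J}" for p q
  proof -
    from that obtain y z where "y \<in> mpv.span Y" "z \<in> mpv.span Y" "p - y \<in> J" "q - z \<in> J" by blast
    then have "y + z \<in> mpv.span Y" "(p - y) + (q - z) \<in> J" using J by (auto intro: mpv.span_add idl_add)
    then show ?thesis by (intro CollectI bexI[of _ "y + z"]) (simp_all add: algebra_simps)
  qed
  show "const c * p \<in> {p. \<exists>y\<in>mpv.span Y. p - y \<in> J}"
    if "p \<in> {p. \<exists>y\<in>mpv.span Y. p - y \<in> J}" for c p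
  proof -
    from that obtain y where "y \<in> mpv.span Y" "p - y \<in> J" by blast
    then have "const c * y \<in> mpv.span Y" "const c * (p - y) \<in> J"
      using J by (auto intro: mpv.span_scale idl_const)
    then show ?thesis by (intro CollectI bexI[of _ "const c * y"]) (simp_all add: algebra_simps)
  qed
qed

lemma mon_expand: "p = (\<Sum>m\<in>supp p. const (cf p m) * mon m)"
  by (subst poly_as_sum) (simp add: mult_single)

text \<open>For each set \<open>U\<close> of \<open>d + 1\<close> variables, \<open>J\<close>
  contains a nonzero polynomial \<open>P U\<close> in these variables alone. Modulo
  \<open>J\<close>, the monomials divisible by no \<open>lm (P U)\<close> span everything, and such
  a monomial has exponents above \<open>E\<close> in at most \<open>d\<close> variables, since
  otherwise some \<open>lm (P U)\<close> would divide it. Only these exponents can grow with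
  \<open>t\<close>, which gives the factor \<open>(t + 1) ^ d\<close>.\<close>

lemma grow_exists:
  assumes J: "idl J" and dep: "\<And>U. U \<subseteq> V \<Longrightarrow> card U = Suc d \<Longrightarrow> \<not> indep U J"
  shows "\<exists>C. grow dbd J C d"
proof -
  define F where "F = {U. U \<subseteq> V \<and> card U = Suc d}"
  have finF: "finite F" unfolding F_def by (rule finite_subset[of _ "Pow V"]) (auto simp: finite_V)
  have "\<exists>p. p \<in> J \<and> p \<in> polys U \<and> p \<noteq> 0" if "U \<in> F" for U
    using dep[of U] that by (auto simp: F_def indep_def)
  then have "\<exists>P. \<forall>U\<in>F. P U \<in> J \<and> P U \<in> polys U \<and> P U \<noteq> 0" by (intro bchoice ballI)
  then obtain P where P: "\<And>U. U \<in> F \<Longrightarrow> P U \<in> J" "\<And>U. U \<in> F \<Longrightarrow> P U \<in> polys U"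
    "\<And>U. U \<in> F \<Longrightarrow> P U \<noteq> 0" by blast
  \<comment> \<open>A sum bounds all these degrees and is also defined when \<open>F\<close> is
    empty.\<close>
  define E where "E = (\<Sum>U\<in>F. deg (lm (P U)))"
  have E: "deg (lm (P U)) \<le> E" if "U \<in> F" for U
    unfolding E_def by (rule member_le_sum) (use that finF in auto)
  define N where "N t = {m \<in> mons. deg m \<le> t \<and> (\<forall>U\<in>F. \<forall>e. m \<noteq> lm (P U) + e)}" for t
  have finN: "finite (N t)" for t by (rule finite_subset[OF _ finite_mons_deg[of t]]) (auto simp: N_def)
  have red: "m \<in> mons \<Longrightarrow> deg m \<le> t \<Longrightarrow> \<exists>y\<in>mpv.span (mon ` N t). mon m - y \<in> J" for m t
  proof (induction m rule: measure_induct_rule[of rank])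
    case (less m)
    let ?S = "{p. \<exists>y\<in>mpv.span (mon ` N t). p - y \<in> J}"
    show ?case
    proof (cases "m \<in> N t")
      case True
      then show ?thesis using idl_zero[OF J] by (intro bexI[of _ "mon m"]) (auto intro: mpv.span_base)
    next
      case False
      then obtain U e where U: "U \<in> F" and m: "m = lm (P U) + e" using less.prems by (auto simp: N_def)
      have em: "e \<in> mons" using less.prems m by simp
      define a where "a = cf (P U) (lm (P U))"
      have a: "a \<noteq> 0" using lm_in[OF P(3)[OF U]] by (simp add: a_def in_keys_iff)
      \<comment> \<open>Scaled and shifted so that its leading term is \<open>mon m\<close>.
        Subtracting it from \<open>mon m\<close> leaves only smaller monomials, to which the
        induction hypothesis applies.\<close>
      define q where "q = Poly_Mapping.single e (1 / a) * P U"
      have qJ: "q \<in> J" unfolding q_def by (rule idl_mult[OF J mon_mons[OF em] P(1)[OF U]])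
      have cq: "cf q m = 1" unfolding q_def m
        using lookup_single_mult[of e "1/a" "P U" "lm (P U)"] a by (simp add: a_def add.commute[of e])
      have "mon k \<in> ?S" if k: "k \<in> supp (mon m - q)" for k
      proof -
        have km: "k \<noteq> m" using k cq by (auto simp: in_keys_iff lookup_minus)
        then have "k \<in> supp q" using k by (auto simp: in_keys_iff lookup_minus lookup_single_not_eq)
        then obtain l where l: "l \<in> supp (P U)" "k = e + l"
          using supp_single_mult[of e "1/a" "P U"] by (auto simp: q_def)
        then have "l \<noteq> lm (P U)" using km m by (auto simp: add.commute)
        then have gk: "gkey k < gkey m"
          using gkey_add_mono[OF lm_max[OF P(3)[OF U] l(1)], of e] l(2) m by (simp add: add.commute)
        have "supp l \<subseteq> V" using P(2)[OF U] l(1) U unfolding polys_def F_def by blast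
        then have kmons: "k \<in> mons" using l(2) em by (simp add: mons_def keys_add_nat)
        have "deg k \<le> t" using gkey_less_deg[OF gk] less.prems(2) by simp
        then show ?thesis using less.IH[OF rank_less[OF kmons gk] kmons] by simp
      qed
      then have "(\<Sum>k\<in>supp (mon m - q). const (cf (mon m - q) k) * mon k) \<in> ?S"
        by (intro mpv.subspace_sum[OF near_span_subspace[OF J]] mpv.subspace_scale[OF near_span_subspace[OF J]])
      then have 1: "mon m - q \<in> ?S" using mon_expand[of "mon m - q"] by simp
      have 2: "q \<in> ?S" using qJ mpv.span_zero by force
      have "(mon m - q) + q \<in> ?S" using mpv.subspace_add[OF near_span_subspace[OF J] 1 2] .
      then show ?thesis by simp
    qed
  qed
  have red': "\<exists>y\<in>mpv.span (mon ` N t). p - y \<in> J" if "p \<in> dbd t" for p t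
  proof -
    let ?S = "{p. \<exists>y\<in>mpv.span (mon ` N t). p - y \<in> J}"
    have "mon m \<in> ?S" if m: "m \<in> supp p" for m
      using red[of m t] polys_mons[of p m] m \<open>p \<in> dbd t\<close> by (auto simp: dbd_def)
    then have "(\<Sum>k\<in>supp p. const (cf p k) * mon k) \<in> ?S"
      by (intro mpv.subspace_sum[OF near_span_subspace[OF J]] mpv.subspace_scale[OF near_span_subspace[OF J]])
    then show ?thesis using mon_expand[of p] by simp
  qed
  \<comment> \<open>\<open>card (Pow V)\<close> bounds the number of sets of variables with large
    exponents, and \<open>(E + 1) ^ card V\<close> the choices for the small exponents.\<close>
  define C where "C = card (Pow V) * (E + 1) ^ card V"
  have cardN: "card (N t) \<le> C * (t + 1) ^ d" for t
  proof -
    define T where "T = {T. T \<subseteq> V \<and> card T \<le> d}"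
    define B where "B W = {m \<in> mons. \<forall>v\<in>V. cf m v \<le> (if v \<in> W then t else E)}" for W
    have finT: "finite T" unfolding T_def by (rule finite_subset[of _ "Pow V"]) (auto simp: finite_V)
    have B: "finite (B W)" "card (B W) \<le> (t + 1) ^ d * (E + 1) ^ card V" if "W \<in> T" for W
    proof -
      have W: "W \<subseteq> V" "card W \<le> d" using that by (auto simp: T_def)
      have 1: "finite (B W) \<and> card (B W) \<le> (\<Prod>v\<in>V. (if v \<in> W then t else E) + 1)"
        by (rule card_mons_box) (auto simp: B_def)
      have "(\<Prod>v\<in>V. (if v \<in> W then t else E) + 1) = (\<Prod>v\<in>V. if v \<in> W then t + 1 else E + 1)"
        by (rule prod.cong) auto
      also have "\<dots> = (t + 1) ^ card (V \<inter> W) * (E + 1) ^ card (V - W)"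
        by (simp add: prod.If_cases finite_V Diff_eq)
      also have "\<dots> \<le> (t + 1) ^ d * (E + 1) ^ card V"
        using W by (intro mult_mono power_increasing) (auto simp: Int_absorb1 finite_V intro: card_mono)
      finally show "finite (B W)" "card (B W) \<le> (t + 1) ^ d * (E + 1) ^ card V" using 1 by auto
    qed
    have "N t \<subseteq> (\<Union>W\<in>T. B W)"
    proof
      fix m assume m: "m \<in> N t"
      define W where "W = {v \<in> V. cf m v > E}"
      have "W \<in> T"
      proof (rule ccontr)
        assume "W \<notin> T"
        then have "Suc d \<le> card W" by (auto simp: T_def W_def)
        then obtain U where U: "U \<subseteq> W" "card U = Suc d" using obtain_subset_with_card_n by metis
        then have UF: "U \<in> F" by (auto simp: F_def W_def)
        have "cf (lm (P U)) v \<le> cf m v" for v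
        proof (cases "v \<in> U")
          case True
          then have "E < cf m v" using U by (auto simp: W_def)
          then show ?thesis using lookup_le_deg[of "lm (P U)" v] E[OF UF] by simp
        next
          case False
          then have "v \<notin> supp (lm (P U))" using P(2)[OF UF] lm_in[OF P(3)[OF UF]] by (auto simp: polys_def)
          then show ?thesis by (simp add: in_keys_iff)
        qed
        then have "m = lm (P U) + (m - lm (P U))"
          by (intro poly_mapping_eqI) (simp add: lookup_add lookup_minus)
        then show False using m UF by (auto simp: N_def)
      qed
      moreover have "cf m v \<le> t" for v using m lookup_le_deg[of m v] by (simp add: N_def)
      then have "m \<in> B W" unfolding B_def W_def using m by (auto simp: N_def)
      ultimately show "m \<in> (\<Union>W\<in>T. B W)" by blast
    qed
    then have "card (N t) \<le> card (\<Union>W\<in>T. B W)" using finT B(1) by (intro card_mono) auto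
    also have "\<dots> \<le> (\<Sum>W\<in>T. card (B W))" by (rule card_UN_le[OF finT])
    also have "\<dots> \<le> (\<Sum>W\<in>T. (t + 1) ^ d * (E + 1) ^ card V)" by (rule sum_mono) (rule B(2))
    also have "\<dots> = card T * ((t + 1) ^ d * (E + 1) ^ card V)" by simp
    also have "\<dots> \<le> card (Pow V) * ((t + 1) ^ d * (E + 1) ^ card V)"
      by (intro mult_right_mono card_mono) (auto simp: T_def finite_V)
    finally show ?thesis by (simp add: C_def algebra_simps)
  qed
  have "grow dbd J C d" unfolding grow_def
  proof
    fix t
    have "mon ` N t \<subseteq> dbd t" by (auto simp: N_def dbd_def mons_def)
    moreover have "card (mon ` N t :: ('v, 'k) mpoly set) \<le> C * (t + 1) ^ d"
      by (rule le_trans[OF card_image_le[OF finN] cardN])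
    ultimately show "\<exists>Y. finite Y \<and> Y \<subseteq> dbd t \<and> card Y \<le> C * (t + 1) ^ d \<and>
       (\<forall>p\<in>dbd t. \<exists>y\<in>mpv.span Y. p - y \<in> J)"
      using finN red' by (intro exI[of _ "mon ` N t"]) auto
  qed
  then show ?thesis ..
qed

text \<open>Each \<open>f x\<close> is replaced by a congruent \<open>h x\<close> in the span of
  \<open>Y\<close>. A linear relation among the \<open>h x\<close> is a relation among the
  \<open>f x\<close> modulo \<open>J\<close>, so the new family is independent.\<close>

lemma indep_family_bound:
  assumes J: "idl J" and fin: "finite Z" "finite Y"
    and near: "\<And>x. x \<in> Z \<Longrightarrow> \<exists>y\<in>mpv.span Y. f x - y \<in> J"
    and ind: "\<And>c. (\<Sum>x\<in>Z. const (c x) * f x) \<in> J \<Longrightarrow> \<forall>x\<in>Z. c x = 0"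
  shows "card Z \<le> card Y"
proof -
  from near have "\<exists>h. \<forall>x\<in>Z. h x \<in> mpv.span Y \<and> f x - h x \<in> J" by (intro bchoice) blast
  then obtain h where h: "\<And>x. x \<in> Z \<Longrightarrow> h x \<in> mpv.span Y" "\<And>x. x \<in> Z \<Longrightarrow> f x - h x \<in> J" by blast
  have key: "\<forall>x\<in>Z. c x = 0" if "(\<Sum>x\<in>Z. const (c x) * h x) = 0" for c
  proof (rule ind)
    have "(\<Sum>x\<in>Z. const (c x) * f x) = (\<Sum>x\<in>Z. const (c x) * (f x - h x))"
      using that by (simp add: right_diff_distrib sum_subtractf)
    also have "\<dots> \<in> J" by (intro idl_sum[OF J] idl_const[OF J] h)
    finally show "(\<Sum>x\<in>Z. const (c x) * f x) \<in> J" .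
  qed
  have inj: "inj_on h Z"
  proof (rule inj_onI, rule ccontr)
    fix x y assume xy: "x \<in> Z" "y \<in> Z" "h x = h y" "x \<noteq> y"
    \<comment> \<open>The family is indexed, so equal values \<open>h x = h y\<close> already form a
      relation, with coefficients 1 and -1.\<close>
    let ?c = "\<lambda>z. if z = x then 1 else if z = y then - 1 else (0::'k)"
    have "(\<Sum>z\<in>Z. const (?c z) * h z) = (\<Sum>z\<in>{x, y}. const (?c z) * h z)"
      using xy by (intro sum.mono_neutral_right fin) auto
    also have "\<dots> = 0" using xy by (simp add: single_uminus)
    finally have "\<forall>z\<in>Z. ?c z = 0" by (rule key)
    with xy show False by auto
  qed
  have "mpv.independent (h ` Z)"
    unfolding mpv.independent_explicit_finite_subsets
  proof (intro allI impI ballI)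
    fix T u v assume T: "T \<subseteq> h ` Z" "finite T" "(\<Sum>v\<in>T. const (u v) * v) = 0" "v \<in> T"
    obtain x where x: "x \<in> Z" "v = h x" using T by blast
    let ?c = "\<lambda>z. if h z \<in> T then u (h z) else 0"
    have "(\<Sum>z\<in>Z. const (?c z) * h z) = (\<Sum>w\<in>h ` Z. const (if w \<in> T then u w else 0) * w)"
      by (simp add: sum.reindex[OF inj] o_def)
    also have "\<dots> = (\<Sum>v\<in>T. const (u v) * v)"
      using T by (intro sum.mono_neutral_cong_right) (auto simp: fin)
    finally have "\<forall>z\<in>Z. ?c z = 0" using T(3) by (intro key) simp
    then show "u v = 0" using x T(4) by auto
  qed
  moreover have "h ` Z \<subseteq> mpv.span Y" using h by auto
  ultimately have "card (h ` Z) \<le> card Y" using mpv.independent_span_bound[OF fin(2)] by blast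
  then show ?thesis by (simp add: card_image inj)
qed

lemma exponent_bound:
  assumes "\<And>t :: nat. (t + 1) ^ k \<le> C * (c * t + 1) ^ d"
  shows "k \<le> d"
proof (rule ccontr)
  assume "\<not> k \<le> d"
  \<comment> \<open>For this \<open>t\<close> the right-hand side is at most
    \<open>(t + 1) ^ d * t\<close>, which lies below \<open>(t + 1) ^ Suc d\<close>.\<close>
  define t where "t = C * (c + 1) ^ d"
  have "(t + 1) ^ d * (t + 1) = (t + 1) ^ Suc d" by simp
  also have "\<dots> \<le> (t + 1) ^ k" using \<open>\<not> k \<le> d\<close> by (intro power_increasing) auto
  also have "\<dots> \<le> C * (c * t + 1) ^ d" by (rule assms)
  also have "\<dots> \<le> C * ((c + 1) * (t + 1)) ^ d"
    by (intro mult_left_mono power_mono) (auto simp: algebra_simps)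
  also have "\<dots> = (t + 1) ^ d * t" by (simp only: t_def power_mult_distrib mult_ac)
  finally show False by simp
qed

text \<open>The comparison behind the dimension inequalities: a family of order \<open>t ^ k\<close>
  that is independent modulo \<open>J\<close> and has degrees linear in \<open>t\<close> does not
  fit into growth of a smaller order.\<close>

lemma grow_family_bound:
  assumes J: "idl J" and grow: "grow D J C d"
    and Z: "\<And>t. finite (Z t)" "\<And>t. (t + 1) ^ k \<le> card (Z t)" "\<And>t x. x \<in> Z t \<Longrightarrow> f t x \<in> dbd (c * t)"
    and ind: "\<And>t a. (\<Sum>x\<in>Z t. const (a x) * f t x) \<in> J \<Longrightarrow> \<forall>x\<in>Z t. a x = 0"
  shows "k \<le> d"
proof (rule exponent_bound)
  fix t
  obtain Y where Y: "finite Y" "card Y \<le> C * (c * t + 1) ^ d"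
    "\<forall>p\<in>dbd (c * t). \<exists>y\<in>mpv.span Y. p - y \<in> J"
    using grow unfolding grow_def by blast
  have "card (Z t) \<le> card Y"
    by (rule indep_family_bound[OF J Z(1) Y(1), of t "f t"]) (use Y(3) Z(3) ind in auto)
  then show "(t + 1) ^ k \<le> C * (c * t + 1) ^ d" using Z(2)[of t] Y(2) by linarith
qed

section \<open>Independent variables and dimension\<close>

definition box :: "'v set \<Rightarrow> nat \<Rightarrow> ('v \<Rightarrow>\<^sub>0 nat) set" where
  "box U t = (\<lambda>f. \<Sum>v\<in>U. Poly_Mapping.single v (f v)) ` PiE U (\<lambda>_. {..t})"

lemma lookup_sum_single: "finite U \<Longrightarrow> cf (\<Sum>v\<in>U. Poly_Mapping.single v (f v)) u = (if u \<in> U then f u else 0)"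
  by (simp add: lookup_sum lookup_single when_def)

lemma box:
  assumes "U \<subseteq> V"
  shows finite_box: "finite (box U t)" and card_box: "card (box U t) = (t + 1) ^ card U"
    and box_supp: "m \<in> box U t \<Longrightarrow> supp m \<subseteq> U" and box_deg: "m \<in> box U t \<Longrightarrow> deg m \<le> card U * t"
proof -
  have fin: "finite U" using assms finite_V finite_subset by blast
  let ?h = "\<lambda>f. \<Sum>v\<in>U. Poly_Mapping.single v (f v :: nat)"
  show "finite (box U t)" unfolding box_def using fin by (intro finite_imageI finite_PiE) auto
  have "inj_on ?h (PiE U (\<lambda>_. {..t}))"
  proof (rule inj_onI)
    fix f g assume f: "f \<in> PiE U (\<lambda>_. {..t})" and g: "g \<in> PiE U (\<lambda>_. {..t})" and eq: "?h f = ?h g"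
    have "f u = g u" if "u \<in> U" for u
      using arg_cong[OF eq, of "\<lambda>m. cf m u"] that fin by (simp add: lookup_sum_single)
    with f g show "f = g" by (rule PiE_ext)
  qed
  then show "card (box U t) = (t + 1) ^ card U"
    unfolding box_def using fin by (simp add: card_image card_PiE)
  assume "m \<in> box U t"
  then obtain f where f: "f \<in> PiE U (\<lambda>_. {..t})" "m = ?h f" by (auto simp: box_def)
  have "v \<in> U" if "v \<in> supp m" for v
    using that fin by (cases "v \<in> U") (simp_all add: f(2) in_keys_iff lookup_sum_single)
  then show sub: "supp m \<subseteq> U" by blast
  have "deg m = (\<Sum>v\<in>U. cf m v)" using wdeg_superset[OF fin sub, of unit_wt] by simp
  also have "\<dots> = (\<Sum>v\<in>U. f v)" using fin by (intro sum.cong) (auto simp: f(2) lookup_sum_single)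
  also have "\<dots> \<le> (\<Sum>v\<in>U. t)" using f(1) by (intro sum_mono) auto
  finally show "deg m \<le> card U * t" by simp
qed

lemma lookup_mon_sum: "finite Z \<Longrightarrow> cf (\<Sum>m\<in>Z. const (c m) * mon m) k = (if k \<in> Z then c k else 0)"
  by (simp add: mult_single lookup_sum lookup_single when_def)

lemma mon_sum_eq_0: "finite Z \<Longrightarrow> (\<Sum>m\<in>Z. const (c m) * mon m) = 0 \<Longrightarrow> m \<in> Z \<Longrightarrow> c m = 0"
  using lookup_mon_sum[of Z c m] by simp

lemma mon_sum_polys: "(\<And>m. m \<in> Z \<Longrightarrow> supp m \<subseteq> U) \<Longrightarrow> (\<Sum>m\<in>Z. const (c m) * mon m) \<in> polys U"
  by (intro polys_sum) (simp add: mult_single)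

lemma indepD: "indep U J \<Longrightarrow> p \<in> J \<Longrightarrow> p \<in> polys U \<Longrightarrow> p = 0"
  by (simp add: indep_def)

lemma indep_empty: "idl J \<Longrightarrow> 1 \<notin> J \<Longrightarrow> indep {} J"
  unfolding indep_def
proof (intro conjI ballI impI)
  fix p assume J: "idl J" "1 \<notin> J" and p: "p \<in> J" "p \<in> polys {}"
  have "supp p \<subseteq> {0}" using p(2) by (auto simp: polys_def)
  then have pc: "p = const (cf p 0)"
    by (intro poly_mapping_eqI) (auto simp: lookup_single when_def in_keys_iff)
  show "p = 0"
  proof (rule ccontr)
    assume "p \<noteq> 0"
    then have "cf p 0 \<noteq> 0" using pc by auto
    then have "const (1 / cf p 0) * p = 1" by (subst pc) (simp add: mult_single)
    then show False using idl_const[OF J(1) p(1), of "1 / cf p 0"] J(2) by simp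
  qed
qed simp

lemma indep_mono: "indep U L \<Longrightarrow> J \<subseteq> L \<Longrightarrow> indep U J"
  by (auto simp: indep_def)

lemma finite_indep: "finite {card U | U. indep U J}"
  by (rule finite_subset[of _ "card ` Pow V"]) (auto simp: indep_def finite_V)

lemma pdim_ge: "indep U J \<Longrightarrow> card U \<le> pdim J"
  unfolding pdim_def by (rule Max_ge[OF finite_indep]) blast

lemma pdim_indep:
  assumes "idl J" "1 \<notin> J"
  obtains U where "indep U J" "card U = pdim J"
proof -
  have "pdim J \<in> {card U | U. indep U J}"
    unfolding pdim_def using indep_empty[OF assms] by (intro Max_in finite_indep) blast
  then show ?thesis using that by auto
qed

lemma pdim_le: "idl J \<Longrightarrow> 1 \<notin> J \<Longrightarrow> pdim J \<le> card V"
  using pdim_indep[of J] card_mono[OF finite_V] unfolding indep_def by metis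

lemma pdim_mono: "idl L \<Longrightarrow> 1 \<notin> L \<Longrightarrow> J \<subseteq> L \<Longrightarrow> pdim L \<le> pdim J"
  using pdim_indep[of L] pdim_ge indep_mono by metis

text \<open>By maximality no set of \<open>pdim J + 1\<close> variables is independent. For the unit
  ideal no set is independent at all, so the bound holds whatever \<open>pdim\<close> is
  there.\<close>

lemma grow_pdim: "idl J \<Longrightarrow> \<exists>C. grow dbd J C (pdim J)"
  using grow_exists[of J "pdim J"] pdim_ge[of _ J] by fastforce

text \<open>The monomials in \<open>U\<close> with exponents at most \<open>t\<close> are
  independent modulo \<open>J\<close>, and their number is \<open>(t + 1) ^ card U\<close>.\<close>

lemma grow_indep_bound:
  assumes J: "idl J" and grow: "grow D J C d" and U: "indep U J"
  shows "card U \<le> d"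
proof (rule grow_family_bound[OF J grow, of "box U" _ "\<lambda>_ m. mon m" "card U"])
  have UV: "U \<subseteq> V" using U by (simp add: indep_def)
  show "finite (box U t)" "(t + 1) ^ card U \<le> card (box U t)" for t
    using finite_box[OF UV] card_box[OF UV] by simp_all
  show "mon m \<in> dbd (card U * t)" if "m \<in> box U t" for m t
    using box_supp[OF UV that] box_deg[OF UV that] UV by (auto simp: dbd_def)
  show "\<forall>x\<in>box U t. a x = 0" if "(\<Sum>x\<in>box U t. const (a x) * mon x) \<in> J" for a t
  proof -
    have "(\<Sum>x\<in>box U t. const (a x) * mon x) = 0"
      by (rule indepD[OF U that mon_sum_polys]) (rule box_supp[OF UV])
    then show ?thesis using mon_sum_eq_0[OF finite_box[OF UV]] by blast
  qed
qed

text \<open>In a polynomial relation for \<open>g\<close> over \<open>polys U\<close>, the constant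
  term lies in \<open>J + (g)\<close> and hence vanishes. What remains is divisible by
  \<open>g\<close>, which can be cancelled modulo \<open>J\<close>.\<close>

lemma transcendental_nzd:
  assumes J: "idl J" and g: "g \<in> A" and nz: "nzd J g" and U: "indep U (adj J g)"
  shows "(\<And>j. j \<le> t \<Longrightarrow> q j \<in> polys U) \<Longrightarrow> (\<Sum>j\<le>t. g ^ j * q j) \<in> J \<Longrightarrow> \<forall>j\<le>t. q j = 0"
proof (induction t arbitrary: q)
  case 0
  then have "q 0 \<in> J" by simp
  then show ?case using indepD[OF U, of "q 0"] adj_sub[OF J, of g] 0(1)[of 0] by auto
next
  case (Suc t)
  have UV: "polys U \<subseteq> A" using U polys_mono by (auto simp: indep_def)
  define r where "r = (\<Sum>j\<le>t. g ^ j * q (Suc j))"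
  have rA: "r \<in> A" unfolding r_def using Suc.prems(1) UV g by (intro polys_sum polys_mult polys_power) auto
  have "(\<Sum>j\<le>Suc t. g ^ j * q j) = q 0 + g * r"
    unfolding r_def sum_distrib_left sum.atMost_Suc_shift by (simp add: mult.assoc)
  then have *: "q 0 + g * r \<in> J" using Suc.prems(2) by simp
  then have "q 0 \<in> adj J g" unfolding adj_def using rA
    by (intro CollectI exI[of _ "q 0 + g * r"] exI[of _ "- r"]) auto
  then have q0: "q 0 = 0" using indepD[OF U] Suc.prems(1)[of 0] by simp
  then have "r \<in> J" using * nz rA by (simp add: nzd_def)
  then have r: "(\<Sum>j\<le>t. g ^ j * q (Suc j)) \<in> J" by (simp only: r_def)
  have "q (Suc j) \<in> polys U" if "j \<le> t" for j using Suc.prems(1) that by simp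
  from Suc.IH[of "\<lambda>j. q (Suc j)", OF this r] have *: "\<forall>j\<le>t. q (Suc j) = 0" .
  show ?case
  proof (intro allI impI)
    fix j assume "j \<le> Suc t"
    then show "q j = 0" using q0 * by (cases j) auto
  qed
qed

text \<open>The powers of \<open>g\<close> act like one further independent variable: the products
  of the monomials in \<open>box U t\<close> with \<open>g ^ j\<close> for \<open>j \<le> t\<close>
  are independent modulo \<open>J\<close>.\<close>

lemma pdim_nzd_indep:
  assumes J: "idl J" and g: "g \<in> A" and nz: "nzd J g" and U: "indep U (adj J g)"
  shows "Suc (card U) \<le> pdim J"
proof -
  obtain C where C: "grow dbd J C (pdim J)" using grow_pdim[OF J] by blast
  obtain e where e: "g \<in> dbd e" using dbd_ex[OF g] by blast
  have UV: "U \<subseteq> V" using U by (simp add: indep_def)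
  show ?thesis
  proof (rule grow_family_bound[OF J C, of "\<lambda>t. box U t \<times> {..t}" _ "\<lambda>_ x. mon (fst x) * g ^ snd x" "card U + e"])
    show "finite (box U t \<times> {..t})" "(t + 1) ^ Suc (card U) \<le> card (box U t \<times> {..t})" for t
      using finite_box[OF UV] card_box[OF UV] by (simp_all add: card_cartesian_product)
    show "mon (fst x) * g ^ snd x \<in> dbd ((card U + e) * t)" if "x \<in> box U t \<times> {..t}" for x t
    proof -
      have "supp (fst x) \<subseteq> U" using that by (intro box_supp[OF UV]) auto
      then have "supp (fst x) \<subseteq> V" using UV by (rule subset_trans)
      then have "mon (fst x) \<in> dbd (card U * t)"
        using box_deg[OF UV, of "fst x" t] that by (auto simp: dbd_def)
      moreover have "g ^ snd x \<in> dbd (e * t)"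
        using dbd_power[OF e, of "snd x"] dbd_mono[of "snd x * e" "e * t"] that by (auto simp: mult.commute)
      ultimately show ?thesis using dbd_mult by (simp add: distrib_right)
    qed
    show "\<forall>x\<in>box U t \<times> {..t}. a x = 0"
      if "(\<Sum>x\<in>box U t \<times> {..t}. const (a x) * (mon (fst x) * g ^ snd x)) \<in> J" for a t
    proof -
      define q where "q j = (\<Sum>m\<in>box U t. const (a (m, j)) * mon m)" for j
      have "(\<Sum>x\<in>box U t \<times> {..t}. const (a x) * (mon (fst x) * g ^ snd x)) =
        (\<Sum>m\<in>box U t. \<Sum>j\<le>t. const (a (m, j)) * (mon m * g ^ j))"
        by (simp add: sum.cartesian_product case_prod_unfold)
      also have "\<dots> = (\<Sum>j\<le>t. \<Sum>m\<in>box U t. const (a (m, j)) * (mon m * g ^ j))" by (rule sum.swap)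
      also have "\<dots> = (\<Sum>j\<le>t. g ^ j * q j)"
        by (simp add: q_def sum_distrib_left mult_ac)
      finally have "(\<Sum>j\<le>t. g ^ j * q j) \<in> J" using that by simp
      moreover have "q j \<in> polys U" for j unfolding q_def by (rule mon_sum_polys[OF box_supp[OF UV]])
      ultimately have "\<forall>j\<le>t. q j = 0" by (intro transcendental_nzd[OF J g nz U])
      then show ?thesis using mon_sum_eq_0[OF finite_box[OF UV]] unfolding q_def by fastforce
    qed
  qed
qed

lemma pdim_adj_nzd:
  assumes "idl J" "g \<in> A" "nzd J g" "1 \<notin> adj J g"
  shows "Suc (pdim (adj J g)) \<le> pdim J"
  using pdim_indep[OF adj_idl[OF assms(1,2)] assms(4)] pdim_nzd_indep[OF assms(1-3)] by metis

text \<open>An element \<open>g\<close> of \<open>Q\<close> outside \<open>P\<close> is regular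
  modulo \<open>P\<close>, and a set that is independent modulo \<open>Q\<close> is so modulo
  \<open>P + (g)\<close>.\<close>

lemma pdim_strict:
  assumes P: "prm P" and Q: "prm Q" and PQ: "P \<subset> Q"
  shows "pdim Q < pdim P"
proof -
  obtain g where g: "g \<in> Q" "g \<notin> P" using PQ by blast
  have gA: "g \<in> A" using idl_sub[OF prm_idl[OF Q] g(1)] .
  obtain U where U: "indep U Q" "card U = pdim Q" using pdim_indep[OF prm_idl[OF Q] prm_one[OF Q]] .
  have "adj P g \<subseteq> Q" using PQ g by (intro adj_least prm_idl[OF Q]) auto
  then show ?thesis
    using pdim_nzd_indep[OF prm_idl[OF P] gA prm_nzd[OF P gA g(2)] indep_mono[OF U(1)]] U(2) by simp
qed

section \<open>Homogeneous ideals and adjoining a form\<close>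

definition hom :: "('v \<Rightarrow> nat) \<Rightarrow> ('v, 'k) mpoly set \<Rightarrow> bool" where
  "hom w J \<longleftrightarrow> idl J \<and> (\<forall>p\<in>J. \<forall>k. wcomp w k p \<in> J)"

abbreviation hidl where "hidl \<equiv> hom unit_wt"
abbreviation hdeg :: "nat \<Rightarrow> ('v, 'k) mpoly \<Rightarrow> bool" where "hdeg \<equiv> whom unit_wt"

lemma hom_idl: "hom w J \<Longrightarrow> idl J"
  and hom_comp: "hom w J \<Longrightarrow> p \<in> J \<Longrightarrow> wcomp w k p \<in> J"
  by (auto simp: hom_def)

lemma restr_deg_eq: "restr (\<lambda>m. wdeg w m \<le> t) p = (\<Sum>k\<le>t. wcomp w k p)"
proof -
  have "(\<Sum>k\<le>t. wcomp w k (restr (\<lambda>m. wdeg w m \<le> t) p)) = (\<Sum>k\<le>t. wcomp w k p)"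
    by (intro sum.cong refl poly_mapping_eqI) (auto simp: lookup_restr)
  then show ?thesis using wcomp_expand[of "restr (\<lambda>m. wdeg w m \<le> t) p" w t] by (simp add: supp_restr)
qed

lemma hom_truncate: "hom w J \<Longrightarrow> p \<in> J \<Longrightarrow> restr (\<lambda>m. wdeg w m \<le> t) p \<in> J"
  unfolding restr_deg_eq by (intro idl_sum hom_idl hom_comp)

lemma restr_compl: "p = restr Q p + restr (\<lambda>m. \<not> Q m) p"
  by (rule poly_mapping_eqI) (simp add: lookup_add lookup_restr)

lemma restr_mult_hom:
  assumes "whom w e l"
  shows "restr (\<lambda>m. wdeg w m \<le> t) (l * q) = l * restr (\<lambda>m. e + wdeg w m \<le> t) q"
proof -
  let ?a = "restr (\<lambda>m. e + wdeg w m \<le> t) q" and ?b = "restr (\<lambda>m. \<not> e + wdeg w m \<le> t) q"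
  have "restr (\<lambda>m. wdeg w m \<le> t) (l * ?a) = l * ?a"
  proof (rule restr_id)
    show "wdeg w m \<le> t" if "m \<in> supp (l * ?a)" for m
      using that keys_mult[of l ?a] assms by (fastforce simp: whom_def supp_restr)
  qed
  moreover have "restr (\<lambda>m. wdeg w m \<le> t) (l * ?b) = 0"
  proof (rule restr_eq_0)
    show "\<not> wdeg w m \<le> t" if "m \<in> supp (l * ?b)" for m
      using that keys_mult[of l ?b] assms by (fastforce simp: whom_def supp_restr)
  qed
  moreover have "l * q = l * ?a + l * ?b"
    using restr_compl[of q "\<lambda>m. e + wdeg w m \<le> t"] by (metis distrib_left)
  ultimately show ?thesis by (simp add: restr_add)
qed

text \<open>A polynomial of degree at most \<open>t\<close> is \<open>y + j + l * q\<close> with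
  \<open>y\<close> in the span of \<open>Y t\<close>. By homogeneity \<open>j\<close> and
  \<open>q\<close> can be truncated, so that \<open>q\<close> has degree at most
  \<open>t - e\<close>, and the step is repeated for \<open>q\<close>. Since \<open>e > 0\<close>,
  at most \<open>t + 1\<close> spanning sets are collected, which raises the exponent by
  one.\<close>

lemma grow_adj_hom:
  assumes J: "hidl J" and l: "l \<in> A" "hdeg e l" "e > 0" and grow: "grow dbd (adj J l) C d"
  shows "grow (\<lambda>_. UNIV) J C (Suc d)"
proof -
  have "\<forall>t. \<exists>Y. finite Y \<and> Y \<subseteq> dbd t \<and> card Y \<le> C * (t + 1) ^ d \<and>
     (\<forall>p\<in>dbd t. \<exists>y\<in>mpv.span Y. p - y \<in> adj J l)" using grow by (simp add: grow_def)
  then have "\<exists>Y. \<forall>t. finite (Y t) \<and> Y t \<subseteq> dbd t \<and> card (Y t) \<le> C * (t + 1) ^ d \<and>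
     (\<forall>p\<in>dbd t. \<exists>y\<in>mpv.span (Y t). p - y \<in> adj J l)" by (rule choice)
  then obtain Y where Y: "\<And>t. finite (Y t)" "\<And>t. Y t \<subseteq> dbd t" "\<And>t. card (Y t) \<le> C * (t + 1) ^ d"
    "\<And>t p. p \<in> dbd t \<Longrightarrow> \<exists>y\<in>mpv.span (Y t). p - y \<in> adj J l" by blast
  \<comment> \<open>Unrolls the recursion: a representative in degree \<open>Suc t\<close> is one
    from the span of \<open>Y (Suc t)\<close> plus \<open>l\<close> times a representative of the
    cofactor in degree \<open>t\<close>.\<close>
  define Z where "Z = rec_nat (Y 0) (\<lambda>t Zt. Y (Suc t) \<union> (*) l ` Zt)"
  have Z0: "Z 0 = Y 0" and ZS: "Z (Suc t) = Y (Suc t) \<union> (*) l ` Z t" for t by (simp_all add: Z_def)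
  have split: "\<exists>y\<in>mpv.span (Y t). \<exists>j\<in>J. \<exists>q\<in>A. p = y + j + l * q \<and> (\<forall>m\<in>supp q. e + deg m \<le> t)"
    if p: "p \<in> dbd t" for p t
  proof -
    from Y(4)[OF p] obtain y j q where y: "y \<in> mpv.span (Y t)" and jq: "j \<in> J" "q \<in> A" "p - y = j + l * q"
      by (auto simp: adj_def)
    \<comment> \<open>The bound \<open>Y t \<subseteq> dbd t\<close> keeps \<open>p - y\<close> in
      degree at most \<open>t\<close>, so truncation leaves the left-hand side unchanged.\<close>
    have "y \<in> dbd t" using mpv.span_minimal[OF Y(2) dbd_subspace] y by blast
    then have "p - y \<in> dbd t" using mpv.subspace_diff[OF dbd_subspace p] by blast
    then have "p - y = restr (\<lambda>m. deg m \<le> t) (p - y)"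
      by (intro restr_id[symmetric]) (simp add: dbd_def)
    also have "\<dots> = restr (\<lambda>m. deg m \<le> t) j + l * restr (\<lambda>m. e + deg m \<le> t) q"
      by (simp only: jq(3) restr_add restr_mult_hom[OF l(2)])
    finally have "p = y + restr (\<lambda>m. deg m \<le> t) j + l * restr (\<lambda>m. e + deg m \<le> t) q"
      by (simp add: algebra_simps)
    moreover have "\<forall>m\<in>supp (restr (\<lambda>m. e + deg m \<le> t) q). e + deg m \<le> t" by (simp add: supp_restr)
    ultimately show ?thesis using y hom_truncate[OF J jq(1)] jq(2) by blast
  qed
  have near: "\<exists>y\<in>mpv.span (Z t). p - y \<in> J" if "p \<in> dbd t" for p t
    using that
  proof (induction t arbitrary: p)
    case 0
    from split[OF 0] obtain y j q where y: "y \<in> mpv.span (Y 0)" and j: "j \<in> J"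
      and q: "q \<in> A" "p = y + j + l * q" "\<forall>m\<in>supp q. e + deg m \<le> 0" by blast
    have "q = 0" using q(3) l(3) by auto
    then show ?case using y j q(2) by (intro bexI[of _ y]) (auto simp: Z0)
  next
    case (Suc t)
    from split[OF Suc.prems] obtain y j q where y: "y \<in> mpv.span (Y (Suc t))" and j: "j \<in> J"
      and q: "q \<in> A" "p = y + j + l * q" "\<forall>m\<in>supp q. e + deg m \<le> Suc t" by blast
    have "deg m \<le> t" if "m \<in> supp q" for m using q(3) that l(3) by fastforce
    then have "q \<in> dbd t" using q(1) by (simp add: dbd_def)
    from Suc.IH[OF this] obtain z where z: "z \<in> mpv.span (Z t)" "q - z \<in> J" by blast
    have "l * x \<in> mpv.span (Z (Suc t))" if "x \<in> mpv.span (Z t)" for x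
      using that
    proof (induction rule: mpv.span_induct_alt)
      case base
      then show ?case by (simp add: mpv.span_zero)
    next
      case (step c x y)
      have "l * x \<in> mpv.span (Z (Suc t))" using step(1) by (intro mpv.span_base) (auto simp: ZS)
      then have "const c * (l * x) + l * y \<in> mpv.span (Z (Suc t))"
        using step(2) by (intro mpv.span_add mpv.span_scale)
      then show ?case by (simp add: algebra_simps)
    qed
    then have "y + l * z \<in> mpv.span (Z (Suc t))"
      using y z(1) mpv.span_mono[of "Y (Suc t)" "Z (Suc t)"] by (intro mpv.span_add) (auto simp: ZS)
    moreover have "j + l * (q - z) \<in> J"
      using j z(2) l(1) by (intro idl_add[OF hom_idl[OF J]] idl_mult[OF hom_idl[OF J]])
    then have "p - (y + l * z) \<in> J" by (simp add: q(2) algebra_simps)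
    ultimately show ?case by blast
  qed
  have finZ: "finite (Z t)" for t by (induction t) (auto simp: Z0 ZS Y(1))
  have cardZ: "card (Z t) \<le> C * (t + 1) ^ Suc d" for t
  proof (induction t)
    case 0
    then show ?case using Y(3)[of 0] by (simp add: Z0)
  next
    case (Suc t)
    have "card (Z (Suc t)) \<le> card (Y (Suc t)) + card ((*) l ` Z t)" unfolding ZS by (rule card_Un_le)
    also have "\<dots> \<le> C * (Suc t + 1) ^ d + C * (t + 1) ^ Suc d"
      using Y(3)[of "Suc t"] card_image_le[OF finZ[of t], of "(*) l"] Suc by linarith
    also have "\<dots> \<le> C * (Suc t + 1) ^ d + C * ((t + 1) * (Suc t + 1) ^ d)"
      using power_mono[of "t + 1" "Suc t + 1" d] by (simp only: power_Suc add_le_mono mult_le_mono le_refl)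
    also have "\<dots> = C * (Suc t + 1) ^ Suc d" by (simp add: algebra_simps)
    finally show ?case .
  qed
  show ?thesis unfolding grow_def
  proof (intro allI exI conjI ballI)
    show "\<exists>y\<in>mpv.span (Z t). p - y \<in> J" if "p \<in> dbd t" for t p by (rule near[OF that])
  qed (use finZ cardZ in auto)
qed

text \<open>The graded counterpart of Krull's principal ideal theorem, obtained from growth instead
  of primes.\<close>

lemma pdim_adj_hom:
  assumes J: "hidl J" "1 \<notin> J" and l: "l \<in> A" "hdeg e l" "e > 0"
  shows "pdim J \<le> Suc (pdim (adj J l))"
proof -
  obtain C where C: "grow dbd (adj J l) C (pdim (adj J l))"
    using grow_pdim[OF adj_idl[OF hom_idl[OF J(1)] l(1)]] by blast
  obtain U where U: "indep U J" "card U = pdim J" using pdim_indep[OF hom_idl[OF J(1)] J(2)] .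
  show ?thesis using grow_indep_bound[OF hom_idl[OF J(1)] grow_adj_hom[OF J(1) l C] U(1)] U(2) by simp
qed

section \<open>Graded primes\<close>

lemma hom_mem: "hom w J \<Longrightarrow> (\<And>k. wcomp w k p \<in> J) \<Longrightarrow> p \<in> J"
proof -
  assume J: "hom w J" and c: "\<And>k. wcomp w k p \<in> J"
  obtain B where "\<forall>m\<in>supp p. wdeg w m \<le> B" using wcomp_bound_ex[of "{p}" w] by auto
  then have "p = (\<Sum>i\<le>B. wcomp w i p)" by (intro wcomp_expand) auto
  then show "p \<in> J" using idl_sum[OF hom_idl[OF J], of "{..B}" "\<lambda>i. wcomp w i p"] c by simp
qed

lemma hom_adj:
  assumes J: "hom w J" and g: "g \<in> A" "whom w e g"
  shows "hom w (adj J g)"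
  unfolding hom_def
proof (intro conjI ballI allI)
  show "idl (adj J g)" by (rule adj_idl[OF hom_idl[OF J] g(1)])
  fix p k assume "p \<in> adj J g"
  then obtain j q where jq: "j \<in> J" "q \<in> A" "p = j + g * q" by (auto simp: adj_def)
  have "wcomp w k p = wcomp w k j + g * (if e \<le> k then wcomp w (k - e) q else 0)"
    using wcomp_mult_hom[OF g(2), of k q] by (auto simp: jq(3) restr_add mult.commute)
  then show "wcomp w k p \<in> adj J g"
    unfolding adj_def using hom_comp[OF J jq(1), of k] jq(2)
    by (intro CollectI exI[of _ "wcomp w k j"] exI[of _ "if e \<le> k then wcomp w (k - e) q else 0"]) auto
qed

lemma hom_zero: "hom w {0}"
  by (simp add: hom_def idl_zero_ideal)

lemma hom_colon:
  assumes J: "hom w J" and u: "u \<in> A" "whom w e u"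
  shows "hom w (colon J u)"
  unfolding hom_def
proof (intro conjI ballI allI)
  show "idl (colon J u)" by (rule colon_idl[OF hom_idl[OF J] u(1)])
  fix p k assume p: "p \<in> colon J u"
  have "wcomp w (k + e) (p * u) \<in> J" using p hom_comp[OF J] by (simp add: colon_def)
  then have "wcomp w k p * u \<in> J" by (simp add: wcomp_mult_hom[OF u(2)])
  then show "wcomp w k p \<in> colon J u" using p by (auto simp: colon_def)
qed

text \<open>If \<open>a\<close> and \<open>b\<close> are outside \<open>Q\<close>, let
  \<open>i\<close> and \<open>j\<close> be the lowest degrees of their components outside
  \<open>Q\<close>. In degree \<open>i + j\<close> of \<open>a * b\<close>, every other summand has
  a factor in \<open>Q\<close>, so the product of these two components lies in
  \<open>Q\<close>.\<close>

lemma hom_prmI: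
  assumes Q: "hom w Q" "1 \<notin> Q"
    and test: "\<And>a b i j. a \<in> A \<Longrightarrow> b \<in> A \<Longrightarrow> whom w i a \<Longrightarrow> whom w j b \<Longrightarrow> a * b \<in> Q \<Longrightarrow> a \<in> Q \<or> b \<in> Q"
  shows "prm Q"
  unfolding prm_def
proof (intro conjI ballI impI hom_idl[OF Q(1)] Q(2))
  fix a b assume ab: "a \<in> A" "b \<in> A" "a * b \<in> Q"
  show "a \<in> Q \<or> b \<in> Q"
  proof (rule ccontr)
    assume "\<not> (a \<in> Q \<or> b \<in> Q)"
    then have ex: "\<exists>i. wcomp w i a \<notin> Q" "\<exists>i. wcomp w i b \<notin> Q" using hom_mem[OF Q(1)] by blast+
    define i where "i = (LEAST i. wcomp w i a \<notin> Q)"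
    define j where "j = (LEAST i. wcomp w i b \<notin> Q)"
    have i: "wcomp w i a \<notin> Q" and j: "wcomp w j b \<notin> Q"
      unfolding i_def j_def using LeastI_ex[OF ex(1)] LeastI_ex[OF ex(2)] by auto
    have less: "i' < i \<Longrightarrow> wcomp w i' a \<in> Q" "i' < j \<Longrightarrow> wcomp w i' b \<in> Q" for i'
      unfolding i_def j_def using not_less_Least by blast+
    let ?f = "\<lambda>k. wcomp w k a * wcomp w (i + j - k) b"
    have "?f k \<in> Q" if "k \<in> {..i + j} - {i}" for k
    proof (cases "k < i")
      case True
      then show ?thesis using less(1) ab(2) by (intro idl_mult_right[OF hom_idl[OF Q(1)]]) auto
    next
      case False
      then have "i + j - k < j" using that by auto
      then show ?thesis using less(2) ab(1) by (intro idl_mult[OF hom_idl[OF Q(1)]]) auto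
    qed
    then have "(\<Sum>k\<in>{..i + j} - {i}. ?f k) \<in> Q" by (intro idl_sum[OF hom_idl[OF Q(1)]])
    moreover have "wcomp w (i + j) (a * b) = ?f i + (\<Sum>k\<in>{..i + j} - {i}. ?f k)"
      unfolding wcomp_mult by (rule sum.remove) auto
    moreover have "wcomp w (i + j) (a * b) \<in> Q" using hom_comp[OF Q(1) ab(3)] .
    ultimately have "?f i \<in> Q"
      using idl_add_cancel[OF hom_idl[OF Q(1)], of "?f i" "\<Sum>k\<in>{..i + j} - {i}. ?f k"] by simp
    then show False using test[of "wcomp w i a" "wcomp w j b" i j] ab i j by auto
  qed
qed

text \<open>For an ideal \<open>P\<close>, the largest \<open>w\<close>-homogeneous ideal inside
  it.\<close>

definition core :: "('v \<Rightarrow> nat) \<Rightarrow> ('v, 'k) mpoly set \<Rightarrow> ('v, 'k) mpoly set" where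
  "core w P = {p \<in> A. \<forall>k. wcomp w k p \<in> P}"

lemma core_hom:
  assumes P: "idl P"
  shows "hom w (core w P)" and "core w P \<subseteq> P"
proof -
  have ww: "wcomp w k (wcomp w l p) = (if k = l then wcomp w l p else 0)" for k l p
    by (rule wcomp_whom) simp
  have "idl (core w P)"
  proof (rule idlI)
    show "a * x \<in> core w P" if "a \<in> A" "x \<in> core w P" for a x
      using that by (auto simp: core_def wcomp_mult intro!: idl_sum[OF P] idl_mult[OF P])
  qed (auto simp: core_def restr_add intro: idl_zero[OF P] idl_add[OF P])
  then show "hom w (core w P)" by (auto simp: hom_def core_def ww intro: idl_zero[OF P])
  show "core w P \<subseteq> P"
  proof
    fix p assume p: "p \<in> core w P"
    obtain B where "\<forall>m\<in>supp p. wdeg w m \<le> B" using wcomp_bound_ex[of "{p}" w] by auto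
    then have "p = (\<Sum>i\<le>B. wcomp w i p)" by (intro wcomp_expand) auto
    then show "p \<in> P" using idl_sum[OF P, of "{..B}" "\<lambda>i. wcomp w i p"] p by (simp add: core_def)
  qed
qed

lemma core_mem: "x \<in> P \<Longrightarrow> idl P \<Longrightarrow> whom w e x \<Longrightarrow> x \<in> core w P"
  using wcomp_whom[of w e x] by (auto simp: core_def idl_zero idl_sub)

lemma core_prm:
  assumes P: "prm P"
  shows "prm (core w P)"
proof (rule hom_prmI[OF core_hom(1)[OF prm_idl[OF P]]])
  show "1 \<notin> core w P" using core_hom(2)[OF prm_idl[OF P]] prm_one[OF P] by blast
  fix a b i j assume ab: "a \<in> A" "b \<in> A" "whom w i a" "whom w j b" "a * b \<in> core w P"
  then have "a \<in> P \<or> b \<in> P" using core_hom(2)[OF prm_idl[OF P]] prm_mult[OF P, of a b] by blast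
  then show "a \<in> core w P \<or> b \<in> core w P" using core_mem[OF _ prm_idl[OF P]] ab by blast
qed

lemma core_sub: "hom w J \<Longrightarrow> J \<subseteq> P \<Longrightarrow> J \<subseteq> core w P"
  unfolding core_def using hom_comp[of w J] idl_sub[OF hom_idl] by blast

definition minprime :: "('v, 'k) mpoly set \<Rightarrow> ('v, 'k) mpoly set \<Rightarrow> bool" where
  "minprime J P \<longleftrightarrow> prm P \<and> J \<subseteq> P \<and> (\<forall>Q. prm Q \<and> J \<subseteq> Q \<and> Q \<subseteq> P \<longrightarrow> Q = P)"

text \<open>The core of \<open>P\<close> is a prime that still contains \<open>J\<close>, so
  minimality makes it equal to \<open>P\<close>.\<close>

lemma minprime_hom: "hom w J \<Longrightarrow> minprime J P \<Longrightarrow> hom w P"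
  using core_prm[of P w] core_hom[of P w] core_sub[of w J P] prm_idl[of P]
  unfolding minprime_def by metis

text \<open>Passing to a smaller prime increases the dimension, which is bounded by \<open>|V|\<close>.\<close>

lemma minprime_exists:
  assumes "prm Q" "J \<subseteq> Q"
  obtains P where "minprime J P" "P \<subseteq> Q"
proof -
  let ?ok = "\<lambda>P. prm P \<and> J \<subseteq> P \<and> P \<subseteq> Q"
  have "?ok Q" using assms by blast
  moreover have "\<forall>P. ?ok P \<longrightarrow> pdim P < Suc (card V)" using pdim_le prm_idl prm_one by (meson le_imp_less_Suc)
  ultimately obtain P where P: "?ok P" "\<And>P'. ?ok P' \<Longrightarrow> pdim P' \<le> pdim P"
    using ex_has_greatest_nat[of ?ok Q pdim "Suc (card V)"] by blast
  have "minprime J P" unfolding minprime_def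
  proof (intro conjI allI impI)
    show "prm P" "J \<subseteq> P" using P by auto
    fix Q' assume Q': "prm Q' \<and> J \<subseteq> Q' \<and> Q' \<subseteq> P"
    show "Q' = P"
    proof (rule ccontr)
      assume "Q' \<noteq> P"
      then have "pdim P < pdim Q'" using Q' P(1) by (intro pdim_strict) auto
      moreover have "?ok Q'" using Q' P(1) by blast
      ultimately show False using P(2)[of Q'] by simp
    qed
  qed
  with P(1) that show thesis by blast
qed

text \<open>The device by which results on homogeneous ideals are applied to arbitrary ones.\<close>

lemma hom_const_weight: "hom (\<lambda>_. 0) J \<longleftrightarrow> idl J"
proof
  assume J: "idl J"
  have "wdeg (\<lambda>_. 0) m = 0" for m :: "'v \<Rightarrow>\<^sub>0 nat" by (simp add: wdeg_def)
  then have "wcomp (\<lambda>_. 0) k p = (if k = 0 then p else 0)" for k and p :: "('v, 'k) mpoly"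
    by (intro wcomp_whom) (simp add: whom_def)
  then show "hom (\<lambda>_. 0) J" using J by (auto simp: hom_def idl_zero)
qed (rule hom_idl)

text \<open>Nonzero polynomials in \<open>U\<close> form a multiplicative set. A homogeneous ideal
  \<open>P\<close> maximal among those that meet it nowhere is prime: if \<open>a\<close> and
  \<open>b\<close> were outside \<open>P\<close> with product inside, elements of the set in
  \<open>P + (a)\<close> and \<open>P + (b)\<close> would multiply to one in
  \<open>P\<close>.\<close>

lemma prime_over_indep:
  assumes J: "hom w J" and U: "indep U J"
  obtains P where "prm P" "hom w P" "J \<subseteq> P" "indep U P"
proof -
  have "\<exists>P\<in>{L. hom w L \<and> indep U L}. J \<subseteq> P \<and> (\<forall>L\<in>{L. hom w L \<and> indep U L}. P \<subseteq> L \<longrightarrow> L = P)"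
    using J U hom_idl[of w] by (intro noeth_max) auto
  then obtain P where "P \<in> {L. hom w L \<and> indep U L}" and JP: "J \<subseteq> P"
    and "\<forall>L\<in>{L. hom w L \<and> indep U L}. P \<subseteq> L \<longrightarrow> L = P" by (elim bexE conjE)
  then have P: "hom w P \<and> indep U P" "J \<subseteq> P"
    and max: "\<And>L. hom w L \<and> indep U L \<Longrightarrow> P \<subseteq> L \<Longrightarrow> L = P" by simp_all
  have UV: "polys U \<subseteq> A" using U polys_mono by (auto simp: indep_def)
  have "prm P"
  proof (rule hom_prmI)
    show "hom w P" using P by simp
    show "1 \<notin> P" using indepD[of U P 1] P by auto
    fix a b i j assume ab: "a \<in> A" "b \<in> A" "whom w i a" "whom w j b" "a * b \<in> P"
    show "a \<in> P \<or> b \<in> P"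
    proof (rule ccontr)
      assume n: "\<not> (a \<in> P \<or> b \<in> P)"
      have idlP: "idl P" using P hom_idl by blast
      have ex: "\<exists>s\<in>adj P c. s \<in> polys U \<and> s \<noteq> 0" if "c \<in> A" "whom w k c" "c \<notin> P" for c k
      proof -
        have "\<not> indep U (adj P c)"
          using max[of "adj P c"] hom_adj[of w P c k] adj_sub[OF idlP] adj_mem[OF idlP, of c] P that by blast
        then show ?thesis using P by (auto simp: indep_def)
      qed
      obtain s t where s: "s \<in> adj P a" "s \<in> polys U" "s \<noteq> 0" and t: "t \<in> adj P b" "t \<in> polys U" "t \<noteq> 0"
        using ex ab n by meson
      obtain p q where p: "p \<in> P" "q \<in> A" "s = p + a * q" using s(1) by (auto simp: adj_def)
      obtain p' q' where p': "p' \<in> P" "q' \<in> A" "t = p' + b * q'" using t(1) by (auto simp: adj_def)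
      have "s * t = p * t + (a * q) * p' + (q * q') * (a * b)" by (simp add: p(3) p'(3) algebra_simps)
      moreover have "p * t \<in> P" using p(1) t(2) UV by (intro idl_mult_right[OF idlP]) auto
      moreover have "(a * q) * p' \<in> P" using p' p ab by (intro idl_mult[OF idlP]) auto
      moreover have "(q * q') * (a * b) \<in> P" by (rule idl_mult[OF idlP polys_mult[OF p(2) p'(2)] ab(5)])
      ultimately have "s * t \<in> P" using idl_add[OF idlP] by simp
      then have "s * t = 0" using indepD[of U P "s * t"] P s t by auto
      then show False using s t by simp
    qed
  qed
  with P that show thesis by blast
qed

lemma prime_of_pdim:
  assumes J: "hom w J" "1 \<notin> J"
  obtains P where "prm P" "hom w P" "J \<subseteq> P" "pdim P = pdim J"
proof -
  obtain U where U: "indep U J" "card U = pdim J" using pdim_indep[OF hom_idl[OF J(1)] J(2)] .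
  obtain P where P: "prm P" "hom w P" "J \<subseteq> P" "indep U P" using prime_over_indep[OF J(1) U(1)] .
  have "pdim P \<le> pdim J" using P prm_idl prm_one by (intro pdim_mono) auto
  moreover have "pdim J \<le> pdim P" using pdim_ge[OF P(4)] U(2) by simp
  ultimately show thesis using P that by simp
qed

section \<open>The irrelevant maximal ideal and its variables\<close>

definition mm :: "('v, 'k) mpoly set" where
  "mm = {p \<in> A. cf p 0 = 0}"

lemma mm_idl: "idl mm"
  by (rule idlI) (auto simp: mm_def lookup_add)

lemma mm_prm: "prm mm"
  using mm_idl by (auto simp: prm_def mm_def)

lemma mm_A: "x \<in> mm \<Longrightarrow> x \<in> A"
  by (simp add: mm_def)

lemma hdeg_mm: "x \<in> A \<Longrightarrow> hdeg e x \<Longrightarrow> e > 0 \<Longrightarrow> x \<in> mm"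
proof -
  assume x: "x \<in> A" "hdeg e x" "e > 0"
  have "0 \<notin> supp x"
  proof
    assume "0 \<in> supp x"
    then have "deg (0 :: 'v \<Rightarrow>\<^sub>0 nat) = e" using x(2) by (simp only: whom_def)
    then show False using x(3) by simp
  qed
  then show ?thesis using x(1) by (simp add: mm_def in_keys_iff)
qed

lemma hdeg_0: "hdeg 0 x \<Longrightarrow> x = const (cf x 0)"
  by (intro poly_mapping_eqI) (auto simp: whom_def lookup_single when_def in_keys_iff)

lemma hidl_mm: "hidl J \<Longrightarrow> 1 \<notin> J \<Longrightarrow> J \<subseteq> mm"
proof
  fix x assume J: "hidl J" "1 \<notin> J" and x: "x \<in> J"
  have x0: "wcomp unit_wt 0 x \<in> J" using hom_comp[OF J(1) x] .
  have "wcomp unit_wt 0 x = const (cf x 0)" using hdeg_0[of "wcomp unit_wt 0 x", OF whom_wcomp] by (simp add: lookup_restr)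
  then have "const (cf x 0) \<in> J" using x0 by simp
  then have "const (1 / cf x 0) * const (cf x 0) \<in> J" by (rule idl_const[OF hom_idl[OF J(1)]])
  then have "cf x 0 = 0" using J(2) by (cases "cf x 0 = 0") (simp_all add: mult_single)
  then show "x \<in> mm" using idl_sub[OF hom_idl[OF J(1)] x] by (simp add: mm_def)
qed

lemma hom_adj_proper: "hidl J \<Longrightarrow> 1 \<notin> J \<Longrightarrow> x \<in> mm \<Longrightarrow> 1 \<notin> adj J x"
  using adj_least[OF mm_idl hidl_mm, of J x] prm_one[OF mm_prm] by blast

definition mvr :: "'v \<Rightarrow> ('v, 'k) mpoly" where "mvr v = mon (Poly_Mapping.single v 1)"

lemma mvr_A [simp]: "mvr v \<in> A \<longleftrightarrow> v \<in> V"
  by (simp add: mvr_def)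

lemma mvr_hdeg [simp]: "hdeg (Suc 0) (mvr v)"
  using unit_wt_mult[of v "Suc 0"] by (simp add: mvr_def whom_def)

lemma mvr_mm: "v \<in> V \<Longrightarrow> mvr v \<in> mm"
  by (rule hdeg_mm[of _ "Suc 0"]) auto

lemma single_div_var:
  assumes "v \<in> supp m"
  shows "m = Poly_Mapping.single v 1 + (m - Poly_Mapping.single v 1)"
    and "Poly_Mapping.single m c = mvr v * Poly_Mapping.single (m - Poly_Mapping.single v 1) c"
proof -
  show m: "m = Poly_Mapping.single v 1 + (m - Poly_Mapping.single v 1)"
    using assms by (intro poly_mapping_eqI) (auto simp: lookup_add lookup_minus lookup_single when_def in_keys_iff)
  show "Poly_Mapping.single m c = mvr v * Poly_Mapping.single (m - Poly_Mapping.single v 1) c"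
    by (subst m) (simp add: mvr_def mult_single)
qed

lemma mon_mem_idl:
  assumes J: "idl J" "mvr v \<in> J" and m: "m \<in> mons" "v \<in> supp m"
  shows "Poly_Mapping.single m c \<in> J"
proof -
  have "m - Poly_Mapping.single v 1 \<in> mons"
    using single_div_var(1)[OF m(2)] m(1) mons_add by metis
  then show ?thesis unfolding single_div_var(2)[OF m(2)] by (intro idl_mult_right[OF J(1) _ J(2)] mon_mons)
qed

lemma mm_least:
  assumes J: "idl J" "\<And>v. v \<in> V \<Longrightarrow> mvr v \<in> J"
  shows "mm \<subseteq> J"
proof
  fix p assume p: "p \<in> mm"
  have "(\<Sum>m\<in>supp p. Poly_Mapping.single m (cf p m)) \<in> J"
  proof (rule idl_sum[OF J(1)])
    fix m assume m: "m \<in> supp p"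
    then have mm: "m \<in> mons" "m \<noteq> 0" using p polys_mons[of p m] by (auto simp: mm_def in_keys_iff)
    then obtain v where v: "v \<in> supp m" by fastforce
    then have "v \<in> V" using mm(1) by (auto simp: mons_def)
    then show "Poly_Mapping.single m (cf p m) \<in> J" using mon_mem_idl[OF J(1) J(2) mm(1) v] by blast
  qed
  then show "p \<in> J" using poly_as_sum[of p] by simp
qed

text \<open>For homogeneous \<open>J\<close>, annihilators of homogeneous elements are all the associated primes.\<close>

definition Ass :: "('v, 'k) mpoly set \<Rightarrow> ('v, 'k) mpoly set set" where
  "Ass J = {colon J u | u e. u \<in> A \<and> hdeg e u \<and> prm (colon J u)}"

lemma Ass_hom: "hidl J \<Longrightarrow> P \<in> Ass J \<Longrightarrow> hidl P"
  and Ass_prm: "P \<in> Ass J \<Longrightarrow> prm P"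
  by (auto simp: Ass_def intro: hom_colon)

text \<open>A maximal member among the colon ideals of homogeneous elements outside \<open>J\<close>
  is prime: if \<open>a * v\<close> is outside \<open>J\<close>, its colon ideal contains that of
  \<open>v\<close>, hence equals it, and it contains \<open>b\<close>.\<close>

lemma prime_colon_exists:
  assumes J: "hom w J" and u: "u \<in> A" "whom w e u" "u \<notin> J"
  obtains v d where "v \<in> A" "whom w d v" "prm (colon J v)" "colon J u \<subseteq> colon J v"
proof -
  let ?F = "{colon J v | v d. v \<in> A \<and> whom w d v \<and> v \<notin> J}"
  have "colon J u \<in> ?F" using u by blast
  moreover have "idl L" if "L \<in> ?F" for L using that colon_idl[OF hom_idl[OF J]] by blast
  ultimately have "\<exists>P\<in>?F. colon J u \<subseteq> P \<and> (\<forall>L\<in>?F. P \<subseteq> L \<longrightarrow> L = P)" by (rule noeth_max)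
  then obtain P where P: "P \<in> ?F" "colon J u \<subseteq> P" and max: "\<forall>L\<in>?F. P \<subseteq> L \<longrightarrow> L = P"
    by (elim bexE conjE)
  from P(1) obtain v d where v: "P = colon J v" "v \<in> A" "whom w d v" "v \<notin> J" by blast
  have "prm (colon J v)"
  proof (rule hom_prmI[OF hom_colon[OF J v(2,3)]])
    show "1 \<notin> colon J v" using v(4) by (simp add: colon_def)
    fix a b i j assume ab: "a \<in> A" "b \<in> A" "whom w i a" "whom w j b" "a * b \<in> colon J v"
    show "a \<in> colon J v \<or> b \<in> colon J v"
    proof (cases "a * v \<in> J")
      case False
      have "P \<subseteq> colon J (a * v)" using idl_mult[OF hom_idl[OF J] ab(1)]
        by (auto simp: v(1) colon_def mult.left_commute[of _ a])
      moreover have "colon J (a * v) \<in> ?F" using ab v False whom_mult[OF ab(3) v(3)] polys_mult by blast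
      ultimately have "colon J (a * v) = P" using bspec[OF max] by simp
      moreover have "b \<in> colon J (a * v)" using ab by (simp add: colon_def mult_ac)
      ultimately show ?thesis using v(1) by simp
    qed (use ab in \<open>simp add: colon_def\<close>)
  qed
  with v P(2) that show thesis by blast
qed

lemma Ass_exists:
  assumes J: "hidl J" and u: "u \<in> A" "hdeg e u" "u \<notin> J"
  obtains P where "P \<in> Ass J" "colon J u \<subseteq> P"
proof -
  obtain v d where v: "v \<in> A" "hdeg d v" "prm (colon J v)" "colon J u \<subseteq> colon J v"
    by (rule prime_colon_exists[OF assms])
  then have "colon J v \<in> Ass J" unfolding Ass_def by blast
  with v(4) that show thesis by blast
qed

lemma hom_zero_divisor:
  assumes J: "hom w J" and g: "g \<in> A" "whom w e g" "\<not> nzd J g"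
  obtains u d where "u \<in> A" "whom w d u" "u \<notin> J" "g * u \<in> J"
proof -
  obtain u where u: "u \<in> A" "g * u \<in> J" "u \<notin> J" using g(3) by (auto simp: nzd_def)
  then obtain k where k: "wcomp w k u \<notin> J" using hom_mem[OF J] by blast
  have "u * g \<in> J" using u(2) by (simp only: mult.commute)
  from hom_comp[OF J this, of "k + e"] have "wcomp w k u * g \<in> J" by (simp add: wcomp_mult_hom[OF g(2)])
  then have "g * wcomp w k u \<in> J" by (simp only: mult.commute)
  with k u(1) that[of "wcomp w k u" k] show thesis by auto
qed

lemma Ass_zero_divisor:
  assumes J: "hidl J" and g: "g \<in> A" "hdeg e g" "\<not> nzd J g"
  obtains P where "P \<in> Ass J" "g \<in> P"
proof -
  obtain u d where u: "u \<in> A" "hdeg d u" "u \<notin> J" "g * u \<in> J" using hom_zero_divisor[OF J g] .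
  obtain P where "P \<in> Ass J" "colon J u \<subseteq> P" using Ass_exists[OF J u(1-3)] .
  with u(4) g(1) that show thesis by (auto simp: colon_def)
qed

text \<open>Noetherian induction: for an associated prime \<open>Q = colon J u\<close> and
  \<open>L = J + (u)\<close>, every other associated prime of \<open>J\<close> is one of
  \<open>L\<close>. Indeed, if some multiple of \<open>v\<close> lies in \<open>L\<close> but not in
  \<open>J\<close>, it is congruent modulo \<open>J\<close> to a multiple of \<open>u\<close>.
  Passing to a nonzero multiple does not change a prime annihilator, so
  \<open>colon J v = Q\<close>. If there is no such multiple,
  \<open>colon L v = colon J v\<close>.\<close>

lemma Ass_finite: "hidl J \<Longrightarrow> finite (Ass J)"
proof (induction J rule: wf_induct_rule[OF wf_ideals])
  case (1 J)
  have J: "idl J" using 1(2) by (rule hom_idl)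
  show ?case
  proof (cases "Ass J = {}")
    case False
    then obtain Q u e where Q: "Q = colon J u" "u \<in> A" "hdeg e u" "prm Q" by (auto simp: Ass_def)
    define L where "L = adj J u"
    have L: "idl L" "hidl L" unfolding L_def using adj_idl[OF J Q(2)] hom_adj[OF 1(2) Q(2,3)] by auto
    have "u \<notin> J" using prm_one[OF Q(4)] Q(1) by (auto simp: colon_def)
    then have "J \<subset> L" using adj_sub[OF J] adj_mem[OF J] unfolding L_def by blast
    then have fin: "finite (Ass L)" using 1(1)[of L] J L by blast
    have "Ass J \<subseteq> insert Q (Ass L)"
    proof
      fix P assume "P \<in> Ass J"
      then obtain v d where v: "P = colon J v" "v \<in> A" "hdeg d v" "prm P" by (auto simp: Ass_def)
      show "P \<in> insert Q (Ass L)"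
      proof (cases "\<exists>s\<in>A. s * v \<in> L \<and> s * v \<notin> J")
        case True
        then obtain s j t where s: "s \<in> A" "s * v \<notin> J" "j \<in> J" "t \<in> A" "s * v = j + u * t"
          by (auto simp: L_def adj_def)
        have cong: "x * (s * v) \<in> J \<longleftrightarrow> x * (t * u) \<in> J" if "x \<in> A" for x
        proof -
          have "x * (s * v) = x * j + x * (t * u)" by (simp add: s(5) algebra_simps)
          moreover have "x * j \<in> J" using idl_mult[OF J that s(3)] .
          ultimately show ?thesis using idl_add[OF J] idl_add_cancel[OF J] by (metis add.commute)
        qed
        have tr: "x \<in> colon J y \<longleftrightarrow> x * (r * y) \<in> J"
          if x: "x \<in> A" and y: "prm (colon J y)" and r: "r \<in> A" "r * y \<notin> J" for x y r
        proof
          assume "x \<in> colon J y"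
          then have "r * (x * y) \<in> J" using idl_mult[OF J r(1)] by (simp add: colon_def)
          then show "x * (r * y) \<in> J" by (simp only: mult.left_commute)
        next
          assume "x * (r * y) \<in> J"
          then have "x * r \<in> colon J y" using x r by (simp add: colon_def mult.assoc polys_mult)
          moreover have "r \<notin> colon J y" using r by (simp add: colon_def)
          ultimately show "x \<in> colon J y" using prm_mult[OF y x r(1)] by blast
        qed
        have "t * u \<notin> J" using s(2) cong[of 1] by simp
        then have "x \<in> P \<longleftrightarrow> x * (s * v) \<in> J" "x \<in> Q \<longleftrightarrow> x * (t * u) \<in> J" if "x \<in> A" for x
          using tr[OF that, of v s] tr[OF that, of u t] s v Q by simp_all
        then have "x \<in> P \<longleftrightarrow> x \<in> Q" for x
          using cong[of x] idl_sub[OF prm_idl[OF v(4)], of x] idl_sub[OF prm_idl[OF Q(4)], of x] by blast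
        then show ?thesis by blast
      next
        case False
        then have "colon L v = P" using adj_sub[OF J, of u] by (auto simp: v(1) colon_def L_def)
        then show ?thesis using v by (auto simp: Ass_def)
      qed
    qed
    then show ?thesis using fin finite_subset by blast
  qed simp
qed

text \<open>Taking powers equalises the degrees of the summands.\<close>

lemma hom_avoidance:
  assumes fin: "finite F" and F: "\<And>P. P \<in> F \<Longrightarrow> prm P" "\<And>P. P \<in> F \<Longrightarrow> hidl P" "\<And>P. P \<in> F \<Longrightarrow> P \<noteq> mm"
  obtains c e where "c \<in> A" "hdeg e c" "e > 0" "\<And>P. P \<in> F \<Longrightarrow> c \<notin> P"
proof -
  \<comment> \<open>Avoiding the maximal members of \<open>F\<close> suffices, and distinct ones
    among them do not contain each other.\<close>
  define G where "G = {P \<in> F. \<forall>Q\<in>F. P \<subseteq> Q \<longrightarrow> Q = P}"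
  have GF: "G \<subseteq> F" by (auto simp: G_def)
  have finG: "finite G" using GF fin by (rule finite_subset)
  have maxG: "\<exists>Q\<in>G. P \<subseteq> Q" if "P \<in> F" for P
  proof -
    have "\<exists>Q\<in>F. P \<subseteq> Q \<and> (\<forall>L\<in>F. Q \<subseteq> L \<longrightarrow> L = Q)"
      using that prm_idl F(1) by (intro noeth_max) auto
    then show ?thesis unfolding G_def by blast
  qed
  have hom_el: "\<exists>b d. b \<in> A \<and> hdeg d b \<and> b \<in> J \<and> b \<notin> P" if "hidl J" "\<not> J \<subseteq> P" "idl P" for J P
  proof (rule ccontr)
    assume n: "\<not> ?thesis"
    have "J \<subseteq> core unit_wt P"
    proof
      fix x assume x: "x \<in> J"
      have "wcomp unit_wt k x \<in> P" for k
      proof (rule ccontr)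
        assume "wcomp unit_wt k x \<notin> P"
        moreover have "wcomp unit_wt k x \<in> J" by (rule hom_comp[OF that(1) x])
        moreover have "wcomp unit_wt k x \<in> A" "hdeg k (wcomp unit_wt k x)"
          using idl_sub[OF hom_idl[OF that(1)] x] by auto
        ultimately show False using n by blast
      qed
      then show "x \<in> core unit_wt P" using idl_sub[OF hom_idl[OF that(1)] x] by (simp add: core_def)
    qed
    then show False using that(2) core_hom(2)[OF that(3)] by blast
  qed
  have "\<exists>b d. b \<in> A \<and> hdeg d b \<and> b \<in> Q \<and> b \<notin> P" if "P \<in> G" "Q \<in> G" "Q \<noteq> P" for P Q
    using that F GF prm_idl by (intro hom_el) (auto simp: G_def)
  then have "\<exists>b. \<forall>P Q. P \<in> G \<longrightarrow> Q \<in> G \<longrightarrow> Q \<noteq> P \<longrightarrow> (\<exists>d. b P Q \<in> A \<and> hdeg d (b P Q) \<and> b P Q \<in> Q \<and> b P Q \<notin> P)"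
    by metis
  then obtain b where b: "\<And>P Q. P \<in> G \<Longrightarrow> Q \<in> G \<Longrightarrow> Q \<noteq> P \<Longrightarrow> \<exists>d. b P Q \<in> A \<and> hdeg d (b P Q) \<and> b P Q \<in> Q \<and> b P Q \<notin> P"
    by blast
  have varex: "\<exists>v\<in>V. mvr v \<notin> P" if "P \<in> F" for P
  proof (rule ccontr)
    assume "\<not> ?thesis"
    then have "mm \<subseteq> P" using that F by (intro mm_least prm_idl) auto
    moreover have "P \<subseteq> mm" using hidl_mm F prm_one that by blast
    ultimately show False using F(3)[OF that] by blast
  qed
  have "\<exists>a. \<exists>d>0. a \<in> A \<and> hdeg d a \<and> a \<notin> P \<and> (\<forall>Q\<in>G. Q \<noteq> P \<longrightarrow> a \<in> Q)" if PG: "P \<in> G" for P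
  proof -
    have PF: "P \<in> F" using PG GF by blast
    \<comment> \<open>The variable serves as an extra factor that makes the degree positive even
      when \<open>G\<close> has only one member.\<close>
    obtain v where v: "v \<in> V" "mvr v \<notin> P" using varex[OF PF] by blast
    define p where "p = prod (b P) (G - {P})"
    have "\<exists>d. \<forall>Q\<in>G - {P}. hdeg (d Q) (b P Q)" using b[OF PG] by (intro bchoice) blast
    then obtain d where d: "\<forall>Q\<in>G - {P}. hdeg (d Q) (b P Q)" by blast
    have hp: "hdeg (sum d (G - {P})) p" unfolding p_def using finG d by (intro whom_prod) auto
    have p: "p \<notin> P" "p \<in> A" using prm_prod[OF F(1)[OF PF], of "G - {P}" "b P"] finG b[OF PG] unfolding p_def by blast+
    have pQ: "p \<in> Q" if "Q \<in> G" "Q \<noteq> P" for Q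
    proof -
      have "p = b P Q * prod (b P) (G - {P} - {Q})"
        unfolding p_def using finG that by (intro prod.remove) auto
      moreover have "prod (b P) (G - {P} - {Q}) \<in> A"
        using prm_prod[OF F(1)[OF PF], of "G - {P} - {Q}" "b P"] finG b[OF PG] by blast
      moreover have "idl Q" using that GF F(1) prm_idl by blast
      ultimately show ?thesis using b[OF PG that] idl_mult_right by metis
    qed
    have "mvr v * p \<notin> P" using prm_mult[OF F(1)[OF PF], of "mvr v" p] v p by auto
    moreover have "hdeg (Suc 0 + sum d (G - {P})) (mvr v * p)" using hp by (intro whom_mult) auto
    moreover have "mvr v * p \<in> Q" if "Q \<in> G" "Q \<noteq> P" for Q
    proof -
      have "idl Q" using that GF F(1) prm_idl by blast
      then show ?thesis using idl_mult pQ[OF that] v(1) by simp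
    qed
    ultimately show ?thesis using v(1) p(2)
      by (intro exI[of _ "mvr v * p"] exI[of _ "Suc 0 + sum d (G - {P})"]) auto
  qed
  then obtain a d where a: "\<And>P. P \<in> G \<Longrightarrow> d P > 0 \<and> a P \<in> A \<and> hdeg (d P) (a P) \<and> a P \<notin> P \<and> (\<forall>Q\<in>G. Q \<noteq> P \<longrightarrow> a P \<in> Q)"
    by metis
  define e where "e = prod d G"
  define c where "c = (\<Sum>P\<in>G. a P ^ (e div d P))"
  have e0: "e > 0" unfolding e_def using a by (intro prod_pos) auto
  have div: "d P * (e div d P) = e" "e div d P > 0" if "P \<in> G" for P
  proof -
    have "d P dvd e" unfolding e_def using finG that by (intro dvd_prodI) auto
    then show e: "d P * (e div d P) = e" by simp
    show "e div d P > 0" using e0 e by (metis gr0I mult_0_right less_irrefl)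
  qed
  show thesis
  proof (rule that)
    show "c \<in> A" unfolding c_def using a by (intro polys_sum polys_power) auto
    show "hdeg e c" unfolding c_def
    proof (rule whom_sum)
      fix P assume "P \<in> G"
      then show "hdeg e (a P ^ (e div d P))" using whom_power[of _ "d P" "a P" "e div d P"] a div by metis
    qed
    show "e > 0" by (rule e0)
    fix P assume "P \<in> F"
    then obtain Q where Q: "Q \<in> G" "P \<subseteq> Q" using maxG by blast
    have iQ: "idl Q" "prm Q" using Q GF F(1) prm_idl by blast+
    \<comment> \<open>Modulo \<open>Q\<close> only one summand survives: the other
      \<open>a P\<close> lie in \<open>Q\<close> and occur with positive exponents.\<close>
    have "c = a Q ^ (e div d Q) + (\<Sum>P\<in>G - {Q}. a P ^ (e div d P))"
      unfolding c_def by (rule sum.remove[OF finG Q(1)])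
    moreover have "(\<Sum>P\<in>G - {Q}. a P ^ (e div d P)) \<in> Q"
    proof (rule idl_sum[OF iQ(1)])
      fix P assume P: "P \<in> G - {Q}"
      then have "a P \<in> Q" using a Q(1) by blast
      moreover obtain k where "e div d P = Suc k" using div(2)[of P] P gr0_implies_Suc by blast
      ultimately show "a P ^ (e div d P) \<in> Q"
        using a[of P] P idl_mult_right[OF iQ(1), of "a P ^ k" "a P"] by (simp add: polys_power)
    qed
    moreover have "a Q ^ (e div d Q) \<notin> Q" using prm_power[OF iQ(2)] a[OF Q(1)] by blast
    ultimately have "c \<notin> Q"
      using idl_add_cancel[OF iQ(1), of "a Q ^ (e div d Q)" "\<Sum>P\<in>G - {Q}. a P ^ (e div d P)"] by auto
    then show "c \<notin> P" using Q(2) by blast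
  qed
qed

section \<open>Depth\<close>

text \<open>Regular sequences of forms may be permuted. A form \<open>u\<close> of degree
  \<open>k\<close> with \<open>c * u\<close> in \<open>J\<close> lies in \<open>J + (a)\<close>, and
  its cofactor, of degree \<open>k - e\<close>, is again killed by \<open>c\<close> modulo
  \<open>J\<close>. As \<open>e > 0\<close>, induction on the degree puts \<open>u\<close> into
  \<open>J\<close>. The second claim is a direct computation.\<close>

lemma nzd_swap:
  assumes J: "hidl J" and a: "a \<in> A" "hdeg e a" "e > 0" "nzd J a"
    and c: "c \<in> A" "hdeg d c" "nzd (adj J a) c"
  shows "nzd J c" and "nzd (adj J c) a"
proof -
  note iJ = hom_idl[OF J]
  have low: "u \<in> A \<Longrightarrow> hdeg k u \<Longrightarrow> c * u \<in> J \<Longrightarrow> u \<in> J" for u k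
  proof (induction k arbitrary: u rule: less_induct)
    case (less k)
    have "c * u \<in> adj J a" using less.prems adj_sub[OF iJ] by blast
    then have "u \<in> adj J a" using c(3) less.prems by (simp add: nzd_def)
    then obtain j q where jq: "j \<in> J" "q \<in> A" "u = j + a * q" by (auto simp: adj_def)
    have "u = wcomp unit_wt k u" using wcomp_whom[OF less.prems(2), of k] by simp
    then have u: "u = wcomp unit_wt k j + (if e \<le> k then a * wcomp unit_wt (k - e) q else 0)"
      using wcomp_mult_hom[OF a(2), of k q] by (simp add: jq(3) restr_add mult.commute[of a])
    have jk: "wcomp unit_wt k j \<in> J" using hom_comp[OF J jq(1)] .
    show ?case
    proof (cases "e \<le> k")
      case False
      then show ?thesis using u jk by simp
    next
      case True
      let ?q = "wcomp unit_wt (k - e) q"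
      have uq: "u = wcomp unit_wt k j + a * ?q" using u True by simp
      have "a * (c * ?q) = c * u - c * wcomp unit_wt k j" by (simp add: uq algebra_simps)
      also have "\<dots> \<in> J" using less.prems(3) jk idl_mult[OF iJ c(1)] by (intro idl_diff[OF iJ]) auto
      finally have "c * ?q \<in> J" using a(4) c(1) jq(2) by (auto simp: nzd_def)
      then have "?q \<in> J" using less.IH[of "k - e" ?q] True a(3) jq(2) by auto
      then show ?thesis unfolding uq using jk a(1) by (intro idl_add[OF iJ] idl_mult[OF iJ])
    qed
  qed
  show "nzd J c"
  proof (rule ccontr)
    assume n: "\<not> nzd J c"
    obtain u k where "u \<in> A" "hdeg k u" "u \<notin> J" "c * u \<in> J" by (rule hom_zero_divisor[OF J c(1,2) n])
    with low show False by blast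
  qed
  show "nzd (adj J c) a" unfolding nzd_def
  proof (intro ballI impI)
    fix u assume u: "u \<in> A" "a * u \<in> adj J c"
    then obtain j v where v: "j \<in> J" "v \<in> A" "a * u = j + c * v" by (auto simp: adj_def)
    have "c * v \<in> adj J a" unfolding adj_def using v u
      by (intro CollectI exI[of _ "- j"] exI[of _ u]) (auto intro: idl_uminus[OF iJ])
    then have "v \<in> adj J a" using c(3) v(2) by (simp add: nzd_def)
    then obtain j' v' where v': "j' \<in> J" "v' \<in> A" "v = j' + a * v'" by (auto simp: adj_def)
    have "a * (u - c * v') = j + c * j'" using v(3) by (simp add: v'(3) algebra_simps)
    also have "\<dots> \<in> J" using v v' c(1) by (intro idl_add[OF iJ] idl_mult[OF iJ])
    finally have "u - c * v' \<in> J" using a(4) u(1) c(1) v'(2) by (auto simp: nzd_def)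
    then show "u \<in> adj J c" unfolding adj_def using v'(2)
      by (intro CollectI exI[of _ "u - c * v'"] exI[of _ v']) simp
  qed
qed

text \<open>Existence of a regular sequence of \<open>k\<close> forms of positive degree.
  Restricting \<open>dep\<close> to forms makes exchange and prime avoidance available.\<close>

primrec hdep :: "nat \<Rightarrow> ('v, 'k) mpoly set \<Rightarrow> bool" where
  "hdep 0 J \<longleftrightarrow> True"
| "hdep (Suc k) J \<longleftrightarrow> (\<exists>a e. a \<in> A \<and> hdeg e a \<and> e > 0 \<and> nzd J a \<and> hdep k (adj J a))"

lemma Ass_nzd: "nzd J b \<Longrightarrow> P \<in> Ass J \<Longrightarrow> b \<notin> P"
proof
  assume b: "nzd J b" and "P \<in> Ass J" "b \<in> P"
  then obtain u where u: "u \<in> A" "P = colon J u" "prm P" by (auto simp: Ass_def)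
  then have "b * u \<in> J" using \<open>b \<in> P\<close> by (simp add: colon_def)
  then have "1 \<in> P" using b u(1,2) by (simp add: nzd_def colon_def)
  then show False using prm_one[OF u(3)] by blast
qed

text \<open>For \<open>x\<close> in \<open>mm\<close> and \<open>M = S/J\<close>, this reflects that
  the socles of \<open>M/xM\<close> and \<open>M/aM\<close> are both isomorphic to the first Ext of
  the residue field into \<open>M\<close>. The socle class \<open>w\<close> is sent to the
  \<open>z\<close> with \<open>a * w\<close> congruent to \<open>x * z\<close> modulo
  \<open>J\<close>.\<close>

lemma socle_exchange:
  assumes J: "idl J" and a: "a \<in> mm" "nzd J a" and x: "x \<in> A" "nzd J x"
    and w: "w \<in> A" "w \<notin> adj J x" "\<And>y. y \<in> mm \<Longrightarrow> y * w \<in> adj J x"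
  obtains z where "z \<in> A" "z \<notin> adj J a" "\<And>y. y \<in> mm \<Longrightarrow> y * z \<in> adj J a"
proof -
  obtain j z where z: "j \<in> J" "z \<in> A" "a * w = j + x * z" using w(3)[OF a(1)] by (auto simp: adj_def)
  have aA: "a \<in> A" using a(1) mm_A by blast
  show thesis
  proof (rule that)
    show "z \<in> A" by (rule z(2))
    show "z \<notin> adj J a"
    proof
      assume "z \<in> adj J a"
      then obtain j' q where q: "j' \<in> J" "q \<in> A" "z = j' + a * q" by (auto simp: adj_def)
      have "a * (w - x * q) = j + x * j'" using z(3) by (simp add: q(3) algebra_simps)
      also have "\<dots> \<in> J" using z q x by (intro idl_add[OF J] idl_mult[OF J])
      finally have "w - x * q \<in> J" using a(2) w(1) x(1) q(2) by (auto simp: nzd_def)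
      then have "w \<in> adj J x" unfolding adj_def using q(2)
        by (intro CollectI exI[of _ "w - x * q"] exI[of _ q]) simp
      then show False using w(2) by blast
    qed
    show "y * z \<in> adj J a" if y: "y \<in> mm" for y
    proof -
      have yA: "y \<in> A" using y mm_A by blast
      obtain k q where q: "k \<in> J" "q \<in> A" "y * w = k + x * q" using w(3)[OF y] by (auto simp: adj_def)
      have "x * (y * z) = y * (a * w) - y * j" using z(3) by (simp add: algebra_simps)
      also have "\<dots> = a * (y * w) - y * j" by (simp add: mult.left_commute)
      also have "\<dots> = a * (k + x * q) - y * j" by (simp only: q(3))
      finally have "x * (y * z - a * q) = a * k - y * j" by (simp add: algebra_simps)
      also have "\<dots> \<in> J" using idl_mult[OF J] aA yA q z by (intro idl_diff[OF J]) auto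
      finally have "y * z - a * q \<in> J" using x(2) yA z(2) aA q(2) by (auto simp: nzd_def)
      then show ?thesis unfolding adj_def using q(2)
        by (intro CollectI exI[of _ "y * z - a * q"] exI[of _ q]) simp
    qed
  qed
qed

text \<open>Depth drops by one for whichever regular form is chosen. Since \<open>mm\<close> is not
  associated to \<open>J + (a)\<close>, socle exchange excludes it for \<open>J + (x)\<close> too,
  and avoidance gives a form \<open>c\<close> regular modulo both. The induction hypothesis passes
  from \<open>J + (a)\<close> to \<open>J + (a, c)\<close>; reordering gives \<open>J + (c)\<close>
  the full depth, and a second application passes to \<open>J + (c, x)\<close>.\<close>

lemma hdep_adj:
  "hidl J \<Longrightarrow> 1 \<notin> J \<Longrightarrow> hdep (Suc k) J \<Longrightarrow> x \<in> A \<Longrightarrow> hdeg e x \<Longrightarrow> e > 0 \<Longrightarrow> nzd J x \<Longrightarrow> hdep k (adj J x)"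
proof (induction k arbitrary: J x e)
  case (Suc k)
  note J = Suc.prems(1) and x = Suc.prems(4-7)
  note iJ = hom_idl[OF J]
  obtain a d where a: "a \<in> A" "hdeg d a" "d > 0" "nzd J a" "hdep (Suc k) (adj J a)"
    using Suc.prems(3) by auto
  then obtain b f where b: "b \<in> A" "hdeg f b" "f > 0" "nzd (adj J a) b" by auto
  have am: "a \<in> mm" "b \<in> mm" "x \<in> mm" using hdeg_mm a b x by blast+
  have Ja: "hidl (adj J a)" and Jx: "hidl (adj J x)" using hom_adj[OF J] a x by blast+
  have no_socle: "z \<in> adj J a" if "z \<in> A" "\<And>y. y \<in> mm \<Longrightarrow> y * z \<in> adj J a" for z
    using that am(2) b(4) by (auto simp: nzd_def)
  have 1: "mm \<notin> Ass (adj J a)" using Ass_nzd[OF b(4)] am(2) by blast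
  have 2: "mm \<notin> Ass (adj J x)"
  proof
    assume "mm \<in> Ass (adj J x)"
    then obtain w where w: "w \<in> A" "mm = colon (adj J x) w" by (auto simp: Ass_def)
    then have "w \<notin> adj J x" "\<And>y. y \<in> mm \<Longrightarrow> y * w \<in> adj J x"
      using prm_one[OF mm_prm] by (auto simp: colon_def)
    then obtain z where "z \<in> A" "z \<notin> adj J a" "\<And>y. y \<in> mm \<Longrightarrow> y * z \<in> adj J a"
      using socle_exchange[OF iJ am(1) a(4) x(1,4) w(1)] by metis
    with no_socle show False by blast
  qed
  have fin: "finite (Ass (adj J a) \<union> Ass (adj J x))" using Ass_finite Ja Jx by blast
  obtain c g where c: "c \<in> A" "hdeg g c" "g > 0" "\<And>P. P \<in> Ass (adj J a) \<union> Ass (adj J x) \<Longrightarrow> c \<notin> P"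
    by (rule hom_avoidance[OF fin]) (use Ass_prm Ass_hom Ja Jx 1 2 in blast)+
  have ca: "nzd (adj J a) c"
  proof (rule ccontr)
    assume "\<not> nzd (adj J a) c"
    then obtain P where "P \<in> Ass (adj J a)" "c \<in> P" by (rule Ass_zero_divisor[OF Ja c(1,2)])
    then show False using c(4) by blast
  qed
  have cx: "nzd (adj J x) c"
  proof (rule ccontr)
    assume "\<not> nzd (adj J x) c"
    then obtain P where "P \<in> Ass (adj J x)" "c \<in> P" by (rule Ass_zero_divisor[OF Jx c(1,2)])
    then show False using c(4) by blast
  qed
  have c': "nzd J c" "nzd (adj J c) a" "nzd (adj J c) x"
    using nzd_swap[OF J a(1-4) c(1,2) ca] nzd_swap(2)[OF J x c(1,2) cx] by blast+
  have Jc: "hidl (adj J c)" using hom_adj[OF J c(1,2)] .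
  have proper: "1 \<notin> adj J a" "1 \<notin> adj J c"
    using hom_adj_proper[OF J Suc.prems(2)] am(1) hdeg_mm[OF c(1-3)] by blast+
  have "hdep k (adj (adj J a) c)" by (rule Suc.IH[OF Ja proper(1) a(5) c(1-3) ca])
  then have "hdep k (adj (adj J c) a)" by (simp add: adj_comm[OF iJ a(1) c(1)])
  then have "hdep (Suc k) (adj J c)" using a c'(2) by auto
  then have "hdep k (adj (adj J c) x)" by (rule Suc.IH[OF Jc proper(2) _ x(1-3) c'(3)])
  then have "hdep k (adj (adj J x) c)" by (simp add: adj_comm[OF iJ x(1) c(1)])
  then show ?case using c cx by auto
qed simp

text \<open>The contraction of the localization of \<open>J\<close> at the irrelevant ideal.\<close>

definition loc :: "('v, 'k) mpoly set \<Rightarrow> ('v, 'k) mpoly set" where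
  "loc J = {f \<in> A. \<exists>y\<in>A. y \<notin> mm \<and> y * f \<in> J}"

lemma not_mm: "y \<in> A \<Longrightarrow> y \<notin> mm \<longleftrightarrow> cf y 0 \<noteq> 0"
  by (simp add: mm_def)

lemma locI: "f \<in> A \<Longrightarrow> y \<in> A \<Longrightarrow> y \<notin> mm \<Longrightarrow> y * f \<in> J \<Longrightarrow> f \<in> loc J"
  by (auto simp: loc_def)

lemma mult_not_mm: "y \<in> A \<Longrightarrow> z \<in> A \<Longrightarrow> y \<notin> mm \<Longrightarrow> z \<notin> mm \<Longrightarrow> y * z \<in> A \<and> y * z \<notin> mm"
  using prm_mult[OF mm_prm] by auto

lemma loc_idl:
  assumes J: "idl J"
  shows "idl (loc J)"
proof (rule idlI)
  show "0 \<in> loc J" using idl_zero[OF J] prm_one[OF mm_prm] by (intro locI[of _ 1]) auto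
  show "x + y \<in> loc J" if xy: "x \<in> loc J" "y \<in> loc J" for x y
  proof -
    obtain s t where s: "s \<in> A" "s \<notin> mm" "s * x \<in> J" and t: "t \<in> A" "t \<notin> mm" "t * y \<in> J"
      using xy by (auto simp: loc_def)
    have "(s * t) * (x + y) = t * (s * x) + s * (t * y)" by (simp add: algebra_simps)
    also have "\<dots> \<in> J" by (rule idl_add[OF J idl_mult[OF J t(1) s(3)] idl_mult[OF J s(1) t(3)]])
    finally show ?thesis using mult_not_mm[OF s(1) t(1) s(2) t(2)] xy by (intro locI[of _ "s * t"]) (auto simp: loc_def)
  qed
  show "a * x \<in> loc J" if ax: "a \<in> A" "x \<in> loc J" for a x
  proof -
    obtain s where s: "s \<in> A" "s \<notin> mm" "s * x \<in> J" using ax by (auto simp: loc_def)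
    have "s * (a * x) \<in> J" using idl_mult[OF J ax(1) s(3)] by (simp only: mult.left_commute)
    then show ?thesis using s ax by (intro locI[of _ s]) (auto simp: loc_def)
  qed
qed (auto simp: loc_def)

lemma loc_sub: "idl J \<Longrightarrow> J \<subseteq> loc J"
  using prm_one[OF mm_prm] idl_sub by (auto intro!: locI[of _ 1])

lemma loc_mono: "J \<subseteq> L \<Longrightarrow> loc J \<subseteq> loc L"
  by (auto simp: loc_def)

lemma loc_loc: "idl J \<Longrightarrow> loc (loc J) = loc J"
proof
  assume J: "idl J"
  show "loc (loc J) \<subseteq> loc J"
  proof
    fix f assume "f \<in> loc (loc J)"
    then obtain y z where y: "f \<in> A" "y \<in> A" "y \<notin> mm" "z \<in> A" "z \<notin> mm" "z * (y * f) \<in> J" by (auto simp: loc_def)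
    then have "(z * y) * f \<in> J" by (simp only: mult.assoc)
    then show "f \<in> loc J" using locI[of f "z * y" J] mult_not_mm[of z y] y by blast
  qed
  show "loc J \<subseteq> loc (loc J)" by (rule loc_sub[OF loc_idl[OF J]])
qed

lemma loc_nzd:
  assumes "nzd J h" "h \<in> A"
  shows "nzd (loc J) h"
  unfolding nzd_def
proof (intro ballI impI)
  fix u assume u: "u \<in> A" "h * u \<in> loc J"
  then obtain y where y: "y \<in> A" "y \<notin> mm" "y * (h * u) \<in> J" by (auto simp: loc_def)
  then have "h * (y * u) \<in> J" by (simp only: mult.left_commute)
  then have "y * u \<in> J" using assms u(1) y(1) by (auto simp: nzd_def)
  then show "u \<in> loc J" using locI u(1) y by blast
qed

text \<open>If \<open>y\<close> has a nonzero constant term, the degree \<open>k\<close> component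
  of \<open>y * f\<close> is that constant times the component of \<open>f\<close>, plus multiples
  of lower components of \<open>f\<close>. Induction on \<open>k\<close> puts all components of
  \<open>f\<close> into \<open>J\<close>.\<close>

lemma loc_hidl: "hidl J \<Longrightarrow> loc J = J"
proof
  assume J: "hidl J"
  note iJ = hom_idl[OF J]
  show "J \<subseteq> loc J" by (rule loc_sub[OF iJ])
  show "loc J \<subseteq> J"
  proof
    fix f assume "f \<in> loc J"
    then obtain y where y: "f \<in> A" "y \<in> A" "cf y 0 \<noteq> 0" "y * f \<in> J" by (auto simp: loc_def not_mm)
    have "wcomp unit_wt k f \<in> J" for k
    proof (induction k rule: less_induct)
      case (less k)
      let ?t = "\<lambda>i. wcomp unit_wt i y * wcomp unit_wt (k - i) f"
      have "wcomp unit_wt k (y * f) = ?t 0 + (\<Sum>i\<in>{..k} - {0}. ?t i)"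
        unfolding wcomp_mult by (rule sum.remove) auto
      moreover have "wcomp unit_wt k (y * f) \<in> J" by (rule hom_comp[OF J y(4)])
      moreover have "(\<Sum>i\<in>{..k} - {0}. ?t i) \<in> J"
      proof (rule idl_sum[OF iJ])
        fix i assume "i \<in> {..k} - {0}"
        then have "k - i < k" by auto
        then show "?t i \<in> J" using less y(2) by (intro idl_mult[OF iJ]) auto
      qed
      ultimately have "?t 0 \<in> J"
        using idl_add_cancel[OF iJ, of "?t 0" "\<Sum>i\<in>{..k} - {0}. ?t i"] by simp
      moreover have "wcomp unit_wt 0 y = const (cf y 0)"
        using hdeg_0[of "wcomp unit_wt 0 y", OF whom_wcomp] by (simp add: lookup_restr)
      ultimately have "const (cf y 0) * wcomp unit_wt k f \<in> J" by simp
      then have "const (1 / cf y 0) * (const (cf y 0) * wcomp unit_wt k f) \<in> J" by (rule idl_const[OF iJ])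
      then show ?case using y(3) by (simp add: mult.assoc[symmetric] mult_single)
    qed
    then show "f \<in> J" by (rule hom_mem[OF J])
  qed
qed

text \<open>A form of Nakayama's lemma: a submodule \<open>M\<close> maximal among the proper local ones would make
  \<open>N/M\<close> locally cyclic.\<close>

lemma nakayama_loc:
  assumes N: "idl N" "loc N = N" and L: "idl L" "loc L = L" "L \<subseteq> N" and h: "h \<in> mm"
    and gen: "\<And>n. n \<in> N \<Longrightarrow> \<exists>y\<in>A. \<exists>j\<in>L. \<exists>w\<in>N. y \<notin> mm \<and> y * n = j + h * w"
  shows "N = L"
proof (rule ccontr)
  assume "N \<noteq> L"
  let ?F = "{M. idl M \<and> loc M = M \<and> L \<subseteq> M \<and> M \<subseteq> N \<and> M \<noteq> N}"
  have hA: "h \<in> A" using h mm_A by blast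
  have "\<exists>M\<in>?F. L \<subseteq> M \<and> (\<forall>M'\<in>?F. M \<subseteq> M' \<longrightarrow> M' = M)"
    by (rule noeth_max) (use L \<open>N \<noteq> L\<close> in auto)
  then obtain M where "M \<in> ?F" and max: "\<forall>M'\<in>?F. M \<subseteq> M' \<longrightarrow> M' = M" by (elim bexE conjE)
  then have M: "idl M" "loc M = M" "L \<subseteq> M" "M \<subseteq> N" "M \<noteq> N" by blast+
  then obtain n where n: "n \<in> N" "n \<notin> M" by blast
  have nA: "n \<in> A" using idl_sub[OF N(1) n(1)] .
  have iM: "idl (adj M n)" by (rule adj_idl[OF M(1) nA])
  have "adj M n \<subseteq> N" using adj_least[OF N(1) M(4) n(1)] .
  then have sub: "loc (adj M n) \<subseteq> N" using loc_mono[of "adj M n" N] N(2) by simp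
  have sup: "M \<subseteq> loc (adj M n)" "n \<in> loc (adj M n)"
    using adj_sub[OF M(1), of n] adj_mem[OF M(1), of n] loc_sub[OF iM] by blast+
  have "loc (adj M n) = N"
  proof (rule ccontr)
    assume "loc (adj M n) \<noteq> N"
    then have "loc (adj M n) \<in> ?F" using loc_idl[OF iM] loc_loc[OF iM] sub sup(1) M(3) by blast
    then have "loc (adj M n) = M" using bspec[OF max] sup(1) by simp
    then show False using sup(2) n(2) by simp
  qed
  moreover obtain y j w where w: "y \<in> A" "j \<in> L" "w \<in> N" "y \<notin> mm" "y * n = j + h * w" using gen[OF n(1)] by blast
  ultimately have "w \<in> loc (adj M n)" by simp
  then obtain z where z: "z \<in> A" "z \<notin> mm" "z * w \<in> adj M n" by (auto simp: loc_def)
  then obtain \<mu> q where q: "\<mu> \<in> M" "q \<in> A" "z * w = \<mu> + n * q" by (auto simp: adj_def)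
  have "z * (y * n) = z * j + h * (z * w)" using w(5) by (simp add: algebra_simps)
  then have "z * (y * n) = z * j + h * (\<mu> + n * q)" by (simp only: q(3))
  then have "(z * y - h * q) * n = z * j + h * \<mu>" by (simp add: algebra_simps)
  also have "\<dots> \<in> M" using w(2) M(3) q(1) z(1) hA by (intro idl_add[OF M(1)] idl_mult[OF M(1)]) auto
  finally have *: "(z * y - h * q) * n \<in> M" .
  have "z * y - h * q \<in> A" using z w hA q by auto
  moreover have "cf (z * y - h * q) 0 \<noteq> 0" using z w h by (simp add: lookup_minus not_mm mm_def)
  ultimately have "n \<in> loc M" using * by (intro locI[OF nA]) (auto simp: not_mm)
  then show False using n(2) M(2) by simp
qed

primrec dep :: "nat \<Rightarrow> ('v, 'k) mpoly set \<Rightarrow> bool" where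
  "dep 0 J \<longleftrightarrow> True"
| "dep (Suc k) J \<longleftrightarrow> (\<exists>h\<in>mm. nzd J h \<and> dep k (adj J h))"

lemma hdep_dep: "hdep k J \<Longrightarrow> dep k J"
  by (induction k arbitrary: J) (use hdeg_mm in fastforce)+

text \<open>Every regular element lowers the dimension, and staying inside \<open>mm\<close> keeps
  the successive ideals proper.\<close>

lemma dep_le_pdim: "idl J \<Longrightarrow> J \<subseteq> mm \<Longrightarrow> dep k J \<Longrightarrow> k \<le> pdim J"
proof (induction k arbitrary: J)
  case (Suc k)
  then obtain h where h: "h \<in> mm" "nzd J h" "dep k (adj J h)" by auto
  have hA: "h \<in> A" using h mm_A by blast
  have sub: "adj J h \<subseteq> mm" using adj_least[OF mm_idl Suc.prems(2) h(1)] .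
  then have "1 \<notin> adj J h" using prm_one[OF mm_prm] by blast
  then have "Suc (pdim (adj J h)) \<le> pdim J" by (rule pdim_adj_nzd[OF Suc.prems(1) hA h(2)])
  then show ?case using Suc.IH[OF adj_idl[OF Suc.prems(1) hA] sub h(3)] by simp
qed simp

text \<open>Modulo a regular element \<open>h\<close>, the associated prime \<open>P\<close> is contained in a strictly larger
  associated prime, whose dimension is smaller.\<close>

lemma dep_le_pdim_assoc:
  "dep k J \<Longrightarrow> idl J \<Longrightarrow> prm P \<Longrightarrow> P \<subseteq> mm \<Longrightarrow> u \<in> A \<Longrightarrow> u \<notin> loc J \<Longrightarrow> (\<And>p. p \<in> P \<Longrightarrow> p * u \<in> loc J) \<Longrightarrow> k \<le> pdim P"
proof (induction k arbitrary: J P u)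
  case (Suc k)
  note J = Suc.prems(2) and P = Suc.prems(3,4) and u = Suc.prems(5-7)
  obtain h where h: "h \<in> mm" "nzd J h" "dep k (adj J h)" using Suc.prems(1) by auto
  have hA: "h \<in> A" using h mm_A by blast
  define L where "L = loc J"
  have L: "idl L" "loc L = L" "J \<subseteq> L" unfolding L_def using loc_idl[OF J] loc_loc[OF J] loc_sub[OF J] by auto
  have hL: "nzd L h" unfolding L_def by (rule loc_nzd[OF h(2) hA])
  have iJh: "idl (adj J h)" by (rule adj_idl[OF J hA])
  define L1 where "L1 = loc (adj J h)"
  have L1: "idl L1" "loc L1 = L1" "adj J h \<subseteq> L1" "L \<subseteq> L1" unfolding L1_def L_def
    using loc_idl[OF iJh] loc_loc[OF iJh] loc_sub[OF iJh] loc_mono[OF adj_sub[OF J]] by auto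
  have hP: "h \<notin> P" using u hL by (auto simp: nzd_def L_def)
  have PA: "p \<in> A" if "p \<in> P" for p using idl_sub[OF prm_idl[OF P(1)] that] .
  \<comment> \<open>\<open>N / L\<close> is the part of \<open>S / L\<close> killed by
    \<open>P\<close>. It is nonzero because it contains the class of \<open>u\<close>.\<close>
  define N where "N = {n \<in> A. \<forall>p\<in>P. p * n \<in> L}"
  have iN: "idl N"
    by (rule idlI) (auto simp: N_def distrib_left mult.left_commute intro: idl_zero[OF L(1)] idl_add[OF L(1)] idl_mult[OF L(1)])
  have LN: "L \<subseteq> N" using idl_sub[OF L(1)] idl_mult[OF L(1)] PA by (auto simp: N_def)
  have "loc N \<subseteq> N"
  proof
    fix n assume "n \<in> loc N"
    then obtain y where y: "n \<in> A" "y \<in> A" "y \<notin> mm" "\<forall>p\<in>P. p * (y * n) \<in> L" by (auto simp: loc_def N_def)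
    have "p * n \<in> loc L" if "p \<in> P" for p
      using y PA[OF that] bspec[OF y(4) that] by (intro locI[of _ y]) (auto simp: mult.left_commute)
    then show "n \<in> N" using y(1) L(2) by (simp add: N_def)
  qed
  then have lN: "loc N = N" using loc_sub[OF iN] by blast
  \<comment> \<open>Otherwise every element of \<open>N\<close> is locally in
    \<open>J + (h)\<close>. Its cofactor of \<open>h\<close> is again killed by \<open>P\<close>, as
    \<open>h\<close> is regular modulo \<open>L\<close>, so \<open>N = L + h N\<close> locally and
    Nakayama gives \<open>N = L\<close>.\<close>
  have "\<exists>n\<in>N. n \<notin> L1"
  proof (rule ccontr)
    assume "\<not> (\<exists>n\<in>N. n \<notin> L1)"
    then have NL1: "\<And>n. n \<in> N \<Longrightarrow> n \<in> L1" by blast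
    have "N = L"
    proof (rule nakayama_loc[OF iN lN L(1,2) LN h(1)])
      fix n assume nN: "n \<in> N"
      from NL1[OF this] have "n \<in> loc (adj J h)" by (simp only: L1_def)
      then obtain y where y: "y \<in> A" "y \<notin> mm" "y * n \<in> adj J h" by (auto simp: loc_def)
      then obtain j w where w: "j \<in> J" "w \<in> A" "y * n = j + h * w" by (auto simp: adj_def)
      have "p * w \<in> L" if p: "p \<in> P" for p
      proof -
        have "h * (p * w) = y * (p * n) - p * j" using arg_cong[OF w(3), of "\<lambda>x. p * x"] by (simp add: algebra_simps)
        moreover have "y * (p * n) \<in> L" using nN p y(1) by (intro idl_mult[OF L(1) y(1)]) (simp add: N_def)
        then have "y * (p * n) - p * j \<in> L" using w(1) L(3) by (intro idl_diff[OF L(1) _ idl_mult[OF L(1) PA[OF p]]]) auto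
        ultimately have "h * (p * w) \<in> L" by simp
        then show ?thesis using hL polys_mult[OF PA[OF p] w(2)] by (simp add: nzd_def)
      qed
      then have "w \<in> N" using w(2) by (simp add: N_def)
      then show "\<exists>y\<in>A. \<exists>j\<in>L. \<exists>w\<in>N. y \<notin> mm \<and> y * n = j + h * w" using y w L(3) by blast
    qed
    then show False using u by (auto simp: N_def L_def)
  qed
  then obtain n where n: "n \<in> N" "n \<notin> L1" by blast
  have nA: "n \<in> A" using n(1) by (simp add: N_def)
  \<comment> \<open>\<open>L1\<close> need not be homogeneous in the standard grading, so its
    associated prime is obtained with weight zero.\<close>
  have hom0: "hom (\<lambda>_. 0) L1" using L1(1) hom_const_weight by blast
  have wh0: "whom (\<lambda>_. 0) 0 n" by (simp add: whom_def wdeg_def)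
  obtain v d where v: "v \<in> A" "prm (colon L1 v)" "colon L1 n \<subseteq> colon L1 v"
    by (rule prime_colon_exists[OF hom0 nA wh0 n(2)])
  let ?Q = "colon L1 v"
  have vL: "v \<notin> L1" using prm_one[OF v(2)] v(1) by (auto simp: colon_def)
  have "P \<subseteq> colon L1 n" using n(1) PA L1(4) by (auto simp: N_def colon_def)
  then have PQ: "P \<subseteq> ?Q" using v(3) by blast
  have "h * v \<in> adj J h" unfolding adj_def using idl_zero[OF J] v(1) by (intro CollectI exI[of _ 0] exI[of _ v]) auto
  then have hQ: "h \<in> ?Q" using L1(3) hA by (auto simp: colon_def)
  have Qm: "?Q \<subseteq> mm"
  proof
    fix y assume y: "y \<in> ?Q"
    show "y \<in> mm"
    proof (rule ccontr)
      assume "y \<notin> mm"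
      then have "v \<in> loc L1" using y v(1) by (intro locI[of _ y]) (auto simp: colon_def)
      then show False using vL L1(2) by simp
    qed
  qed
  have "k \<le> pdim ?Q"
    by (rule Suc.IH[OF h(3) iJh v(2) Qm v(1)]) (use vL in \<open>auto simp: L1_def[symmetric] colon_def\<close>)
  moreover have "pdim ?Q < pdim P" using PQ hQ hP by (intro pdim_strict[OF P(1) v(2)]) blast
  ultimately show ?case by simp
qed simp

text \<open>The maximal \<open>M = colon J w\<close> with \<open>w\<close> outside \<open>P\<close>
  plays the role of \<open>J\<close> localized at \<open>P\<close>: multiplying \<open>w\<close> by
  further elements outside \<open>P\<close> does not enlarge it. An associated prime of
  \<open>M\<close> therefore lies inside \<open>P\<close>, contains \<open>J\<close>, and equals
  \<open>P\<close> by minimality. Since \<open>P\<close> is inside \<open>mm\<close>, the element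
  found survives in \<open>S / loc J\<close>.\<close>

lemma minprime_assoc:
  assumes J: "idl J" and P: "minprime J P" "P \<subseteq> mm"
  obtains u where "u \<in> A" "u \<notin> loc J" "\<And>p. p \<in> P \<Longrightarrow> p * u \<in> J"
proof -
  have pP: "prm P" and JP: "J \<subseteq> P" using P(1) by (auto simp: minprime_def)
  let ?F = "{colon J w | w. w \<in> A \<and> w \<notin> P}"
  have "colon J 1 \<in> ?F" using prm_one[OF pP] by (intro CollectI exI[of _ 1]) auto
  moreover have "idl M" if "M \<in> ?F" for M using that colon_idl[OF J] by blast
  ultimately have "\<exists>M\<in>?F. colon J 1 \<subseteq> M \<and> (\<forall>M'\<in>?F. M \<subseteq> M' \<longrightarrow> M' = M)" by (rule noeth_max)
  then obtain M where "M \<in> ?F" and max: "\<forall>M'\<in>?F. M \<subseteq> M' \<longrightarrow> M' = M" by (elim bexE conjE)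
  then obtain w where w: "M = colon J w" "w \<in> A" "w \<notin> P" by blast
  have iM: "idl M" unfolding w(1) by (rule colon_idl[OF J w(2)])
  have sat: "colon J (s * w) = M" if s: "s \<in> A" "s \<notin> P" for s
  proof -
    have "s * w \<in> A" "s * w \<notin> P" using prm_mult[OF pP s(1) w(2)] s w by auto
    then have "colon J (s * w) \<in> ?F" by blast
    moreover have "M \<subseteq> colon J (s * w)"
      using idl_mult[OF J s(1)] by (auto simp: w(1) colon_def mult.left_commute[of _ s])
    ultimately show ?thesis using bspec[OF max] by blast
  qed
  have "1 \<notin> M" using w JP by (auto simp: colon_def)
  moreover have "hom (\<lambda>_. 0) M" using iM hom_const_weight by blast
  moreover have "whom (\<lambda>_. 0) 0 (1 :: ('v, 'k) mpoly)" by (simp add: whom_def)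
  ultimately obtain v d where v: "v \<in> A" "prm (colon M v)"
    using prime_colon_exists[of "\<lambda>_. 0" M 1 0] by auto
  have vM: "v \<notin> M" using prm_one[OF v(2)] v(1) by (auto simp: colon_def)
  have "colon M v \<subseteq> P"
  proof
    fix s assume s: "s \<in> colon M v"
    show "s \<in> P"
    proof (rule ccontr)
      assume "s \<notin> P"
      moreover have "v \<in> colon J (s * w)" using s v(1) by (simp add: colon_def w(1) mult_ac)
      ultimately show False using sat[of s] s vM by (auto simp: colon_def)
    qed
  qed
  moreover have "J \<subseteq> colon M v"
    using colon_sub[OF J w(2)] colon_sub[OF iM v(1)] unfolding w(1) by blast
  ultimately have PM: "colon M v = P" using P(1) v(2) by (auto simp: minprime_def)
  show thesis
  proof (rule that[of "v * w"])
    show "v * w \<in> A" using v w by auto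
    show "v * w \<notin> loc J"
    proof
      assume "v * w \<in> loc J"
      then obtain y where y: "y \<in> A" "y \<notin> mm" "y * (v * w) \<in> J" by (auto simp: loc_def)
      then have "v \<in> colon J (y * w)" using v(1) by (simp add: colon_def mult.left_commute)
      then show False using sat[of y] y P(2) vM by auto
    qed
    show "p * (v * w) \<in> J" if "p \<in> P" for p
      using that unfolding PM[symmetric] by (simp add: colon_def w(1) mult.assoc)
  qed
qed

text \<open>With \<open>k = pdim J\<close>, the Cohen-Macaulay case, all minimal primes inside
  \<open>mm\<close> have the dimension of \<open>J\<close>.\<close>

lemma dep_le_pdim_minprime:
  assumes "idl J" "dep k J" "minprime J P" "P \<subseteq> mm"
  shows "k \<le> pdim P"
proof -
  obtain u where u: "u \<in> A" "u \<notin> loc J" "\<And>p. p \<in> P \<Longrightarrow> p * u \<in> J"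
    using minprime_assoc[OF assms(1,3,4)] by blast
  show ?thesis
    by (rule dep_le_pdim_assoc[OF assms(2,1) _ assms(4) u(1,2)])
      (use assms(3) u(3) loc_sub[OF assms(1)] in \<open>auto simp: minprime_def\<close>)
qed

section \<open>Ideals generated by forms\<close>

text \<open>The base \<open>J\<close> lets sequences in \<open>S/J\<close> be handled by
  representatives in \<open>S\<close>. For ideals of \<open>S\<close> itself the base is 0.\<close>

primrec gidb :: "('v, 'k) mpoly set \<Rightarrow> (nat \<Rightarrow> ('v, 'k) mpoly) \<Rightarrow> nat \<Rightarrow> ('v, 'k) mpoly set" where
  "gidb J f 0 = J"
| "gidb J f (Suc i) = adj (gidb J f i) (f i)"

lemma gidb_idl: "idl J \<Longrightarrow> (\<And>i. i < k \<Longrightarrow> f i \<in> A) \<Longrightarrow> idl (gidb J f k)"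
  by (induction k) (auto intro: adj_idl)

lemma gidb_mono: "idl J \<Longrightarrow> (\<And>i. i < k \<Longrightarrow> f i \<in> A) \<Longrightarrow> J \<subseteq> gidb J f k"
proof (induction k)
  case (Suc k)
  then show ?case using adj_sub[OF gidb_idl[of J k f]] by auto
qed simp

lemma gidb_mem: "idl J \<Longrightarrow> (\<And>i. i < k \<Longrightarrow> f i \<in> A) \<Longrightarrow> j < k \<Longrightarrow> f j \<in> gidb J f k"
proof (induction k)
  case (Suc k)
  have i: "idl (gidb J f k)" using Suc.prems by (intro gidb_idl) auto
  show ?case using Suc adj_mem[OF i, of "f k"] adj_sub[OF i, of "f k"] by (cases "j = k") auto
qed simp

lemma gidb_least: "idl L \<Longrightarrow> J \<subseteq> L \<Longrightarrow> (\<And>i. i < k \<Longrightarrow> f i \<in> L) \<Longrightarrow> gidb J f k \<subseteq> L"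
proof (induction k)
  case (Suc k)
  then show ?case using adj_least[of L "gidb J f k" "f k"] by simp
qed simp

abbreviation gid :: "(nat \<Rightarrow> ('v, 'k) mpoly) \<Rightarrow> nat \<Rightarrow> ('v, 'k) mpoly set" where
  "gid \<equiv> gidb {0}"

lemmas gid_idl = gidb_idl[OF idl_zero_ideal] and gid_mem = gidb_mem[OF idl_zero_ideal]

lemma gid_hom: "(\<And>i. i < k \<Longrightarrow> f i \<in> A \<and> (\<exists>e. whom w e (f i))) \<Longrightarrow> hom w (gid f k)"
proof (induction k)
  case (Suc k)
  then obtain e where "f k \<in> A" "whom w e (f k)" by blast
  then show ?case using Suc by (auto intro: hom_adj)
qed (simp add: hom_zero)

lemma gid_sub: "(\<And>i. i < k \<Longrightarrow> f i \<in> A) \<Longrightarrow> gid f k \<subseteq> gid f (Suc k)"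
  using adj_sub[OF gid_idl[of k f]] by simp

lemma gid_least: "idl L \<Longrightarrow> (\<And>i. i < k \<Longrightarrow> f i \<in> L) \<Longrightarrow> gid f k \<subseteq> L"
  by (rule gidb_least) (auto simp: idl_zero)

text \<open>The ideal generated by the variables of \<open>V\<close> in \<open>W\<close>, described
  through monomials so that membership can be read off. It serves to show that the variables form a
  regular sequence.\<close>

definition vid :: "'v set \<Rightarrow> ('v, 'k) mpoly set" where
  "vid W = {p \<in> A. \<forall>m\<in>supp p. supp m \<inter> W \<noteq> {}}"

lemma vid_idl: "idl (vid W)"
proof (rule idlI)
  show "x + y \<in> vid W" if "x \<in> vid W" "y \<in> vid W" for x y
    using that Poly_Mapping.keys_add[of x y] by (auto simp: vid_def)
  show "a * x \<in> vid W" if "a \<in> A" "x \<in> vid W" for a x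
    unfolding vid_def
  proof (intro CollectI conjI ballI)
    show "a * x \<in> A" using that by (auto simp: vid_def)
    fix m assume "m \<in> supp (a * x)"
    then obtain k l where "m = k + l" "l \<in> supp x" using keys_mult[of a x] by blast
    then show "supp m \<inter> W \<noteq> {}" using that by (auto simp: vid_def keys_add_nat)
  qed
qed (auto simp: vid_def)

lemma vid_empty: "vid {} = {0}"
  by (auto simp: vid_def)

lemma vid_nzd:
  assumes "v \<notin> W"
  shows "nzd (vid W) (mvr v)"
  unfolding nzd_def
proof (intro ballI impI)
  fix u assume u: "u \<in> A" "mvr v * u \<in> vid W"
  have "supp m \<inter> W \<noteq> {}" if m: "m \<in> supp u" for m
  proof -
    have "Poly_Mapping.single v 1 + m \<in> supp (mvr v * u)"
      using m lookup_single_mult[of "Poly_Mapping.single v 1" 1 u m] by (simp add: mvr_def in_keys_iff)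
    then have "supp (Poly_Mapping.single v (1 :: nat) + m) \<inter> W \<noteq> {}" using u(2) by (auto simp: vid_def)
    then show ?thesis using assms by (auto simp: keys_add_nat)
  qed
  then show "u \<in> vid W" using u(1) by (simp add: vid_def)
qed

lemma vid_insert:
  assumes v: "v \<in> V"
  shows "adj (vid W) (mvr v) = vid (insert v W)"
proof
  have "mvr v \<in> vid (insert v W)" using v by (simp add: vid_def mvr_def)
  moreover have "vid W \<subseteq> vid (insert v W)" by (auto simp: vid_def)
  ultimately show "adj (vid W) (mvr v) \<subseteq> vid (insert v W)" by (intro adj_least vid_idl) auto
  note ia = adj_idl[OF vid_idl, of "mvr v" W]
  show "vid (insert v W) \<subseteq> adj (vid W) (mvr v)"
  proof
    fix p assume p: "p \<in> vid (insert v W)"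
    have "(\<Sum>m\<in>supp p. Poly_Mapping.single m (cf p m)) \<in> adj (vid W) (mvr v)"
    proof (rule idl_sum)
      show "idl (adj (vid W) (mvr v))" using ia v by simp
      fix m assume m: "m \<in> supp p"
      have mm: "m \<in> mons" using p m polys_mons[of p m] by (auto simp: vid_def)
      show "Poly_Mapping.single m (cf p m) \<in> adj (vid W) (mvr v)"
      proof (cases "v \<in> supp m")
        case True
        then show ?thesis using mon_mem_idl[OF _ adj_mem[OF vid_idl] mm] ia v by auto
      next
        case False
        then have "supp m \<inter> W \<noteq> {}" using p m by (auto simp: vid_def)
        then have "Poly_Mapping.single m (cf p m) \<in> vid W" using mm by (auto simp: vid_def mons_def)
        then show ?thesis using adj_sub[OF vid_idl] by blast
      qed
    qed
    then show "p \<in> adj (vid W) (mvr v)" using poly_as_sum[of p] by simp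
  qed
qed

lemma hdep_vid: "W \<subseteq> V \<Longrightarrow> card (V - W) = k \<Longrightarrow> hdep k (vid W)"
proof (induction k arbitrary: W)
  case (Suc k)
  then have "V - W \<noteq> {}" by auto
  then obtain v where v: "v \<in> V" "v \<notin> W" by blast
  have "V - insert v W = (V - W) - {v}" by blast
  then have "card (V - insert v W) = k" using Suc.prems v finite_V by (simp add: card_Diff_singleton)
  then have "hdep k (vid (insert v W))" using Suc v by blast
  then show ?case using vid_nzd[OF v(2)] v(1) vid_insert[OF v(1)]
    by (auto intro!: exI[of _ "mvr v"] exI[of _ "Suc 0"])
qed simp

lemma hdep_zero: "hdep (card V) {0}"
  using hdep_vid[of "{}"] by (simp add: vid_empty)

lemma pdim_zero_le: "pdim {0} \<le> card V"
  using pdim_le[OF idl_zero_ideal] by simp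

lemma pdim_mm: "pdim mm = 0"
proof -
  obtain U where U: "indep U mm" "card U = pdim mm" using pdim_indep[OF mm_idl prm_one[OF mm_prm]] .
  have "U = {}"
  proof (rule ccontr)
    assume "U \<noteq> {}"
    then obtain v where v: "v \<in> U" by blast
    then have "mvr v \<in> mm" using U(1) mvr_mm by (auto simp: indep_def)
    moreover have "mvr v \<in> polys U" using v by (simp add: mvr_def)
    ultimately have "mvr v = 0" by (rule indepD[OF U(1)])
    then show False by (simp add: mvr_def)
  qed
  then show ?thesis using U(2) by simp
qed

lemma pdim_gid_step:
  assumes f: "\<And>i. i < r \<Longrightarrow> f i \<in> A \<and> hdeg (e i) (f i) \<and> e i > 0"
  shows "i \<le> r \<Longrightarrow> pdim (gid f i) \<le> pdim (gid f r) + (r - i)"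
    and "i \<le> r \<Longrightarrow> hidl (gid f i) \<and> gid f i \<subseteq> mm"
proof -
  show hm: "hidl (gid f i) \<and> gid f i \<subseteq> mm" if "i \<le> r" for i
  proof
    have fi: "f j \<in> A \<and> hdeg (e j) (f j) \<and> e j > 0" if "j < i" for j using f[of j] that \<open>i \<le> r\<close> by simp
    then show "hidl (gid f i)" by (intro gid_hom) blast
    show "gid f i \<subseteq> mm" using fi hdeg_mm by (intro gid_least[OF mm_idl]) blast
  qed
  show "pdim (gid f i) \<le> pdim (gid f r) + (r - i)" if "i \<le> r"
    using that
  proof (induction "r - i" arbitrary: i)
    case (Suc d)
    then have i: "i < r" by simp
    have "1 \<notin> gid f i" using hm[of i] i prm_one[OF mm_prm] by auto
    then have "pdim (gid f i) \<le> Suc (pdim (gid f (Suc i)))"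
      using pdim_adj_hom[of "gid f i" "f i" "e i"] hm[of i] f[OF i] i by simp
    moreover have "pdim (gid f (Suc i)) \<le> pdim (gid f r) + (r - Suc i)"
      using Suc(2) i by (intro Suc(1)) auto
    ultimately show ?case using i by simp
  qed simp
qed

text \<open>If \<open>f i\<close> were a zero divisor modulo its predecessors, it would lie in an associated prime
  whose dimension is at least \<open>n - i\<close>, too much for the remaining forms to bring it down to
  \<open>n - r\<close>.\<close>

lemma regular_of_pdim:
  assumes f: "\<And>i. i < r \<Longrightarrow> f i \<in> A \<and> hdeg (e i) (f i) \<and> e i > 0"
    and star: "pdim (gid f r) + r \<le> card V"
  shows "i \<le> r \<Longrightarrow> hdep (card V - i) (gid f i)" and "i < r \<Longrightarrow> nzd (gid f i) (f i)"
proof -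
  note step = pdim_gid_step[of r f e, OF f]
  have nz: "nzd (gid f i) (f i)" if i: "i < r" and dep: "hdep (card V - i) (gid f i)" for i
  proof (rule ccontr)
    assume n: "\<not> nzd (gid f i) (f i)"
    have hi: "hidl (gid f i)" "gid f i \<subseteq> mm" using step(2)[of i] i by auto
    obtain P where P: "P \<in> Ass (gid f i)" "f i \<in> P"
      by (rule Ass_zero_divisor[OF hi(1) _ _ n]) (use f[OF i] in auto)
    obtain u where u: "u \<in> A" "P = colon (gid f i) u" "prm P" using P(1) by (auto simp: Ass_def)
    have "u \<notin> gid f i" using u(1,2) prm_one[OF u(3)] by (auto simp: colon_def)
    then have uloc: "u \<notin> loc (gid f i)" using loc_hidl[OF hi(1)] by simp
    have "P \<subseteq> mm" using hidl_mm[OF Ass_hom[OF hi(1) P(1)] prm_one[OF u(3)]] .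
    then have "card V - i \<le> pdim P"
      by (rule dep_le_pdim_assoc[OF hdep_dep[OF dep] hom_idl[OF hi(1)] u(3) _ u(1) uloc])
        (use loc_sub[OF hom_idl[OF hi(1)]] in \<open>auto simp: u(2) colon_def\<close>)
    also have "gid f (Suc i) \<subseteq> P"
      using colon_sub[OF hom_idl[OF hi(1)] u(1)] P(2) u(2) adj_least[OF prm_idl[OF u(3)]] by simp
    then have "pdim P \<le> pdim (gid f (Suc i))" by (rule pdim_mono[OF prm_idl[OF u(3)] prm_one[OF u(3)]])
    also have "\<dots> \<le> pdim (gid f r) + (r - Suc i)" using step(1)[of "Suc i"] i by simp
    finally show False using star i by simp
  qed
  have dep: "hdep (card V - i) (gid f i)" if "i \<le> r" for i
    using that
  proof (induction i)
    case 0
    then show ?case using hdep_zero by simp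
  next
    case (Suc i)
    then have i: "i < r" and d: "hdep (card V - i) (gid f i)" by auto
    have hi: "hidl (gid f i)" "1 \<notin> gid f i" using step(2)[of i] i prm_one[OF mm_prm] by auto
    \<comment> \<open>The inequality \<open>star\<close> forces \<open>r \<le> card V\<close>, so
      the subtraction on naturals is exact.\<close>
    have "card V - i = Suc (card V - Suc i)" using i star by simp
    then have "hdep (card V - Suc i) (adj (gid f i) (f i))"
      using hdep_adj[OF hi _ _ _ _ nz[OF i d], of "card V - Suc i" "e i"] d f[OF i] by simp
    then show ?case by simp
  qed
  show "i \<le> r \<Longrightarrow> hdep (card V - i) (gid f i)" by (rule dep)
  show "i < r \<Longrightarrow> nzd (gid f i) (f i)" using nz dep by simp
qed

section \<open>Chains of primes above and below a prime\<close>

lemma chain_pdim: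
  assumes "\<And>i. i \<le> n \<Longrightarrow> prm (P i)" "\<And>i. i < n \<Longrightarrow> P i \<subset> P (Suc i)"
  shows "n + pdim (P n) \<le> pdim (P 0)"
  using assms
proof (induction n)
  case (Suc n)
  have "pdim (P (Suc n)) < pdim (P n)" using Suc.prems by (intro pdim_strict) auto
  then show ?case using Suc.IH Suc.prems by simp
qed simp

text \<open>A graded prime of positive dimension misses some variable. Adjoining that variable costs
  at most one dimension, and a prime of full dimension over the result is strictly larger than
  \<open>P\<close>, so it has dimension exactly one less.\<close>

lemma chain_above:
  "prm P \<Longrightarrow> hidl P \<Longrightarrow> pdim P = d \<Longrightarrow>
    \<exists>Q. Q 0 = P \<and> (\<forall>i\<le>d. prm (Q i)) \<and> (\<forall>i<d. Q i \<subset> Q (Suc i))"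
proof (induction d arbitrary: P)
  case 0
  then show ?case by (intro exI[of _ "\<lambda>_. P"]) auto
next
  case (Suc d)
  have P: "1 \<notin> P" "P \<subseteq> mm" using prm_one[OF Suc.prems(1)] hidl_mm[OF Suc.prems(2)] by auto
  have "\<exists>v\<in>V. mvr v \<notin> P"
  proof (rule ccontr)
    assume "\<not> ?thesis"
    then have "mm \<subseteq> P" by (intro mm_least[OF prm_idl[OF Suc.prems(1)]]) auto
    then show False using P pdim_mm Suc.prems(3) by auto
  qed
  then obtain v where v: "v \<in> V" "mvr v \<notin> P" by blast
  define J where "J = adj P (mvr v)"
  have J: "hidl J" unfolding J_def using v by (intro hom_adj[OF Suc.prems(2), of _ "Suc 0"]) auto
  have J1: "1 \<notin> J" unfolding J_def using hom_adj_proper[OF Suc.prems(2) P(1) mvr_mm[OF v(1)]] .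
  have "pdim P \<le> Suc (pdim J)" unfolding J_def
    using v by (intro pdim_adj_hom[OF Suc.prems(2) P(1), of _ "Suc 0"]) auto
  moreover obtain Q where Q: "prm Q" "hidl Q" "J \<subseteq> Q" "pdim Q = pdim J" using prime_of_pdim[OF J J1] .
  have PQ: "P \<subset> Q" using Q(3) adj_sub[OF prm_idl[OF Suc.prems(1)]] adj_mem[OF prm_idl[OF Suc.prems(1)]] v(2)
    unfolding J_def by blast
  then have "pdim Q < pdim P" by (rule pdim_strict[OF Suc.prems(1) Q(1)])
  ultimately have "pdim Q = d" using Q(4) Suc.prems(3) by simp
  from Suc.IH[OF Q(1,2) this] obtain R where
    R: "R 0 = Q" "\<forall>i\<le>d. prm (R i)" "\<forall>i<d. R i \<subset> R (Suc i)" by blast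
  show ?case
  proof (intro exI[of _ "\<lambda>i. case i of 0 \<Rightarrow> P | Suc j \<Rightarrow> R j"] conjI allI impI)
    fix i
    show "prm (case i of 0 \<Rightarrow> P | Suc j \<Rightarrow> R j)" if "i \<le> Suc d"
      using that Suc.prems(1) R(2) by (cases i) auto
    show "(case i of 0 \<Rightarrow> P | Suc j \<Rightarrow> R j) \<subset> (case Suc i of 0 \<Rightarrow> P | Suc j \<Rightarrow> R j)" if "i < Suc d"
      using that R PQ by (cases i) auto
  qed simp
qed

text \<open>Built downwards from \<open>P\<close>: a minimal prime over all forms but the last,
  chosen inside \<open>P\<close>, misses the last form and is therefore strictly smaller.\<close>

lemma chain_below:
  assumes "prm P" "gid f r \<subseteq> P" "\<And>i. i < r \<Longrightarrow> f i \<in> A"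
    and "\<And>i Q. i < r \<Longrightarrow> minprime (gid f i) Q \<Longrightarrow> Q \<subseteq> P \<Longrightarrow> f i \<notin> Q"
  shows "\<exists>Q. Q r = P \<and> (\<forall>i\<le>r. prm (Q i)) \<and> (\<forall>i<r. Q i \<subset> Q (Suc i))"
  using assms
proof (induction r arbitrary: P)
  case 0
  then show ?case by (intro exI[of _ "\<lambda>_. P"]) auto
next
  case (Suc r)
  have fA: "\<And>i. i < r \<Longrightarrow> f i \<in> A" using Suc.prems(3) by simp
  have "gid f r \<subseteq> P" using gid_sub[of r f, OF fA] Suc.prems(2) by blast
  then obtain P' where P': "minprime (gid f r) P'" "P' \<subseteq> P" by (rule minprime_exists[OF Suc.prems(1)])
  have pP': "prm P'" "gid f r \<subseteq> P'" using P'(1) by (auto simp: minprime_def)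
  have "f r \<notin> P'" using Suc.prems(4)[of r P'] P' by simp
  moreover have "f r \<in> P" using gid_mem[of "Suc r" f r] Suc.prems(2,3) by blast
  ultimately have PP: "P' \<subset> P" using P'(2) by blast
  have "\<exists>Q. Q r = P' \<and> (\<forall>i\<le>r. prm (Q i)) \<and> (\<forall>i<r. Q i \<subset> Q (Suc i))"
  proof (rule Suc.IH[OF pP' fA])
    show "f i \<notin> Q" if "i < r" "minprime (gid f i) Q" "Q \<subseteq> P'" for i Q
      using Suc.prems(4)[of i Q] that P'(2) by auto
  qed
  then obtain Q where Q: "Q r = P'" "\<forall>i\<le>r. prm (Q i)" "\<forall>i<r. Q i \<subset> Q (Suc i)" by blast
  show ?case
  proof (intro exI[of _ "Q(Suc r := P)"] conjI allI impI)
    fix i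
    show "prm ((Q(Suc r := P)) i)" if "i \<le> Suc r" using that Q(2) Suc.prems(1) by (cases "i = Suc r") auto
    show "(Q(Suc r := P)) i \<subset> (Q(Suc r := P)) (Suc i)" if "i < Suc r"
      using that Q PP by (cases "i = r") auto
  qed simp
qed

text \<open>Evaluation at the point (1, ..., 1).\<close>

definition ev :: "('v, 'k) mpoly \<Rightarrow> 'k" where
  "ev p = (\<Sum>m\<in>supp p. cf p m)"

lemma ev_superset: "finite Z \<Longrightarrow> supp p \<subseteq> Z \<Longrightarrow> ev p = (\<Sum>m\<in>Z. cf p m)"
  unfolding ev_def by (rule sum.mono_neutral_left) (auto simp: in_keys_iff)

lemma ev_add: "ev (p + q) = ev p + ev q"
proof -
  let ?Z = "supp p \<union> supp q"
  have "ev x = (\<Sum>m\<in>?Z. cf x m)" if "x \<in> {p, q, p + q}" for x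
    using that Poly_Mapping.keys_add[of p q] by (intro ev_superset) auto
  then show ?thesis by (simp add: lookup_add sum.distrib)
qed

lemma ev_single [simp]: "ev (Poly_Mapping.single m c) = c"
  by (simp add: ev_def)

lemma ev_zero [simp]: "ev 0 = 0"
  by (simp add: ev_def)

lemma ev_sum: "ev (sum f Z) = (\<Sum>i\<in>Z. ev (f i))"
  by (induction Z rule: infinite_finite_induct) (auto simp: ev_add)

lemma ev_mult: "ev (p * q) = ev p * ev q"
proof -
  have "p * q = (\<Sum>m\<in>supp p. Poly_Mapping.single m (cf p m)) * (\<Sum>l\<in>supp q. Poly_Mapping.single l (cf q l))"
    using poly_as_sum[of p] poly_as_sum[of q] by simp
  then show ?thesis by (simp add: sum_product ev_sum mult_single) (simp add: ev_def sum_product)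
qed

lemma ev_prm: "prm {p \<in> A. ev p = 0}"
  unfolding prm_def by (intro conjI idlI) (auto simp: ev_add ev_mult simp flip: single_one)

text \<open>The minimal prime is chosen inside the kernel of \<open>ev\<close>, and every monomial
  takes the value 1.\<close>

lemma minprime_without_vars:
  assumes J: "J \<subseteq> A" "\<And>p. p \<in> J \<Longrightarrow> ev p = 0"
  obtains P where "minprime J P" "\<And>m. mon m \<notin> P"
proof -
  obtain P where "minprime J P" "P \<subseteq> {p \<in> A. ev p = 0}"
    by (rule minprime_exists[OF ev_prm, of J]) (use J in auto)
  moreover have "ev (mon m) \<noteq> 0" for m by simp
  ultimately show thesis using that by blast
qed

lemma pdim_regular:
  assumes g: "\<And>i. i < s \<Longrightarrow> g i \<in> A \<and> nzd (gid g i) (g i)" and one: "1 \<notin> gid g s"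
  shows "i \<le> s \<Longrightarrow> pdim (gid g i) + i \<le> card V"
proof (induction i)
  case 0
  then show ?case using pdim_zero_le by simp
next
  case (Suc i)
  have "gid g (Suc i) \<subseteq> gid g s"
    using Suc.prems g by (intro gid_least gid_idl gid_mem) auto
  then have "1 \<notin> adj (gid g i) (g i)" using one by auto
  then have "Suc (pdim (adj (gid g i) (g i))) \<le> pdim (gid g i)"
    using Suc.prems g by (intro pdim_adj_nzd gid_idl) auto
  then show ?case using Suc by simp
qed

text \<open>The degree-two parts of any generating system span the quadrics of the ideal.\<close>

lemma quadric_generators:
  assumes f: "\<And>i. i < r \<Longrightarrow> f i \<in> A \<and> hdeg 2 (f i)"
    and k: "\<And>i j. i < r \<Longrightarrow> j < r \<Longrightarrow> cf (f i) (k j) = (if i = j then 1 else 0)"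
    and g: "\<And>i. i < s \<Longrightarrow> g i \<in> A" and eq: "gid f r = gid g s"
  shows "r \<le> s"
proof -
  let ?c = "\<lambda>i. wcomp unit_wt i :: ('v, 'k) mpoly \<Rightarrow> _"
  define M where "M = {p \<in> A. ?c 0 p = 0 \<and> ?c 1 p = 0}"
  \<comment> \<open>Elements of \<open>M\<close> start in degree two, so of a multiplier only the
    constant term reaches the degree-two part. This makes \<open>T\<close> below an ideal.\<close>
  have c2: "?c 2 (a * q) = const (cf a 0) * ?c 2 q" if "q \<in> M" for a q
  proof -
    have "?c 0 a = const (cf a 0)"
      using hdeg_0[of "?c 0 a", OF whom_wcomp] by (simp add: lookup_restr)
    then show ?thesis using that by (simp add: wcomp_mult M_def numeral_2_eq_2)
  qed
  have iM: "idl M"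
  proof (rule idlI)
    show "a * x \<in> M" if "a \<in> A" "x \<in> M" for a x
      using that by (simp add: M_def wcomp_mult polys_mult del: deg_eq_0_iff)
  qed (auto simp: M_def restr_add)
  have fM: "f i \<in> M" if "i < r" for i
    using f[OF that] wcomp_whom[of unit_wt 2 "f i"] by (simp add: M_def del: deg_eq_0_iff)
  have fr: "gid f r \<subseteq> M" by (rule gid_least[OF iM fM])
  have gM: "g j \<in> M" if "j < s" for j
    using gid_mem[of s g j] that g fr eq by blast
  define G where "G = (\<lambda>j. ?c 2 (g j)) ` {..<s}"
  define T where "T = {p \<in> M. ?c 2 p \<in> mpv.span G}"
  have "idl T"
  proof (rule idlI)
    show "a * x \<in> T" if "a \<in> A" "x \<in> T" for a x
      using that idl_mult[OF iM, of a x] c2[of x a] mpv.span_scale[of "?c 2 x" G "cf a 0"]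
      by (simp add: T_def)
    show "x + y \<in> T" if "x \<in> T" "y \<in> T" for x y
      using that idl_add[OF iM, of x y] mpv.span_add[of "?c 2 x" G "?c 2 y"]
      by (simp add: T_def restr_add)
  qed (use idl_sub[OF iM] idl_zero[OF iM] mpv.span_zero in \<open>auto simp: T_def\<close>)
  then have "gid g s \<subseteq> T" by (rule gid_least) (use gM in \<open>auto simp: T_def G_def intro: mpv.span_base\<close>)
  then have fT: "f i \<in> T" if "i < r" for i
    using gid_mem[of r f i] that f eq by blast
  have fspan: "f i \<in> mpv.span G" if "i < r" for i
    using fT[OF that] f[OF that] wcomp_whom[of unit_wt 2 "f i" 2] by (simp add: T_def)
  have inj: "inj_on f {..<r}"
  proof (rule inj_onI)
    fix i j assume "i \<in> {..<r}" "j \<in> {..<r}" "f i = f j"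
    then show "i = j" using k[of i j] k[of j j] by (simp split: if_splits)
  qed
  have "mpv.independent (f ` {..<r})"
    unfolding mpv.independent_explicit_finite_subsets
  proof (intro allI impI ballI)
    fix Z u v assume Z: "Z \<subseteq> f ` {..<r}" "finite Z" "(\<Sum>v\<in>Z. const (u v) * v) = 0" "v \<in> Z"
    obtain j where j: "j < r" "v = f j" using Z by blast
    \<comment> \<open>The monomial \<open>k j\<close> occurs in no generator but \<open>f j\<close>,
      so its coefficient isolates \<open>u (f j)\<close>.\<close>
    have "cf (\<Sum>v\<in>Z. const (u v) * v) (k j) = (\<Sum>x\<in>Z. if x = f j then u (f j) else 0)"
      unfolding lookup_sum
    proof (rule sum.cong)
      fix x assume "x \<in> Z"
      then obtain i where i: "i < r" "x = f i" using Z(1) by blast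
      then have "x = f j \<longleftrightarrow> i = j" using inj j(1) by (auto simp: inj_on_def)
      then show "cf (const (u x) * x) (k j) = (if x = f j then u (f j) else 0)"
        using k[OF i(1) j(1)] i(2) by simp
    qed simp
    then show "u v = 0" using Z j by (simp add: sum.delta)
  qed
  moreover have "f ` {..<r} \<subseteq> mpv.span G" using fspan by auto
  moreover have finG: "finite G" by (simp add: G_def)
  ultimately have "card (f ` {..<r}) \<le> card G" using mpv.independent_span_bound by blast
  then have "r \<le> card G" by (simp add: card_image[OF inj])
  also have "\<dots> \<le> s" unfolding G_def using card_image_le[of "{..<s}"] by auto
  finally show ?thesis .
qed

section \<open>The quotient ring\<close>

abbreviation S :: "('v, 'k) mpoly ring" where "S \<equiv> mpoly_ring V"

lemma S_simps [simp]:
  "carrier S = A" "x \<otimes>\<^bsub>S\<^esub> y = x * y" "x \<oplus>\<^bsub>S\<^esub> y = x + y" "\<zero>\<^bsub>S\<^esub> = 0" "\<one>\<^bsub>S\<^esub> = 1"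
  by (simp_all add: mpoly_ring_def polys_def)

interpretation S: cring S
  by (rule cring_mpoly_ring)

lemma S_uminus: "x \<in> A \<Longrightarrow> \<ominus>\<^bsub>S\<^esub> x = - x"
  using S.minus_equality[of "- x" x] by (simp add: polys_uminus)

lemma S_minus: "x \<in> A \<Longrightarrow> y \<in> A \<Longrightarrow> x \<ominus>\<^bsub>S\<^esub> y = x - y"
  using S_uminus[of y] by (simp add: S.minus_eq)

lemma ideal_iff: "ideal J S \<longleftrightarrow> idl J"
proof
  assume "ideal J S"
  then interpret ideal J S .
  show "idl J" using a_subset zero_closed a_closed I_l_closed by (intro idlI) auto
next
  assume J: "idl J"
  show "ideal J S"
  proof (rule idealI)
    show "ring S" by (rule S.ring_axioms)
    show "subgroup J (add_monoid S)"
    proof (rule S.add.subgroupI)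
      show "\<ominus>\<^bsub>S\<^esub> a \<in> J" if "a \<in> J" for a
        using S_uminus[OF idl_sub[OF J that]] idl_uminus[OF J that] by simp
    qed (use J idl_add[OF J] in \<open>auto simp: idl_def\<close>)
  qed (use J in \<open>auto intro: idl_mult idl_mult_right\<close>)
qed

lemma primeideal_iff: "primeideal P S \<longleftrightarrow> prm P"
proof
  assume "primeideal P S"
  then interpret primeideal P S .
  have i: "idl P" using is_ideal ideal_iff by blast
  then show "prm P" using I_notcarr I_prime idl_one_iff[OF i] by (auto simp: prm_def)
next
  assume P: "prm P"
  show "primeideal P S"
    by (rule primeidealI)
      (use P ideal_iff[of P] S.is_cring prm_mult[OF P] prm_one[OF P] in \<open>auto simp: prm_idl\<close>)
qed

lemma genideal_idl: "Z \<subseteq> A \<Longrightarrow> idl (genideal S Z)"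
  using S.genideal_ideal[of Z] by (simp add: ideal_iff)

lemma genideal_eqI:
  assumes "idl L" "Z \<subseteq> L" "\<And>M. idl M \<Longrightarrow> Z \<subseteq> M \<Longrightarrow> L \<subseteq> M"
  shows "genideal S Z = L"
proof
  have ZA: "Z \<subseteq> A" using assms(1,2) idl_sub by blast
  show "genideal S Z \<subseteq> L" using S.genideal_minimal[of L Z] assms by (simp add: ideal_iff)
  show "L \<subseteq> genideal S Z" using assms(3)[OF genideal_idl[OF ZA]] S.genideal_self[of Z] ZA by simp
qed

lemma genideal_gid: "(\<And>i. i < k \<Longrightarrow> f i \<in> A) \<Longrightarrow> genideal S (f ` {..<k}) = gid f k"
  using gid_mem[of k f] by (intro genideal_eqI gid_idl gid_least) auto

lemma set_take_conv: "i \<le> length fs \<Longrightarrow> set (take i fs) = (!) fs ` {..<i}"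
  using nth_image[of i fs] by (simp add: lessThan_atLeast0)

lemma regular_sequence_iff:
  "regular_sequence S fs \<longleftrightarrow> (\<forall>i<length fs. fs ! i \<in> A \<and> nzd (gid ((!) fs) i) (fs ! i)) \<and>
     1 \<notin> gid ((!) fs) (length fs)"
proof (cases "set fs \<subseteq> A")
  case True
  then have fA: "fs ! i \<in> A" if "i < length fs" for i using that by auto
  have "genideal S (set (take i fs)) = gid ((!) fs) i" if "i \<le> length fs" for i
    using genideal_gid[of i "(!) fs"] fA that by (simp add: set_take_conv)
  moreover from this[of "length fs"] have "genideal S (set fs) = gid ((!) fs) (length fs)" by simp
  moreover have "idl (gid ((!) fs) (length fs))" using fA by (intro gid_idl) auto
  ultimately show ?thesis using True fA idl_one_iff by (auto simp: regular_sequence_def nzd_def)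
next
  case False
  then show ?thesis by (auto simp: regular_sequence_def set_conv_nth)
qed

lemma minimal_prime_iff: "minimal_prime S J P \<longleftrightarrow> minprime J P"
  by (simp add: minimal_prime_def minprime_def primeideal_iff)

lemma prime_chain_iff:
  "prime_chain S n P \<longleftrightarrow> (\<forall>i\<le>n. prm (P i)) \<and> (\<forall>i<n. P i \<subset> P (Suc i))"
  by (simp add: prime_chain_def primeideal_iff)

lemma prime_chain_pdim: "prime_chain S n P \<Longrightarrow> n + pdim (P n) \<le> pdim (P 0) \<and> pdim (P 0) \<le> card V"
  using chain_pdim[of n P] pdim_le[of "P 0"] by (simp add: prime_chain_iff prm_idl prm_one)

lemma prime_height_ge: "prime_chain S n P \<Longrightarrow> enat n \<le> prime_height S (P n)"
  unfolding prime_height_def by (rule Sup_upper) blast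

text \<open>Along a chain ending in \<open>P\<close> the dimension falls at every step, starting
  from at most \<open>card V\<close>.\<close>

lemma prime_height_le: "prime_height S P \<le> enat (card V - pdim P)"
  unfolding prime_height_def using prime_chain_pdim by (intro Sup_least) fastforce

section \<open>Transfer of ideals and primes to the quotient ring\<close>

definition proj :: "('v, 'k) mpoly set \<Rightarrow> ('v, 'k) mpoly \<Rightarrow> ('v, 'k) mpoly set" where
  "proj J p = J +>\<^bsub>S\<^esub> p"

lemma proj_eq_iff: "idl J \<Longrightarrow> p \<in> A \<Longrightarrow> q \<in> A \<Longrightarrow> proj J p = proj J q \<longleftrightarrow> p - q \<in> J"
  using S.quotient_eq_iff_same_a_r_cos[of J p q] by (simp add: ideal_iff S_minus proj_def)

lemma Quot_simps:
  assumes "idl J"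
  shows "carrier (S Quot J) = proj J ` A"
    and "p \<in> A \<Longrightarrow> q \<in> A \<Longrightarrow> proj J p \<oplus>\<^bsub>S Quot J\<^esub> proj J q = proj J (p + q)"
    and "p \<in> A \<Longrightarrow> q \<in> A \<Longrightarrow> proj J p \<otimes>\<^bsub>S Quot J\<^esub> proj J q = proj J (p * q)"
    and "cring (S Quot J)"
proof -
  interpret ideal J S using assms by (simp add: ideal_iff)
  show "carrier (S Quot J) = proj J ` A"
    by (auto simp: FactRing_def A_RCOSETS_def' proj_def)
  show "p \<in> A \<Longrightarrow> q \<in> A \<Longrightarrow> proj J p \<oplus>\<^bsub>S Quot J\<^esub> proj J q = proj J (p + q)"
    using a_rcos_sum[of p q] by (simp add: FactRing_def proj_def)
  show "p \<in> A \<Longrightarrow> q \<in> A \<Longrightarrow> proj J p \<otimes>\<^bsub>S Quot J\<^esub> proj J q = proj J (p * q)"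
    using rcoset_mult_add[of p q] by (simp add: FactRing_def proj_def)
  show "cring (S Quot J)" by (rule quotient_is_cring[OF S.is_cring])
qed

lemma ideal_proj: "idl J \<Longrightarrow> idl L \<Longrightarrow> ideal (proj J ` L) (S Quot J)"
  using S.ring_ideal_imp_quot_ideal[of J L] by (simp add: ideal_iff proj_def[abs_def])

lemma proj_mem_iff: "idl J \<Longrightarrow> idl L \<Longrightarrow> J \<subseteq> L \<Longrightarrow> p \<in> A \<Longrightarrow> proj J p \<in> proj J ` L \<longleftrightarrow> p \<in> L"
proof
  assume J: "idl J" "idl L" "J \<subseteq> L" "p \<in> A" and "proj J p \<in> proj J ` L"
  then obtain q where "q \<in> L" "proj J p = proj J q" by blast
  then show "p \<in> L" using J proj_eq_iff[of J p q] idl_sub idl_diff_cancel[of L p q] by blast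
qed blast

definition pull :: "('v, 'k) mpoly set \<Rightarrow> ('v, 'k) mpoly set set \<Rightarrow> ('v, 'k) mpoly set" where
  "pull J L = {p \<in> A. proj J p \<in> L}"

lemma ideal_hom: "idl J \<Longrightarrow> ring_hom_ring S (S Quot J) (proj J)"
  using ideal.rcos_ring_hom_ring[of J S] by (simp add: ideal_iff proj_def[abs_def])

lemma pull_ideal: "idl J \<Longrightarrow> ideal L (S Quot J) \<Longrightarrow> idl (pull J L)"
  using ring_hom_ring.ideal_vimage[OF ideal_hom] by (simp add: pull_def ideal_iff)

lemma pull_prime: "idl J \<Longrightarrow> primeideal L (S Quot J) \<Longrightarrow> prm (pull J L)"
  using ring_hom_ring.primeideal_vimage[OF ideal_hom S.is_cring] by (simp add: pull_def primeideal_iff)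

lemma pull_sup:
  assumes "idl J" "ideal L (S Quot J)"
  shows "J \<subseteq> pull J L"
proof
  fix p assume p: "p \<in> J"
  then have "proj J p = proj J 0" using assms(1) proj_eq_iff[of J p 0] idl_sub by simp
  also have "proj J 0 = \<zero>\<^bsub>S Quot J\<^esub>"
    using ring_hom_ring.axioms(1) S.a_rcos_zero[of J 0] assms(1) idl_zero[OF assms(1)]
    by (simp add: FactRing_def proj_def ideal_iff)
  finally show "p \<in> pull J L"
    using additive_subgroup.zero_closed[OF ideal.axioms(1)[OF assms(2)]] p idl_sub[OF assms(1)]
    by (simp add: pull_def)
qed

lemma proj_pull: "idl J \<Longrightarrow> L \<subseteq> carrier (S Quot J) \<Longrightarrow> proj J ` pull J L = L"
  by (auto simp: pull_def Quot_simps(1))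

lemma proj_prime:
  assumes J: "idl J" and P: "prm P" "J \<subseteq> P"
  shows "primeideal (proj J ` P) (S Quot J)"
proof (rule primeidealI)
  show "ideal (proj J ` P) (S Quot J)" by (rule ideal_proj[OF J prm_idl[OF P(1)]])
  show "cring (S Quot J)" by (rule Quot_simps(4)[OF J])
  have mem: "proj J p \<in> proj J ` P \<longleftrightarrow> p \<in> P" if "p \<in> A" for p
    by (rule proj_mem_iff[OF J prm_idl[OF P(1)] P(2) that])
  show "carrier (S Quot J) \<noteq> proj J ` P"
  proof
    assume "carrier (S Quot J) = proj J ` P"
    then have "proj J 1 \<in> proj J ` P" using Quot_simps(1)[OF J] by (metis imageI polys_one)
    then show False using mem[of 1] prm_one[OF P(1)] by simp
  qed
  fix a b assume "a \<in> carrier (S Quot J)" "b \<in> carrier (S Quot J)" "a \<otimes>\<^bsub>S Quot J\<^esub> b \<in> proj J ` P"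
  then obtain p q where pq: "p \<in> A" "q \<in> A" "a = proj J p" "b = proj J q" by (auto simp: Quot_simps(1)[OF J])
  then have "p * q \<in> P" using \<open>a \<otimes>\<^bsub>S Quot J\<^esub> b \<in> proj J ` P\<close> mem[of "p * q"]
    by (simp add: Quot_simps(3)[OF J] polys_mult)
  then show "a \<in> proj J ` P \<or> b \<in> proj J ` P" using prm_mult[OF P(1) pq(1,2)] pq by blast
qed

text \<open>Pulling a chain back to \<open>S\<close> bounds its length by the strict fall of
  \<open>pdim\<close>. Conversely, a graded prime over \<open>J\<close> of the same dimension starts
  a chain of that length, which is pushed down to the quotient.\<close>

lemma krull_dim_Quot:
  assumes J: "hidl J" "1 \<notin> J"
  shows "krull_dim (S Quot J) = enat (pdim J)"
proof (rule antisym)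
  note iJ = hom_idl[OF J(1)]
  show "krull_dim (S Quot J) \<le> enat (pdim J)" unfolding krull_dim_def
  proof (rule Sup_least)
    fix x assume "x \<in> {enat n |n. \<exists>P. prime_chain (S Quot J) n P}"
    then obtain n P where x: "x = enat n" and P: "prime_chain (S Quot J) n P" by blast
    have Pi: "primeideal (P i) (S Quot J)" "prm (pull J (P i))" "J \<subseteq> pull J (P i)" "proj J ` pull J (P i) = P i"
      if "i \<le> n" for i
    proof -
      show p: "primeideal (P i) (S Quot J)" using P that by (simp add: prime_chain_def)
      then have i: "ideal (P i) (S Quot J)" by (rule primeideal.axioms(1))
      show "prm (pull J (P i))" by (rule pull_prime[OF iJ p])
      show "J \<subseteq> pull J (P i)" by (rule pull_sup[OF iJ i])
      show "proj J ` pull J (P i) = P i"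
        by (rule proj_pull[OF iJ additive_subgroup.a_subset[OF ideal.axioms(1)[OF i]]])
    qed
    have "pull J (P i) \<subset> pull J (P (Suc i))" if "i < n" for i
    proof -
      have "P i \<subset> P (Suc i)" using P that by (simp add: prime_chain_def)
      then have "pull J (P i) \<subseteq> pull J (P (Suc i))" "P i \<noteq> P (Suc i)" by (auto simp: pull_def)
      moreover have "proj J ` pull J (P i) = P i" "proj J ` pull J (P (Suc i)) = P (Suc i)"
        using Pi(4) that by simp_all
      ultimately show ?thesis by (metis psubsetI)
    qed
    then have "n + pdim (pull J (P n)) \<le> pdim (pull J (P 0))"
      using Pi(2) by (intro chain_pdim[of n "\<lambda>i. pull J (P i)"]) auto
    also have "\<dots> \<le> pdim J" using Pi(2)[of 0] Pi(3)[of 0] prm_idl prm_one by (intro pdim_mono) auto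
    finally show "x \<le> enat (pdim J)" using x by simp
  qed
  obtain P where P: "prm P" "hidl P" "J \<subseteq> P" "pdim P = pdim J" by (rule prime_of_pdim[OF J])
  obtain Q where Q: "Q 0 = P" "\<forall>i\<le>pdim J. prm (Q i)" "\<forall>i<pdim J. Q i \<subset> Q (Suc i)"
    using chain_above[OF P(1,2,4)] by blast
  have JQ: "J \<subseteq> Q i" if "i \<le> pdim J" for i
    using that
  proof (induction i)
    case (Suc i)
    then have "J \<subseteq> Q i" "Q i \<subset> Q (Suc i)" using Q(3) by auto
    then show ?case by blast
  qed (use Q(1) P(3) in simp)
  have "prime_chain (S Quot J) (pdim J) (\<lambda>i. proj J ` Q i)"
    unfolding prime_chain_def
  proof (intro conjI allI impI)
    show "primeideal (proj J ` Q i) (S Quot J)" if "i \<le> pdim J" for i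
      using that Q JQ by (intro proj_prime[OF iJ]) auto
    fix i assume i: "i < pdim J"
    have sub: "Q i \<subset> Q (Suc i)" using Q i by blast
    then obtain q where q: "q \<in> Q (Suc i)" "q \<notin> Q i" by blast
    have iQ: "idl (Q i)" "idl (Q (Suc i))" using Q i prm_idl by auto
    have "proj J q \<notin> proj J ` Q i"
      using proj_mem_iff[OF iJ iQ(1) JQ idl_sub[OF iQ(2) q(1)]] q(2) i by simp
    then show "proj J ` Q i \<subset> proj J ` Q (Suc i)" using sub q(1) by blast
  qed
  then show "enat (pdim J) \<le> krull_dim (S Quot J)"
    unfolding krull_dim_def by (intro Sup_upper) blast
qed

section \<open>Regular sequences and depth of the quotient ring\<close>

lemma gidb_shift: "gidb J f (Suc k) = gidb (adj J (f 0)) (\<lambda>i. f (Suc i)) k"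
  by (induction k) auto

lemma dep_iff: "dep k J \<longleftrightarrow> (\<exists>f. \<forall>i<k. f i \<in> mm \<and> nzd (gidb J f i) (f i))"
proof (induction k arbitrary: J)
  case (Suc k)
  show ?case
  proof
    assume "dep (Suc k) J"
    then obtain h where h: "h \<in> mm" "nzd J h" "dep k (adj J h)" by auto
    then obtain f where f: "\<forall>i<k. f i \<in> mm \<and> nzd (gidb (adj J h) f i) (f i)" using Suc by blast
    let ?g = "\<lambda>i. case i of 0 \<Rightarrow> h | Suc j \<Rightarrow> f j"
    have "?g i \<in> mm \<and> nzd (gidb J ?g i) (?g i)" if "i < Suc k" for i
      using that h f gidb_shift[of J ?g] by (cases i) (auto simp del: gidb.simps(2))
    then show "\<exists>f. \<forall>i<Suc k. f i \<in> mm \<and> nzd (gidb J f i) (f i)" by blast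
  next
    assume "\<exists>f. \<forall>i<Suc k. f i \<in> mm \<and> nzd (gidb J f i) (f i)"
    then obtain f where f: "\<And>i. i < Suc k \<Longrightarrow> f i \<in> mm \<and> nzd (gidb J f i) (f i)" by blast
    have "\<forall>i<k. f (Suc i) \<in> mm \<and> nzd (gidb (adj J (f 0)) (\<lambda>i. f (Suc i)) i) (f (Suc i))"
      using f gidb_shift[of J f] by (metis Suc_less_eq)
    then have "dep k (adj J (f 0))" unfolding Suc by (rule exI[of _ "\<lambda>i. f (Suc i)"])
    then show "dep (Suc k) J" using f[of 0] by auto
  qed
qed simp

lemma genideal_Quot:
  assumes J: "idl J" and f: "\<And>i. i < k \<Longrightarrow> f i \<in> A"
  shows "genideal (S Quot J) ((\<lambda>i. proj J (f i)) ` {..<k}) = proj J ` gidb J f k"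
proof
  interpret Q: cring "S Quot J" by (rule Quot_simps(4)[OF J])
  have g: "idl (gidb J f k)" using J f by (rule gidb_idl)
  have sub: "(\<lambda>i. proj J (f i)) ` {..<k} \<subseteq> carrier (S Quot J)" using f by (auto simp: Quot_simps(1)[OF J])
  show "genideal (S Quot J) ((\<lambda>i. proj J (f i)) ` {..<k}) \<subseteq> proj J ` gidb J f k"
    using gidb_mem[OF J, of k f] f by (intro Q.genideal_minimal ideal_proj[OF J g]) auto
  let ?G = "genideal (S Quot J) ((\<lambda>i. proj J (f i)) ` {..<k})"
  have G: "ideal ?G (S Quot J)" by (rule Q.genideal_ideal[OF sub])
  have "gidb J f k \<subseteq> pull J ?G"
    using f Q.genideal_self[OF sub] by (intro gidb_least pull_ideal[OF J G] pull_sup[OF J G]) (auto simp: pull_def)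
  then show "proj J ` gidb J f k \<subseteq> ?G" by (auto simp: pull_def)
qed

lemma regular_sequence_Quot:
  assumes J: "idl J" and f: "\<And>i. i < k \<Longrightarrow> f i \<in> A"
  shows "regular_sequence (S Quot J) (map (\<lambda>i. proj J (f i)) [0..<k]) \<longleftrightarrow>
    (\<forall>i<k. nzd (gidb J f i) (f i)) \<and> 1 \<notin> gidb J f k"
proof -
  let ?fs = "map (\<lambda>i. proj J (f i)) [0..<k]"
  have g: "genideal (S Quot J) (set (take i ?fs)) = proj J ` gidb J f i" if "i \<le> k" for i
  proof -
    have "set (take i ?fs) = (\<lambda>i. proj J (f i)) ` {..<i}" using that
      by (simp add: take_map lessThan_atLeast0)
    then show ?thesis using genideal_Quot[OF J, of i f] f that by simp
  qed
  have i: "idl (gidb J f i)" "J \<subseteq> gidb J f i" if "i \<le> k" for i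
    using gidb_idl[OF J, of i f] gidb_mono[OF J, of i f] f that by auto
  have sub: "set ?fs \<subseteq> carrier (S Quot J)" using f by (auto simp: Quot_simps(1)[OF J])
  have "genideal (S Quot J) (set ?fs) = proj J ` gidb J f k" using g[of k] by simp
  moreover have "proj J ` gidb J f k = carrier (S Quot J) \<longleftrightarrow> 1 \<in> gidb J f k"
  proof
    assume "proj J ` gidb J f k = carrier (S Quot J)"
    then have "proj J 1 \<in> proj J ` gidb J f k" using Quot_simps(1)[OF J] by (metis imageI polys_one)
    then show "1 \<in> gidb J f k" using proj_mem_iff[OF J i, of k 1] by simp
  next
    assume "1 \<in> gidb J f k"
    then show "proj J ` gidb J f k = carrier (S Quot J)"
      using idl_one_iff[OF i(1)[of k]] Quot_simps(1)[OF J] by simp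
  qed
  moreover have "(\<forall>r\<in>carrier (S Quot J). ?fs ! j \<otimes>\<^bsub>S Quot J\<^esub> r \<in> genideal (S Quot J) (set (take j ?fs)) \<longrightarrow>
      r \<in> genideal (S Quot J) (set (take j ?fs))) \<longleftrightarrow> nzd (gidb J f j) (f j)" if j: "j < k" for j
  proof -
    have mem: "proj J p \<in> proj J ` gidb J f j \<longleftrightarrow> p \<in> gidb J f j" if "p \<in> A" for p
      using proj_mem_iff[OF J i that] j by simp
    have "genideal (S Quot J) (set (take j ?fs)) = proj J ` gidb J f j" using g[of j] j by simp
    then show ?thesis using j f[OF j] mem
      by (auto simp: Quot_simps(1,3)[OF J] nzd_def polys_mult)
  qed
  ultimately show ?thesis unfolding regular_sequence_def using sub by simp
qed

lemma irrelevant_eq: "irrelevant_ideal V J = proj J ` mm"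
  by (auto simp: irrelevant_ideal_def proj_def mm_def)

text \<open>Sequences are lifted to representatives in \<open>mm\<close>. Properness is automatic,
  because \<open>J\<close> and all representatives stay inside \<open>mm\<close>.\<close>

lemma depth_Quot:
  assumes J: "idl J" "J \<subseteq> mm"
  shows "{enat (length fs) |fs. regular_sequence (S Quot J) fs \<and> set fs \<subseteq> irrelevant_ideal V J} = {enat k |k. dep k J}"
proof (intro equalityI subsetI)
  fix x assume "x \<in> {enat (length fs) |fs. regular_sequence (S Quot J) fs \<and> set fs \<subseteq> irrelevant_ideal V J}"
  then obtain fs where fs: "x = enat (length fs)" "regular_sequence (S Quot J) fs" "set fs \<subseteq> proj J ` mm"
    by (auto simp: irrelevant_eq)
  have "\<exists>p. p \<in> mm \<and> fs ! i = proj J p" if "i < length fs" for i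
    using fs(3) nth_mem[OF that] by blast
  then have "\<exists>f. \<forall>i<length fs. f i \<in> mm \<and> fs ! i = proj J (f i)" by metis
  then obtain f where f: "\<And>i. i < length fs \<Longrightarrow> f i \<in> mm \<and> fs ! i = proj J (f i)" by blast
  have "fs = map (\<lambda>i. proj J (f i)) [0..<length fs]" using f by (intro nth_equalityI) auto
  then have "\<forall>i<length fs. nzd (gidb J f i) (f i)"
    using regular_sequence_Quot[OF J(1), of "length fs" f] f fs(2) mm_A by auto
  then have "dep (length fs) J" unfolding dep_iff using f by blast
  then show "x \<in> {enat k |k. dep k J}" using fs(1) by blast
next
  fix x assume "x \<in> {enat k |k. dep k J}"
  then obtain k f where x: "x = enat k" and f: "\<forall>i<k. f i \<in> mm \<and> nzd (gidb J f i) (f i)"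
    by (auto simp: dep_iff)
  have "gidb J f k \<subseteq> mm" using f by (intro gidb_least mm_idl J(2)) auto
  then have "1 \<notin> gidb J f k" using prm_one[OF mm_prm] by blast
  then have "regular_sequence (S Quot J) (map (\<lambda>i. proj J (f i)) [0..<k])"
    using regular_sequence_Quot[OF J(1), of k f] f mm_A by auto
  moreover have "set (map (\<lambda>i. proj J (f i)) [0..<k]) \<subseteq> irrelevant_ideal V J"
    using f by (auto simp: irrelevant_eq)
  ultimately show "x \<in> {enat (length fs) |fs. regular_sequence (S Quot J) fs \<and> set fs \<subseteq> irrelevant_ideal V J}"
    using x by (intro CollectI exI[of _ "map (\<lambda>i. proj J (f i)) [0..<k]"]) auto
qed

text \<open>Depth never exceeds dimension, so equality means that a regular sequence of length
  \<open>pdim J\<close> exists.\<close>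

lemma cohen_macaulay_iff:
  assumes J: "hidl J" "1 \<notin> J"
  shows "cohen_macaulay V J \<longleftrightarrow> dep (pdim J) J"
proof -
  note iJ = hom_idl[OF J(1)] and Jm = hidl_mm[OF J]
  have "depth (S Quot J) (irrelevant_ideal V J) = Sup {enat k |k. dep k J}"
    unfolding depth_def depth_Quot[OF iJ Jm] ..
  moreover have "Sup {enat k |k. dep k J} = enat (pdim J) \<longleftrightarrow> pdim J = 0 \<or> enat (pdim J) \<in> {enat k |k. dep k J}"
    using dep_le_pdim[OF iJ Jm] by (intro Sup_enat_eq_iff) auto
  moreover have "\<dots> \<longleftrightarrow> dep (pdim J) J" by auto
  ultimately show ?thesis unfolding cohen_macaulay_def krull_dim_Quot[OF J] by simp
qed

section \<open>Free resolutions by mapping cones\<close>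

text \<open>Coordinates of the differential without extensionality of the vectors, which enters only
  when the complex is matched with \<open>graded_free_resolution\<close>.\<close>

abbreviation appl :: "('v, 'k) mpoly free_complex \<Rightarrow> nat \<Rightarrow> (nat \<Rightarrow> ('v, 'k) mpoly) \<Rightarrow> nat \<Rightarrow> ('v, 'k) mpoly" where
  "appl F i v j \<equiv> \<Sum>k<rk F (Suc i). diff F i j k * v k"

text \<open>The rank one step to the right, \<open>F\<^sub>-\<^sub>1\<close> being zero.\<close>

definition rkp :: "('v, 'k) mpoly free_complex \<Rightarrow> nat \<Rightarrow> nat" where
  "rkp F i = (case i of 0 \<Rightarrow> 0 | Suc j \<Rightarrow> rk F j)"

lemma rkp_simps [simp]: "rkp F 0 = 0" "rkp F (Suc i) = rk F i"
  by (simp_all add: rkp_def)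

text \<open>A resolution of \<open>S/J\<close> of length \<open>r\<close> ending in \<open>S(-E)\<close>. The second set equation says that the
  image of the last map of the dual complex is again \<open>J\<close>.\<close>

definition cires :: "('v, 'k) mpoly free_complex \<Rightarrow> ('v, 'k) mpoly set \<Rightarrow> nat \<Rightarrow> nat \<Rightarrow> bool" where
  "cires F J r E \<longleftrightarrow>
     (\<forall>i. \<forall>j<rk F i. \<forall>k<rk F (Suc i). diff F i j k \<in> A \<and> homogeneous (gdeg F (Suc i) k - gdeg F i j) (diff F i j k)) \<and>
     rk F 0 = 1 \<and> gdeg F 0 0 = 0 \<and> rk F r = 1 \<and> gdeg F r 0 = int E \<and> (\<forall>i>r. rk F i = 0) \<and>
     {appl F 0 v 0 | v. \<forall>k<rk F 1. v k \<in> A} = J \<and>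
     {(\<Sum>j<rkp F r. diff F (r - 1) j 0 * u j) | u. \<forall>j<rkp F r. u j \<in> A} = J \<and>
     (\<forall>i v. \<forall>j<rk F i. appl F i (appl F (Suc i) v) j = 0) \<and>
     (\<forall>i v. (\<forall>k<rk F (Suc i). v k \<in> A) \<and> (\<forall>j<rk F i. appl F i v j = 0) \<longrightarrow>
        (\<exists>w. (\<forall>l<rk F (Suc (Suc i)). w l \<in> A) \<and> (\<forall>k<rk F (Suc i). v k = appl F (Suc i) w k)))"

lemma ciresD:
  assumes "cires F J r E"
  shows "j < rk F i \<Longrightarrow> k < rk F (Suc i) \<Longrightarrow> diff F i j k \<in> A"
    and "j < rk F i \<Longrightarrow> k < rk F (Suc i) \<Longrightarrow> homogeneous (gdeg F (Suc i) k - gdeg F i j) (diff F i j k)"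
    and "rk F 0 = 1" "gdeg F 0 0 = 0" "rk F r = 1" "gdeg F r 0 = int E" "i > r \<Longrightarrow> rk F i = 0"
    and "{appl F 0 v 0 | v. \<forall>k<rk F 1. v k \<in> A} = J"
    and "{(\<Sum>j<rkp F r. diff F (r - 1) j 0 * u j) | u. \<forall>j<rkp F r. u j \<in> A} = J"
    and "j < rk F i \<Longrightarrow> appl F i (appl F (Suc i) v) j = 0"
    and "(\<And>k. k < rk F (Suc i) \<Longrightarrow> v k \<in> A) \<Longrightarrow> (\<And>j. j < rk F i \<Longrightarrow> appl F i v j = 0) \<Longrightarrow>
        \<exists>w. (\<forall>l<rk F (Suc (Suc i)). w l \<in> A) \<and> (\<forall>k<rk F (Suc i). v k = appl F (Suc i) w k)"
proof -
  note d = assms[unfolded cires_def]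
  show "(\<And>k. k < rk F (Suc i) \<Longrightarrow> v k \<in> A) \<Longrightarrow> (\<And>j. j < rk F i \<Longrightarrow> appl F i v j = 0) \<Longrightarrow>
        \<exists>w. (\<forall>l<rk F (Suc (Suc i)). w l \<in> A) \<and> (\<forall>k<rk F (Suc i). v k = appl F (Suc i) w k)"
    using d[THEN conjunct2, THEN conjunct2, THEN conjunct2, THEN conjunct2, THEN conjunct2, THEN conjunct2,
      THEN conjunct2, THEN conjunct2, THEN conjunct2, rule_format, of i v] by blast
qed (use assms in \<open>simp_all add: cires_def\<close>)

lemma homogeneous_zero [simp]: "homogeneous d 0"
  by (simp add: homogeneous_def)

lemma homogeneous_uminus [simp]: "homogeneous d (- p) = homogeneous d p"
  by (simp add: homogeneous_def)

lemma hdeg_homogeneous: "hdeg e p \<Longrightarrow> homogeneous (int e) p"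
  by (simp add: homogeneous_def whom_def monom_deg_eq)

lemma cires_zero: "\<exists>F. cires F {0} 0 0"
proof -
  define F :: "('v, 'k) mpoly free_complex" where
    "F = \<lparr>rk = (\<lambda>i. if i = 0 then 1 else 0), gdeg = (\<lambda>_ _. 0), diff = (\<lambda>_ _ _. 0)\<rparr>"
  have "cires F {0} 0 0" by (auto simp: cires_def F_def)
  then show ?thesis ..
qed

text \<open>The mapping cone of multiplication by \<open>f\<close> on \<open>F\<close>.\<close>

definition cone :: "('v, 'k) mpoly free_complex \<Rightarrow> ('v, 'k) mpoly \<Rightarrow> nat \<Rightarrow> ('v, 'k) mpoly free_complex" where
  "cone F f e =
     \<lparr>rk = (\<lambda>i. rk F i + rkp F i),
      gdeg = (\<lambda>i j. if j < rk F i then gdeg F i j else gdeg F (i - 1) (j - rk F i) + int e),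
      diff = (\<lambda>i j k.
        if j < rk F i then
          if k < rk F (Suc i) then diff F i j k else if j = k - rk F (Suc i) then f else 0
        else if k < rk F (Suc i) then 0 else - diff F (i - 1) (j - rk F i) (k - rk F (Suc i)))\<rparr>"

lemma cone_rk: "rk (cone F f e) i = rk F i + rkp F i"
  by (simp add: cone_def)

text \<open>In step \<open>i\<close> of the cone, indices below \<open>rk F i\<close> belong to the
  old module and the others to the preceding one, shifted by \<open>e\<close>. Here the two blocks
  meet through \<open>f\<close>; in the other block the differential changes its sign.\<close>

lemma appl_cone_left:
  assumes "j < rk F i"
  shows "appl (cone F f e) i v j = appl F i v j + f * v (rk F (Suc i) + j)"
proof -
  have "(\<Sum>k<rk F i. (if j = k then f else 0) * v (rk F (Suc i) + k))
      = (\<Sum>k<rk F i. if j = k then f * v (rk F (Suc i) + j) else 0)"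
    by (rule sum.cong) auto
  also have "\<dots> = f * v (rk F (Suc i) + j)" using assms by simp
  finally show ?thesis using assms by (simp add: cone_def sum_lessThan_add)
qed

lemma appl_cone_right:
  "appl (cone F f e) (Suc i) v (rk F (Suc i) + j) = - appl F i (\<lambda>k. v (rk F (Suc (Suc i)) + k)) j"
  by (simp add: cone_def sum_lessThan_add sum_negf)

text \<open>A cycle of the cone is a pair of a vector \<open>v\<close> and a cycle \<open>w\<close>
  with \<open>d v + f * w = 0\<close>; exactness of \<open>F\<close> is used once for each part. The
  last map of the cone is the column consisting of \<open>f\<close> and the negated last column of
  \<open>F\<close>, so its transpose has image \<open>J + (f)\<close>, which preserves the
  self-duality clause.\<close>

lemma cires_cone:
  assumes F: "cires F J r E" and f: "f \<in> A" "hdeg e f" "nzd J f"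
  shows "cires (cone F f e) (adj J f) (Suc r) (E + e)"
proof -
  note FD = ciresD[OF F]
  let ?G = "cone F f e"
  have entries: "diff ?G i j k \<in> A \<and> homogeneous (gdeg ?G (Suc i) k - gdeg ?G i j) (diff ?G i j k)"
    if jk: "j < rk ?G i" "k < rk ?G (Suc i)" for i j k
  proof (cases "j < rk F i")
    case True
    show ?thesis
    proof (cases "k < rk F (Suc i)")
      case False
      then show ?thesis using True f hdeg_homogeneous[OF f(2)] by (auto simp: cone_def)
    qed (use True FD(1,2) in \<open>simp add: cone_def\<close>)
  next
    case False
    then obtain i' where i: "i = Suc i'" using jk(1) by (cases i) (auto simp: cone_rk)
    then have j: "j - rk F i < rk F i'" using False jk(1) by (simp add: cone_def)
    show ?thesis
    proof (cases "k < rk F (Suc i)")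
      case k: False
      then have k': "k - rk F (Suc i) < rk F i" using jk(2) by (simp add: cone_def)
      show ?thesis
        using False k FD(1,2)[OF j, of "k - rk F (Suc i)"] k' i by (simp add: cone_def polys_uminus)
    qed (use False in \<open>simp add: cone_def\<close>)
  qed
  have top: "rk F (Suc r) = 0" "\<And>i. r < i \<Longrightarrow> rk F i = 0" using FD(7) by auto
  have H0: "{appl ?G 0 v 0 | v. \<forall>k<rk ?G 1. v k \<in> A} = adj J f"
  proof (intro equalityI subsetI)
    fix p assume "p \<in> {appl ?G 0 v 0 | v. \<forall>k<rk ?G 1. v k \<in> A}"
    then obtain v where v: "\<forall>k<rk F 1 + 1. v k \<in> A" "p = appl F 0 v 0 + f * v (rk F 1)"
      using appl_cone_left[of 0 F 0] FD(3) by (auto simp: cone_rk)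
    have "appl F 0 v 0 \<in> J" unfolding FD(8)[symmetric] using v(1) by auto
    then show "p \<in> adj J f" using v by (auto simp: adj_def)
  next
    fix p assume "p \<in> adj J f"
    then obtain x q where x: "x \<in> J" "q \<in> A" "p = x + f * q" by (auto simp: adj_def)
    then obtain v where v: "x = appl F 0 v 0" "\<forall>k<rk F 1. v k \<in> A" unfolding FD(8)[symmetric] by blast
    let ?w = "\<lambda>k. if k < rk F 1 then v k else q"
    have "appl F 0 ?w 0 = x" using v by simp
    then have "p = appl ?G 0 ?w 0" using appl_cone_left[of 0 F 0 f e ?w] FD(3) x(3) by simp
    moreover have "\<forall>k<rk ?G 1. ?w k \<in> A" using v x by simp
    ultimately show "p \<in> {appl ?G 0 v 0 | v. \<forall>k<rk ?G 1. v k \<in> A}"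
      by (intro CollectI exI[of _ ?w] conjI)
  qed
  have dual: "{(\<Sum>j<rkp ?G (Suc r). diff ?G (Suc r - 1) j 0 * u j) | u. \<forall>j<rkp ?G (Suc r). u j \<in> A} = adj J f"
  proof -
    have sum: "(\<Sum>j<rkp ?G (Suc r). diff ?G (Suc r - 1) j 0 * u j)
        = - (\<Sum>j<rkp F r. diff F (r - 1) j 0 * u (Suc j)) + f * u 0" for u
    proof -
      have "(\<Sum>j<rkp ?G (Suc r). diff ?G r j 0 * u j) = (\<Sum>j<1 + rkp F r. diff ?G r j 0 * u j)"
        using FD(5) by (simp add: cone_rk)
      also have "\<dots> = (\<Sum>j<1. diff ?G r j 0 * u j) + (\<Sum>j<rkp F r. diff ?G r (1 + j) 0 * u (1 + j))"
        by (rule sum_lessThan_add)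
      also have "\<dots> = - (\<Sum>j<rkp F r. diff F (r - 1) j 0 * u (Suc j)) + f * u 0"
        using FD(5) top(1) by (simp add: cone_def sum_negf)
      finally show ?thesis by simp
    qed
    have rk: "rkp ?G (Suc r) = Suc (rkp F r)" using FD(5) by (simp add: cone_rk)
    show ?thesis
    proof (intro equalityI subsetI)
      fix p assume "p \<in> {(\<Sum>j<rkp ?G (Suc r). diff ?G (Suc r - 1) j 0 * u j) | u. \<forall>j<rkp ?G (Suc r). u j \<in> A}"
      then have "\<exists>u. p = - (\<Sum>j<rkp F r. diff F (r - 1) j 0 * u (Suc j)) + f * u 0 \<and> (\<forall>j<Suc (rkp F r). u j \<in> A)"
        unfolding sum unfolding rk by (rule CollectD)
      then obtain u where u: "p = - (\<Sum>j<rkp F r. diff F (r - 1) j 0 * u (Suc j)) + f * u 0"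
        "\<forall>j<Suc (rkp F r). u j \<in> A" by (elim exE conjE)
      have "(\<Sum>j<rkp F r. diff F (r - 1) j 0 * - u (Suc j)) \<in> J"
        unfolding FD(9)[symmetric] using u(2)
        by (intro CollectI exI[of _ "\<lambda>j. - u (Suc j)"]) (simp add: polys_uminus)
      then show "p \<in> adj J f" unfolding adj_def using u
        by (intro CollectI exI[of _ "- (\<Sum>j<rkp F r. diff F (r - 1) j 0 * u (Suc j))"] exI[of _ "u 0"])
          (simp add: sum_negf)
    next
      fix p assume "p \<in> adj J f"
      then obtain x q where x: "x \<in> J" "q \<in> A" "p = x + f * q" by (auto simp: adj_def)
      then obtain u where u: "x = (\<Sum>j<rkp F r. diff F (r - 1) j 0 * u j)" "\<forall>j<rkp F r. u j \<in> A"
        unfolding FD(9)[symmetric] by blast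
      let ?w = "\<lambda>j. case j of 0 \<Rightarrow> q | Suc j \<Rightarrow> - u j"
      have "p = (\<Sum>j<rkp ?G (Suc r). diff ?G (Suc r - 1) j 0 * ?w j)"
        unfolding sum using x(3) u(1) by (simp add: sum_negf)
      moreover have "\<forall>j<rkp ?G (Suc r). ?w j \<in> A"
        unfolding rk using x(2) u(2) by (auto split: nat.split)
      ultimately show "p \<in> {(\<Sum>j<rkp ?G (Suc r). diff ?G (Suc r - 1) j 0 * u j) | u. \<forall>j<rkp ?G (Suc r). u j \<in> A}"
        by blast
    qed
  qed
  have appl_add: "appl F i (\<lambda>k. v k + f * w k) j = appl F i v j + f * appl F i w j" for i v w j
    by (simp add: distrib_left sum.distrib sum_distrib_left mult.left_commute)
  have appl_neg: "appl F i (\<lambda>k. - w k) j = - appl F i w j" for i w j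
    by (simp add: sum_negf)
  have comp: "appl ?G i (appl ?G (Suc i) v) j = 0" if j: "j < rk ?G i" for i v j
  proof -
    let ?u = "\<lambda>k. v (rk F (Suc (Suc i)) + k)"
    have L: "appl ?G (Suc i) v k = appl F (Suc i) v k + f * ?u k" if "k < rk F (Suc i)" for k
      using appl_cone_left[OF that] by simp
    have R: "appl ?G (Suc i) v (rk F (Suc i) + k) = - appl F i ?u k" for k
      by (rule appl_cone_right)
    show ?thesis
    proof (cases "j < rk F i")
      case True
      have "appl F i (appl ?G (Suc i) v) j = appl F i (\<lambda>k. appl F (Suc i) v k + f * ?u k) j"
        by (rule sum.cong) (simp_all add: L)
      also have "\<dots> = f * appl F i ?u j" using FD(10)[OF True, of v] by (simp only: appl_add) simp
      finally show ?thesis unfolding appl_cone_left[OF True] R by simp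
    next
      case False
      then obtain i' where i: "i = Suc i'" using j by (cases i) (auto simp: cone_rk)
      define j' where "j' = j - rk F i"
      have j': "j = rk F (Suc i') + j'" "j' < rk F i'" using False j i by (auto simp: j'_def cone_rk)
      have "appl ?G i (appl ?G (Suc i) v) j = - appl F i' (\<lambda>k. appl ?G (Suc i) v (rk F (Suc i) + k)) j'"
        unfolding i j'(1) by (rule appl_cone_right)
      also have "\<dots> = appl F i' (appl F i ?u) j'" by (simp only: R appl_neg) simp
      also have "\<dots> = 0" using FD(10)[OF j'(2), of ?u] i by simp
      finally show ?thesis .
    qed
  qed
  have exact: "\<exists>w. (\<forall>l<rk ?G (Suc (Suc i)). w l \<in> A) \<and> (\<forall>k<rk ?G (Suc i). v k = appl ?G (Suc i) w k)"
    if v: "\<And>k. k < rk ?G (Suc i) \<Longrightarrow> v k \<in> A" and ker: "\<And>j. j < rk ?G i \<Longrightarrow> appl ?G i v j = 0" for i v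
  proof -
    let ?a = "rk F (Suc i)"
    let ?w = "\<lambda>k. v (?a + k)"
    have vA: "v k \<in> A" if "k < ?a" for k using v that by (simp add: cone_rk)
    have wA: "?w k \<in> A" if "k < rk F i" for k using v that by (simp add: cone_rk)
    have 1: "appl F i v j + f * ?w j = 0" if "j < rk F i" for j
      using ker[of j] appl_cone_left[OF that, of f e v] that by (simp add: cone_rk)
    have "\<exists>x. (\<forall>k<?a. x k \<in> A) \<and> (\<forall>j<rk F i. ?w j = appl F i x j)"
    proof (cases i)
      case 0
      \<comment> \<open>At the bottom no cycle condition on \<open>w\<close> is available. Instead
        \<open>f * w\<close> lies in \<open>J\<close>, and regularity of \<open>f\<close> puts
        \<open>w\<close> into \<open>J\<close>, the image of the first differential.\<close>
      have "f * ?w 0 = appl F 0 (\<lambda>k. - v k) 0" using 1[of 0] FD(3) 0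
        by (simp add: sum_negf eq_neg_iff_add_eq_0 add.commute)
      also have "\<dots> \<in> J" unfolding FD(8)[symmetric] using vA 0 by (auto intro!: exI[of _ "\<lambda>k. - v k"])
      finally have "?w 0 \<in> J" using f(3) wA[of 0] FD(3) 0 by (simp add: nzd_def)
      then obtain x where "?w 0 = appl F 0 x 0" "\<forall>k<rk F 1. x k \<in> A" unfolding FD(8)[symmetric] by blast
      then show ?thesis using 0 FD(3) by (intro exI[of _ x]) auto
    next
      case (Suc i')
      have "appl F i' ?w j = 0" if "j < rk F i'" for j
        using ker[of "rk F i + j"] appl_cone_right[where F = F and f = f and e = e and i = i' and v = v and j = j] that Suc by (simp add: cone_rk)
      then show ?thesis using FD(11)[where i = i' and v = ?w] wA Suc by auto
    qed
    then obtain x where x: "\<And>k. k < ?a \<Longrightarrow> x k \<in> A" "\<And>j. j < rk F i \<Longrightarrow> ?w j = appl F i x j" by blast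
    have "appl F i (\<lambda>k. v k + f * x k) j = 0" if "j < rk F i" for j
      using 1[OF that] x(2)[OF that] by (simp only: appl_add)
    then obtain y where y: "\<And>l. l < rk F (Suc (Suc i)) \<Longrightarrow> y l \<in> A"
      "\<And>k. k < ?a \<Longrightarrow> v k + f * x k = appl F (Suc i) y k"
      using FD(11)[where i = i and v = "\<lambda>k. v k + f * x k"] vA x(1) f(1) by (auto simp: polys_add polys_mult)
    let ?b = "rk F (Suc (Suc i))"
    \<comment> \<open>The preimage is the pair \<open>(y, - x)\<close>: the term
      \<open>f * x\<close> cancels in the first block, and the sign of the cone differential turns
      \<open>- x\<close> into \<open>w\<close>.\<close>
    define z where "z l = (if l < ?b then y l else - x (l - ?b))" for l
    have "z l \<in> A" if "l < rk ?G (Suc (Suc i))" for l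
      using that y(1) x(1) by (auto simp: z_def cone_rk polys_uminus)
    moreover have "v k = appl ?G (Suc i) z k" if k: "k < rk ?G (Suc i)" for k
    proof (cases "k < ?a")
      case True
      have "appl F (Suc i) z k = appl F (Suc i) y k" by (rule sum.cong) (auto simp: z_def)
      then have "appl ?G (Suc i) z k = v k + f * x k + f * z (?b + k)"
        unfolding appl_cone_left[OF True] using y(2)[OF True] by simp
      also have "z (?b + k) = - x k" by (simp add: z_def)
      finally show ?thesis by simp
    next
      case False
      define k' where "k' = k - ?a"
      have k': "k = ?a + k'" "k' < rk F i" using False k by (auto simp: k'_def cone_rk)
      have "appl ?G (Suc i) z k = - appl F i (\<lambda>l. - x l) k'"
        unfolding k'(1) appl_cone_right by (simp add: z_def)
      also have "\<dots> = v k" using x(2)[OF k'(2)] k'(1) by (simp add: sum_negf)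
      finally show ?thesis by simp
    qed
    ultimately show ?thesis by blast
  qed
  show ?thesis unfolding cires_def
  proof (intro conjI)
    show "rk ?G 0 = 1" "gdeg ?G 0 0 = 0" using FD(3,4) by (simp_all add: cone_def)
    show "rk ?G (Suc r) = 1" "gdeg ?G (Suc r) 0 = int (E + e)" "\<forall>i>Suc r. rk ?G i = 0"
      using FD(5,6) top by (auto simp: cone_def rkp_def split: nat.split)
    show "\<forall>i. \<forall>j<rk ?G i. \<forall>k<rk ?G (Suc i).
        diff ?G i j k \<in> A \<and> homogeneous (gdeg ?G (Suc i) k - gdeg ?G i j) (diff ?G i j k)"
      by (intro allI impI) (rule entries)
    show "\<forall>i v. \<forall>j<rk ?G i. appl ?G i (appl ?G (Suc i) v) j = 0"
      by (intro allI impI) (rule comp)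
    show "\<forall>i v. (\<forall>k<rk ?G (Suc i). v k \<in> A) \<and> (\<forall>j<rk ?G i. appl ?G i v j = 0) \<longrightarrow>
        (\<exists>w. (\<forall>l<rk ?G (Suc (Suc i)). w l \<in> A) \<and> (\<forall>k<rk ?G (Suc i). v k = appl ?G (Suc i) w k))"
      by (intro allI impI, elim conjE, rule exact) (erule allE, erule (1) mp)+
  qed (rule H0 dual)+
qed

text \<open>The iterated cone is the Koszul complex, whose top generator has the sum of all
  degrees.\<close>

lemma cires_gid:
  assumes "\<And>i. i < r \<Longrightarrow> f i \<in> A \<and> hdeg (e i) (f i) \<and> nzd (gid f i) (f i)"
  shows "\<exists>F. cires F (gid f r) r (\<Sum>i<r. e i)"
  using assms
proof (induction r)
  case 0
  then show ?case using cires_zero by simp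
next
  case (Suc r)
  then obtain F where "cires F (gid f r) r (\<Sum>i<r. e i)" by auto
  then have "cires (cone F (f r) (e r)) (gid f (Suc r)) (Suc r) (\<Sum>i<Suc r. e i)"
    using cires_cone[of F "gid f r" r "\<Sum>i<r. e i" "f r" "e r"] Suc.prems[of r] by simp
  then show ?case by blast
qed

section \<open>The resolution and its top cohomology as modules\<close>

lemma free_module_simps [simp]:
  "carrier (free_module V b) = {..<b} \<rightarrow>\<^sub>E A"
  "\<zero>\<^bsub>free_module V b\<^esub> = (\<lambda>j\<in>{..<b}. 0 :: ('v, 'k) mpoly)"
  "u \<oplus>\<^bsub>free_module V b\<^esub> v = (\<lambda>j\<in>{..<b}. u j + v j)"
  "p \<odot>\<^bsub>free_module V b\<^esub> u = (\<lambda>j\<in>{..<b}. p * u j)"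
  for u v :: "nat \<Rightarrow> ('v, 'k) mpoly" and p :: "('v, 'k) mpoly"
  by (simp_all add: free_module_def)

lemma cires_resolution:
  assumes F: "cires F J r E"
  shows "graded_free_resolution V J F"
proof -
  note FD = ciresD[OF F]
  have applA: "appl F i v j \<in> A" if "j < rk F i" "\<And>k. k < rk F (Suc i) \<Longrightarrow> v k \<in> A" for i v j
    using FD(1)[OF that(1)] that(2) by (intro polys_sum polys_mult) auto
  have dif: "differential F i v = (\<lambda>j\<in>{..<rk F i}. appl F i v j)" for i v
    by (simp add: differential_def mat_apply_def)
  have 0: "differential F 0 ` ({..<rk F (Suc 0)} \<rightarrow>\<^sub>E A) = {v \<in> {..<1} \<rightarrow>\<^sub>E A. v 0 \<in> J}"
  proof (intro equalityI subsetI)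
    fix x assume "x \<in> differential F 0 ` ({..<rk F (Suc 0)} \<rightarrow>\<^sub>E A)"
    then obtain v where v: "v \<in> {..<rk F (Suc 0)} \<rightarrow>\<^sub>E A" "x = (\<lambda>j\<in>{..<1}. appl F 0 v j)"
      using FD(3) by (auto simp: dif)
    have vA: "\<forall>k<rk F 1. v k \<in> A" using v(1) by auto
    then have "appl F 0 v 0 \<in> J" unfolding FD(8)[symmetric] by auto
    moreover have "appl F 0 v 0 \<in> A" using applA[of 0 0 v] vA FD(3) by simp
    ultimately show "x \<in> {v \<in> {..<1} \<rightarrow>\<^sub>E A. v 0 \<in> J}" using v(2) by auto
  next
    fix x :: "nat \<Rightarrow> ('v, 'k) mpoly" assume x: "x \<in> {v \<in> {..<1} \<rightarrow>\<^sub>E A. v 0 \<in> J}"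
    then have "x 0 \<in> {appl F 0 v 0 | v. \<forall>k<rk F 1. v k \<in> A}" by (simp only: FD(8) mem_Collect_eq)
    then obtain v where v: "x 0 = appl F 0 v 0" "\<forall>k<rk F 1. v k \<in> A" by blast
    let ?v = "restrict v {..<rk F (Suc 0)}"
    have "x = differential F 0 ?v"
    proof
      fix j
      have "appl F 0 ?v 0 = appl F 0 v 0" by (rule sum.cong) auto
      moreover have "x j = undefined" if "j \<noteq> 0" using x that PiE_arb[of x "{..<1}" "\<lambda>_. A" j] by simp
      ultimately show "x j = differential F 0 ?v j"
        using v(1) FD(3) by (cases "j = 0") (simp_all add: dif)
    qed
    moreover have "?v \<in> {..<rk F (Suc 0)} \<rightarrow>\<^sub>E A" using v(2) by auto
    ultimately show "x \<in> differential F 0 ` ({..<rk F (Suc 0)} \<rightarrow>\<^sub>E A)" by blast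
  qed
  have S: "differential F (Suc i) ` ({..<rk F (Suc (Suc i))} \<rightarrow>\<^sub>E A) =
      {v \<in> {..<rk F (Suc i)} \<rightarrow>\<^sub>E A. differential F i v = (\<lambda>j\<in>{..<rk F i}. 0)}" for i
  proof (intro equalityI subsetI)
    fix x assume "x \<in> differential F (Suc i) ` ({..<rk F (Suc (Suc i))} \<rightarrow>\<^sub>E A)"
    then obtain w where w: "w \<in> {..<rk F (Suc (Suc i))} \<rightarrow>\<^sub>E A" "x = (\<lambda>j\<in>{..<rk F (Suc i)}. appl F (Suc i) w j)"
      by (auto simp: dif)
    have "appl F i x j = appl F i (appl F (Suc i) w) j" for j
      by (rule sum.cong) (auto simp: w(2))
    then have "differential F i x = (\<lambda>j\<in>{..<rk F i}. 0)"
      using FD(10) by (simp add: dif restrict_eq_iff)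
    moreover have "x \<in> {..<rk F (Suc i)} \<rightarrow>\<^sub>E A" using w applA[of _ "Suc i" w] by auto
    ultimately show "x \<in> {v \<in> {..<rk F (Suc i)} \<rightarrow>\<^sub>E A. differential F i v = (\<lambda>j\<in>{..<rk F i}. 0)}" by blast
  next
    fix x assume x: "x \<in> {v \<in> {..<rk F (Suc i)} \<rightarrow>\<^sub>E A. differential F i v = (\<lambda>j\<in>{..<rk F i}. 0)}"
    then have "\<And>k. k < rk F (Suc i) \<Longrightarrow> x k \<in> A" "\<And>j. j < rk F i \<Longrightarrow> appl F i x j = 0"
      by (auto simp: dif restrict_eq_iff)
    then obtain w where w: "\<forall>l<rk F (Suc (Suc i)). w l \<in> A" "\<forall>k<rk F (Suc i). x k = appl F (Suc i) w k"
      using FD(11)[where i = i and v = x] by blast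
    let ?w = "restrict w {..<rk F (Suc (Suc i))}"
    have "x = differential F (Suc i) ?w"
    proof
      fix j
      have "appl F (Suc i) ?w j = appl F (Suc i) w j" by (rule sum.cong) auto
      moreover have "x j = undefined" if "\<not> j < rk F (Suc i)"
        using x that PiE_arb[of x "{..<rk F (Suc i)}" "\<lambda>_. A" j] by simp
      ultimately show "x j = differential F (Suc i) ?w j"
        using w(2) by (cases "j < rk F (Suc i)") (simp_all add: dif)
    qed
    moreover have "?w \<in> {..<rk F (Suc (Suc i))} \<rightarrow>\<^sub>E A" using w(1) by auto
    ultimately show "x \<in> differential F (Suc i) ` ({..<rk F (Suc (Suc i))} \<rightarrow>\<^sub>E A)" by blast
  qed
  show ?thesis unfolding graded_free_resolution_def using FD(1-4) 0 S by simp
qed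

text \<open>A polynomial as an element of the free module of rank one, whose elements are functions
  on one index.\<close>

definition vec :: "('v, 'k) mpoly \<Rightarrow> nat \<Rightarrow> ('v, 'k) mpoly" where
  "vec p = (\<lambda>j\<in>{..<Suc 0}. p)"

lemma vec_0 [simp]: "vec p 0 = p"
  by (simp add: vec_def)

lemma inj_vec: "inj vec"
  by (rule injI) (metis vec_0)

lemma vec_carrier: "{..<Suc 0} \<rightarrow>\<^sub>E Z = vec ` Z"
proof (intro equalityI subsetI)
  fix u assume u: "u \<in> {..<Suc 0} \<rightarrow>\<^sub>E Z"
  have "u j = vec (u 0) j" for j
    using PiE_arb[OF u, of j] by (cases "j = 0") (simp_all add: vec_def)
  then have "u = vec (u 0)" by (rule ext)
  moreover have "u 0 \<in> Z" using u by auto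
  ultimately show "u \<in> vec ` Z" by blast
qed (auto simp: vec_def split: if_splits)

lemma vec_ops:
  "vec p \<oplus>\<^bsub>free_module V (Suc 0)\<^esub> vec q = vec (p + q)"
  "s \<odot>\<^bsub>free_module V (Suc 0)\<^esub> vec p = vec (s * p)"
  by (auto simp: vec_def restrict_eq_iff)

lemma proj_set: "proj J p = (\<lambda>j. j + p) ` J"
  by (auto simp: proj_def a_r_coset_def')

lemma vec_coset: "vec ` J +>\<^bsub>free_module V (Suc 0)\<^esub> vec p = vec ` proj J p"
  by (auto simp: a_r_coset_def' vec_ops proj_set simp del: free_module_simps)

text \<open>In the last step every element is a cocycle, and the coboundaries are \<open>J\<close>
  by the self-duality clause of \<open>cires\<close>. The cohomology is thus \<open>S/J\<close>,
  with the class of 1 in degree \<open>card V - E\<close>.\<close>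

lemma cires_canonical:
  assumes F: "cires F J r E" and J: "idl J"
  shows "carrier (ext_module V F r) = (\<lambda>c. vec ` c) ` carrier (S Quot J)"
    and "p \<in> A \<Longrightarrow> q \<in> A \<Longrightarrow> vec ` proj J p \<oplus>\<^bsub>ext_module V F r\<^esub> vec ` proj J q = vec ` proj J (p + q)"
    and "s \<in> A \<Longrightarrow> p \<in> A \<Longrightarrow> s \<odot>\<^bsub>ext_module V F r\<^esub> vec ` proj J p = vec ` proj J (s * p)"
    and "ext_component V F (card V) r t = (\<lambda>c. vec ` c) ` quot_component V J (int E - int (card V) + t)"
proof -
  note FD = ciresD[OF F]
  have cocyc: "ext_cocycles V F r = vec ` A"
  proof -
    have "codifferential F r u = \<zero>\<^bsub>free_module V (rk F (Suc r))\<^esub>" for u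
      using FD(7)[of "Suc r"] by (simp add: codifferential_def mat_apply_def restrict_eq_iff)
    then show ?thesis using FD(5) by (simp add: ext_cocycles_def vec_carrier)
  qed
  have cobound: "ext_coboundaries V F r = vec ` J"
  proof (cases r)
    case 0
    \<comment> \<open>A resolution of length 0 has no preceding map, so the dual image is an empty
      sum, which forces \<open>J\<close> to be zero.\<close>
    have "J = {0}" using FD(9) 0 by auto
    then show ?thesis using 0 FD(3) by (auto simp: ext_coboundaries_def vec_def)
  next
    case (Suc i)
    have "ext_coboundaries V F r = {vec (\<Sum>j<rk F i. diff F i j 0 * u j) | u. u \<in> {..<rk F i} \<rightarrow>\<^sub>E A}"
    proof -
      have "codifferential F i u = vec (\<Sum>j<rk F i. diff F i j 0 * u j)" for u
        using FD(5) Suc by (simp add: codifferential_def mat_apply_def vec_def restrict_eq_iff)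
      then show ?thesis using Suc by (auto simp: ext_coboundaries_def)
    qed
    also have "\<dots> = vec ` {(\<Sum>j<rk F i. diff F i j 0 * u j) | u. \<forall>j<rk F i. u j \<in> A}"
    proof (intro equalityI subsetI)
      fix x assume "x \<in> vec ` {(\<Sum>j<rk F i. diff F i j 0 * u j) | u. \<forall>j<rk F i. u j \<in> A}"
      then obtain u where u: "x = vec (\<Sum>j<rk F i. diff F i j 0 * u j)" "\<forall>j<rk F i. u j \<in> A" by blast
      have "(\<Sum>j<rk F i. diff F i j 0 * u j) = (\<Sum>j<rk F i. diff F i j 0 * restrict u {..<rk F i} j)"
        by (rule sum.cong) auto
      moreover have "restrict u {..<rk F i} \<in> {..<rk F i} \<rightarrow>\<^sub>E A" using u(2) by auto
      ultimately show "x \<in> {vec (\<Sum>j<rk F i. diff F i j 0 * u j) | u. u \<in> {..<rk F i} \<rightarrow>\<^sub>E A}"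
        unfolding u(1) by (intro CollectI exI[of _ "restrict u {..<rk F i}"] conjI) simp_all
    qed auto
    also have "\<dots> = vec ` J" using FD(9) Suc by simp
    finally show ?thesis .
  qed
  let ?M = "free_module V (Suc 0) :: (('v, 'k) mpoly, nat \<Rightarrow> ('v, 'k) mpoly) module"
  have M: "(free_module V (rk F r))\<lparr>carrier := ext_cocycles V F r\<rparr> = ?M"
    using FD(5) by (simp add: cocyc vec_carrier[symmetric] free_module_def mpoly_ring_def polys_def)
  have ext: "ext_module V F r = quot_module ?M (vec ` J)"
    by (simp add: ext_module_def M cobound)
  show "carrier (ext_module V F r) = (\<lambda>c. vec ` c) ` carrier (S Quot J)"
    unfolding ext quot_module_def Quot_simps(1)[OF J]
    by (auto simp: A_RCOSETS_def' vec_carrier vec_coset)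
  show "vec ` proj J p \<oplus>\<^bsub>ext_module V F r\<^esub> vec ` proj J q = vec ` proj J (p + q)" if "p \<in> A" "q \<in> A"
  proof -
    have "proj J (p + q) = (\<Union>x\<in>proj J p. \<Union>y\<in>proj J q. {x + y})"
      using Quot_simps(2)[OF J that] by (auto simp: FactRing_def set_add_def')
    then show ?thesis
      by (auto simp: ext quot_module_def set_add_def' vec_ops simp del: free_module_simps)
  qed
  show "s \<odot>\<^bsub>ext_module V F r\<^esub> vec ` proj J p = vec ` proj J (s * p)" if s: "s \<in> A" "p \<in> A"
  proof -
    have "proj J (s * x) = proj J (s * p)" if x: "x \<in> proj J p" for x
    proof -
      obtain j where j: "j \<in> J" "x = j + p" using x by (auto simp: proj_set)
      have "s * x - s * p \<in> J" using idl_mult[OF J s(1) j(1)] by (simp add: j(2) algebra_simps)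
      then show ?thesis using s j idl_sub[OF J j(1)] by (subst proj_eq_iff[OF J]) auto
    qed
    then have "(\<Union>x\<in>proj J p. vec ` proj J (s * x)) = (\<Union>x\<in>proj J p. vec ` proj J (s * p))"
      by (rule SUP_cong[OF refl arg_cong])
    also have "\<dots> = vec ` proj J (s * p)"
    proof -
      have "proj J p \<noteq> {}" using idl_zero[OF J] by (auto simp: proj_set)
      then show ?thesis by simp
    qed
    finally show ?thesis
      by (simp add: ext quot_module_def vec_ops vec_coset del: free_module_simps)
  qed
  show "ext_component V F (card V) r t = (\<lambda>c. vec ` c) ` quot_component V J (int E - int (card V) + t)"
  proof -
    have "ext_component V F (card V) r t =
      {vec ` J +>\<^bsub>?M\<^esub> vec p | p. p \<in> A \<and> homogeneous (t - (int (card V) - int E)) p}"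
      unfolding ext_component_def cocyc cobound using FD(5,6) by (auto simp del: free_module_simps)
    also have "t - (int (card V) - int E) = int E - int (card V) + t" by simp
    finally show ?thesis by (auto simp: vec_coset quot_component_def proj_def)
  qed
qed

text \<open>The assumption on dimensions makes the length \<open>r\<close> of the resolution the
  codimension, so the last cohomology is the canonical module. The shift \<open>E - card V\<close>
  is the a-invariant.\<close>

lemma gorenstein_level_of_cires:
  assumes F: "cires F J r E" and J: "hidl J" "1 \<notin> J" and dim: "r + pdim J = card V" and cm: "cohen_macaulay V J"
  shows "gorenstein V J" and "level V J"
proof -
  note iJ = hom_idl[OF J(1)]
  note can = cires_canonical[OF F iJ]
  let ?\<omega> = "ext_module V F r" and ?g = "ext_component V F (card V) r"
  have canon: "canonical_module V J ?\<omega> ?g"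
    unfolding canonical_module_def
    by (intro exI[of _ F] exI[of _ r]) (use cires_resolution[OF F] krull_dim_Quot[OF J] dim in simp)
  have bij: "bij_betw (\<lambda>c. vec ` c) (carrier (S Quot J)) (carrier ?\<omega>)"
    unfolding can(1) by (intro bij_betw_imageI inj_onI) (simp_all add: inj_image_eq_iff[OF inj_vec])
  show "gorenstein V J" unfolding gorenstein_def Let_def
  proof (intro conjI cm exI[of _ ?\<omega>] exI[of _ ?g] exI[of _ "int E - int (card V)"] exI[of _ "\<lambda>c. vec ` c"] canon bij ballI allI)
    fix x y assume "x \<in> carrier (S Quot J)" "y \<in> carrier (S Quot J)"
    then obtain p q where "p \<in> A" "q \<in> A" "x = proj J p" "y = proj J q" by (auto simp: Quot_simps(1)[OF iJ])
    then show "vec ` (x \<oplus>\<^bsub>S Quot J\<^esub> y) = vec ` x \<oplus>\<^bsub>?\<omega>\<^esub> vec ` y"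
      by (simp add: Quot_simps(2)[OF iJ] can(2))
  next
    fix s x assume s: "s \<in> carrier S" and "x \<in> carrier (S Quot J)"
    then obtain p where "p \<in> A" "x = proj J p" by (auto simp: Quot_simps(1)[OF iJ])
    then show "vec ` ((J +>\<^bsub>S\<^esub> s) \<otimes>\<^bsub>S Quot J\<^esub> x) = s \<odot>\<^bsub>?\<omega>\<^esub> vec ` x"
      using s by (simp add: Quot_simps(3)[OF iJ] can(3) proj_def[symmetric])
  next
    fix t
    show "(\<lambda>c. vec ` c) ` quot_component V J (int E - int (card V) + t) = ?g t" by (rule can(4)[symmetric])
  qed
  show "level V J" unfolding level_def
  \<comment> \<open>The chosen degree is that of the class of 1, which generates the whole
    module.\<close>
  proof (intro conjI cm exI[of _ ?\<omega>] exI[of _ ?g] exI[of _ "int (card V) - int E"] canon allI impI)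
    fix N assume N: "submodule N S ?\<omega> \<and> ?g (int (card V) - int E) \<subseteq> N"
    have "proj J 1 \<in> quot_component V J 0"
      unfolding quot_component_def proj_def by (intro CollectI exI[of _ 1]) (simp add: homogeneous_def monom_deg_eq)
    then have one: "vec ` proj J 1 \<in> N" using N unfolding can(4) by auto
    have "vec ` proj J p \<in> N" if "p \<in> A" for p
    proof -
      have "p \<odot>\<^bsub>?\<omega>\<^esub> vec ` proj J 1 \<in> N"
        using submodule.smult_closed[of N S ?\<omega> p] N one that by simp
      then show ?thesis using can(3)[OF that, of 1] by simp
    qed
    then have "carrier ?\<omega> \<subseteq> N" unfolding can(1) Quot_simps(1)[OF iJ] by auto
    moreover have "N \<subseteq> carrier ?\<omega>"
      using N subgroup.subset[OF submodule.axioms(1), of N S ?\<omega>] by simp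
    ultimately show "N = carrier ?\<omega>" by blast
  qed
qed

section \<open>Ideals of quadrics\<close>

lemma prime_height_gid:
  assumes "prm P" "gid f r \<subseteq> P" "\<And>i. i < r \<Longrightarrow> f i \<in> A"
    and "\<And>i Q. i < r \<Longrightarrow> minprime (gid f i) Q \<Longrightarrow> Q \<subseteq> P \<Longrightarrow> f i \<notin> Q"
  shows "enat r \<le> prime_height S P"
proof -
  obtain Q where "Q r = P" "prime_chain S r Q" using chain_below[OF assms] prime_chain_iff by blast
  then show ?thesis using prime_height_ge[of r Q] by simp
qed

text \<open>The weight \<open>w i\<close> makes all earlier forms homogeneous, hence also the minimal primes of the
  ideal that they generate; those primes therefore do not contain \<open>f i\<close>.\<close>

theorem quadrics_equivalences:
  assumes f: "\<And>i. i < r \<Longrightarrow> f i \<in> A \<and> hdeg 2 (f i)"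
    and key: "\<And>i j. i < r \<Longrightarrow> j < r \<Longrightarrow> cf (f i) (k j) = (if i = j then 1 else 0)"
    and ev: "\<And>i. i < r \<Longrightarrow> ev (f i) = 0"
    and w: "\<And>i j. j < i \<Longrightarrow> i < r \<Longrightarrow> \<exists>e. whom (w i) e (f j)"
    and lead: "\<And>i. i < r \<Longrightarrow> \<exists>d m. wcomp (w i) d (f i) = mon m"
    and I: "I = gid f r"
  shows "(complete_intersection S I \<longleftrightarrow> gorenstein V I) \<and> (gorenstein V I \<longleftrightarrow> level V I) \<and>
    (level V I \<longleftrightarrow> cohen_macaulay V I) \<and> (cohen_macaulay V I \<longleftrightarrow> unmixed S I) \<and>
    (unmixed S I \<longrightarrow> height S I = enat r)"
proof -
  have fA: "f i \<in> A" if "i < r" for i using f that by blast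
  have f2: "f i \<in> A \<and> hdeg 2 (f i) \<and> (0 :: nat) < 2" if "i < r" for i using f that by simp
  have I_hom: "hidl I" and Im: "I \<subseteq> mm" using pdim_gid_step(2)[of r f "\<lambda>_. 2" r, OF f2] I by auto
  note iI = hom_idl[OF I_hom]
  have I1: "1 \<notin> I" using Im prm_one[OF mm_prm] by blast
  have min_mm: "P \<subseteq> mm" if "minprime I P" for P
    using hidl_mm[OF minprime_hom[OF I_hom that]] that prm_one by (auto simp: minprime_def)
  define star where "star \<longleftrightarrow> pdim I + r \<le> card V"

  obtain P0 where P0: "minprime I P0" "\<And>m. mon m \<notin> P0"
  proof (rule minprime_without_vars[of I])
    have "idl {p \<in> A. ev p = 0}" by (rule prm_idl[OF ev_prm])
    then have "I \<subseteq> {p \<in> A. ev p = 0}" unfolding I using fA ev by (intro gid_least) auto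
    then show "I \<subseteq> A" "\<And>p. p \<in> I \<Longrightarrow> ev p = 0" by auto
  qed blast
  have ht0: "enat r \<le> prime_height S P0"
  proof (rule prime_height_gid)
    show "prm P0" "gid f r \<subseteq> P0" using P0(1) I by (auto simp: minprime_def)
    fix i Q assume i: "i < r" and Q: "minprime (gid f i) Q" "Q \<subseteq> P0"
    have "hom (w i) (gid f i)" using w[of _ i] i fA by (intro gid_hom) auto
    then have hQ: "hom (w i) Q" using minprime_hom Q(1) by blast
    obtain d m where dm: "wcomp (w i) d (f i) = mon m" using lead[OF i] by blast
    \<comment> \<open>A prime homogeneous for \<open>w i\<close> that contains \<open>f i\<close>
      also contains its component \<open>mon m\<close>, whereas \<open>P0\<close> contains no
      monomial.\<close>
    show "f i \<notin> Q"
    proof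
      assume "f i \<in> Q"
      then have "mon m \<in> Q" using hom_comp[OF hQ, of "f i" d] dm by simp
      then show False using Q(2) P0(2) by blast
    qed
  qed (rule fA)
  have pdim_of_ht: "pdim P + r \<le> card V" if "prm P" "enat r \<le> prime_height S P" for P
  proof -
    have "enat r \<le> enat (card V - pdim P)" using that(2) prime_height_le by (rule order_trans)
    moreover have "pdim P \<le> card V" using pdim_le prm_idl prm_one that(1) by blast
    ultimately show ?thesis by simp
  qed

  have unmixed_star: star if "unmixed S I"
  proof -
    \<comment> \<open>A minimal prime below a prime of full dimension has at least the dimension of
      \<open>I\<close>, so a lower bound for its height bounds \<open>pdim I\<close>.\<close>
    obtain Q where Q: "prm Q" "hidl Q" "I \<subseteq> Q" "pdim Q = pdim I" by (rule prime_of_pdim[OF I_hom I1])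
    obtain P where P: "minprime I P" "P \<subseteq> Q" by (rule minprime_exists[OF Q(1,3)])
    have pP: "prm P" using P(1) by (simp add: minprime_def)
    have "prime_height S P = prime_height S P0"
      using that[unfolded unmixed_def minimal_prime_iff] P(1) P0(1) by blast
    then have "pdim P + r \<le> card V" using pdim_of_ht[OF pP] ht0 by simp
    moreover have "pdim Q \<le> pdim P" using pdim_mono[OF prm_idl[OF Q(1)] prm_one[OF Q(1)] P(2)] .
    ultimately show star using Q(4) by (simp add: star_def)
  qed

  have cm_star: star if "cohen_macaulay V I"
  proof -
    have "dep (pdim I) I" using that cohen_macaulay_iff[OF I_hom I1] by simp
    then have "pdim I \<le> pdim P0" by (rule dep_le_pdim_minprime[OF iI _ P0(1) min_mm[OF P0(1)]])
    moreover have "pdim P0 + r \<le> card V" using P0(1) ht0 by (intro pdim_of_ht) (simp add: minprime_def)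
    ultimately show star by (simp add: star_def)
  qed

  have ci_star: star if ci: "complete_intersection S I"
  proof -
    obtain fs where fs: "regular_sequence S fs" "I = genideal S (set fs)"
      using ci unfolding complete_intersection_def by blast
    let ?s = "length fs"
    have g: "\<forall>i<?s. fs ! i \<in> A \<and> nzd (gid ((!) fs) i) (fs ! i)" "1 \<notin> gid ((!) fs) ?s"
      using fs(1) by (auto simp: regular_sequence_iff)
    have eq: "I = gid ((!) fs) ?s"
      using genideal_gid[of ?s "(!) fs"] g(1) set_take_conv[of ?s fs] fs(2) by simp
    have "pdim I + ?s \<le> card V" unfolding eq by (rule pdim_regular[of ?s]) (use g in auto)
    moreover have "r \<le> ?s"
      by (rule quadric_generators[of r f k ?s "(!) fs"]) (use f key g(1) eq I in auto)
    ultimately show star by (simp add: star_def)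
  qed

  have conseq: "complete_intersection S I \<and> gorenstein V I \<and> level V I \<and> cohen_macaulay V I \<and>
      unmixed S I \<and> height S I = enat r" if star: star
  proof -
    have st: "pdim (gid f r) + r \<le> card V" using star by (simp add: star_def I)
    note reg = regular_of_pdim[of r f "\<lambda>_. 2", OF f2 st]
    have nz: "nzd (gid f i) (f i)" if "i < r" for i using reg(2)[of i] that by simp
    have d: "dep (card V - r) I" using hdep_dep[OF reg(1)[of r]] I by simp
    then have "card V - r \<le> pdim I" by (rule dep_le_pdim[OF iI Im])
    then have dim: "r + pdim I = card V" using st by (simp add: I)
    then have dI: "dep (pdim I) I" using d by (metis add_diff_cancel_left')
    have cm: "cohen_macaulay V I" using dI cohen_macaulay_iff[OF I_hom I1] by simp
    have ci: "complete_intersection S I" unfolding complete_intersection_def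
    proof (intro exI[of _ "map f [0..<r]"] conjI)
      have same: "gid ((!) (map f [0..<r])) i = gid f i" if "i \<le> r" for i
        using that by (induction i) auto
      show "regular_sequence S (map f [0..<r])"
        unfolding regular_sequence_iff using same fA nz I1 I by simp
      show "I = genideal S (set (map f [0..<r]))"
        using genideal_gid[of r f, OF fA] I by (simp add: lessThan_atLeast0)
    qed
    obtain F where "cires F I r (\<Sum>i<r. 2)" using cires_gid[of r f "\<lambda>_. 2"] f nz I by auto
    then have gl: "gorenstein V I" "level V I"
      using gorenstein_level_of_cires[OF _ I_hom I1 dim cm] by blast+
    have ge: "enat r \<le> prime_height S Q" if Q: "prm Q" "I \<subseteq> Q" for Q
    proof (rule prime_height_gid[OF Q(1) _ fA])
      show "gid f r \<subseteq> Q" using Q(2) I by simp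
      fix i P assume i: "i < r" and P: "minprime (gid f i) P"
      have hi: "hidl (gid f i)" using pdim_gid_step(2)[of r f "\<lambda>_. 2" i, OF f2] i by simp
      have Pm: "P \<subseteq> mm" using hidl_mm[OF minprime_hom[OF hi P]] P prm_one by (auto simp: minprime_def)
      \<comment> \<open>Elements of a minimal prime are zero divisors modulo \<open>gid f i\<close>,
        and \<open>f i\<close> is not one.\<close>
      obtain u where u: "u \<in> A" "u \<notin> loc (gid f i)" "\<And>p. p \<in> P \<Longrightarrow> p * u \<in> gid f i"
        using minprime_assoc[OF hom_idl[OF hi] P Pm] by blast
      then have "u \<notin> gid f i" using loc_sub[OF hom_idl[OF hi]] by blast
      then show "f i \<notin> P" using u(1,3) nz[OF i] by (auto simp: nzd_def)
    qed
    have le: "prime_height S P = enat r" if P: "minprime I P" for P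
    proof (rule antisym)
      \<comment> \<open>Full depth excludes minimal primes of smaller dimension. Together with
        \<open>r + pdim I = card V\<close> this caps the height at \<open>r\<close>.\<close>
      have "pdim I \<le> pdim P" by (rule dep_le_pdim_minprime[OF iI dI P min_mm[OF P]])
      then have "card V - pdim P \<le> r" using dim by simp
      then show "prime_height S P \<le> enat r" using prime_height_le[of P] order_trans by fastforce
      show "enat r \<le> prime_height S P" using P by (intro ge) (auto simp: minprime_def)
    qed
    have "unmixed S I" using le by (simp add: unmixed_def minimal_prime_iff)
    moreover have "height S I = enat r"
    proof (rule antisym)
      show "height S I \<le> enat r"
        unfolding height_def using P0(1) le[OF P0(1)]
        by (intro INF_lower2[of P0]) (auto simp: primeideal_iff minprime_def)
      show "enat r \<le> height S I"
        unfolding height_def using ge by (intro INF_greatest) (auto simp: primeideal_iff)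
    qed
    ultimately show ?thesis using ci gl cm by blast
  qed
  have "gorenstein V I \<Longrightarrow> cohen_macaulay V I" "level V I \<Longrightarrow> cohen_macaulay V I"
    by (simp_all add: gorenstein_def level_def)
  then show ?thesis using conseq unmixed_star cm_star ci_star by blast
qed

end

section \<open>Adjacent 2-minors\<close>

text \<open>Each lower left corner lies in the other cell, which gives inequalities in both
  directions.\<close>

lemma cell_eq_iff: "cell i j = cell i' j' \<longleftrightarrow> i = i' \<and> j = j'"
proof
  assume eq: "cell i j = cell i' j'"
  have "(i, j) \<in> cell i j" "(i', j') \<in> cell i' j'" by (simp_all add: cell_def)
  then have "(i, j) \<in> cell i' j'" "(i', j') \<in> cell i j" by (simp_all only: eq)
  then show "i = i' \<and> j = j'" by (auto simp: cell_def)
qed simp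

definition e2 :: "'v \<Rightarrow> 'v \<Rightarrow> 'v \<Rightarrow>\<^sub>0 nat" where
  "e2 a b = Poly_Mapping.single a 1 + Poly_Mapping.single b 1"

lemma supp_e2 [simp]: "supp (e2 a b) = {a, b}"
  by (auto simp: e2_def keys_add_nat)

lemma wdeg_e2 [simp]: "wdeg w (e2 a b) = w a + w b"
  by (simp add: e2_def)

lemma e2_eq_iff: "e2 a b = e2 c d \<longleftrightarrow> a = c \<and> b = d \<or> a = d \<and> b = c"
proof
  assume eq: "e2 a b = e2 c d"
  have "{a, b} = {c, d}" using arg_cong[OF eq, of supp] by simp
  then consider "a = c" "b = d" | "a = d" "b = c" by (auto simp: doubleton_eq_iff)
  then show "a = c \<and> b = d \<or> a = d \<and> b = c" by cases simp_all
qed (auto simp: e2_def add.commute)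

lemma adjacent_minor_eq:
  "adjacent_minor i j = mon (e2 (i, j) (i + 1, j + 1)) - mon (e2 (i, j + 1) (i + 1, j))"
  by (simp add: adjacent_minor_def mvar_def mult_single e2_def)

text \<open>Diagonal corners differ by (1, 1) and anti-diagonal ones by (1, -1), so a diagonal
  monomial determines its cell and is never anti-diagonal.\<close>

lemma cf_adjacent_minor:
  "cf (adjacent_minor i j :: (point, 'k::field) mpoly) (e2 (i', j') (i' + 1, j' + 1)) = (if i = i' \<and> j = j' then 1 else 0)"
  by (auto simp: adjacent_minor_eq lookup_minus lookup_single when_def e2_eq_iff)

theorem theorem0p1:
  fixes \<C> :: "point set set"
    and V :: "point set"
    and S :: "(point, 'k::field) mpoly ring"
    and I :: "(point, 'k) mpoly set"
  assumes "finite \<C>" and "\<C> \<noteq> {}" and "\<forall>C\<in>\<C>. is_cell C" and "weakly_connected \<C>"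
  defines "V \<equiv> vertices \<C>" and "S \<equiv> mpoly_ring V" and "I \<equiv> adjacent_ideal \<C>"
  shows "(complete_intersection S I \<longleftrightarrow> gorenstein V I) \<and>
         (gorenstein V I \<longleftrightarrow> level V I) \<and>
         (level V I \<longleftrightarrow> cohen_macaulay V I) \<and>
         (cohen_macaulay V I \<longleftrightarrow> unmixed S I) \<and>
         (unmixed S I \<longrightarrow> height S I = enat (card \<C>))"
proof -
  have finV: "finite V" unfolding V_def vertices_def
    using assms(1,3) by (intro finite_Union) (auto simp: is_cell_def cell_def)
  interpret poly_vars V "TYPE('k)" by unfold_locales (rule finV)
  \<comment> \<open>Cells are listed through their lower left corners, on which the lexicographic
    order of points is available.\<close>
  define B where "B = {p. cell (fst p) (snd p) \<in> \<C>}"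
  have img: "\<C> = (\<lambda>p. cell (fst p) (snd p)) ` B"
  proof (intro equalityI subsetI)
    fix C assume C: "C \<in> \<C>"
    then obtain i j where "C = cell i j" using assms(3) by (auto simp: is_cell_def)
    then show "C \<in> (\<lambda>p. cell (fst p) (snd p)) ` B" using C by (intro image_eqI[of _ _ "(i, j)"]) (simp_all add: B_def)
  qed (auto simp: B_def)
  have inj: "inj_on (\<lambda>p. cell (fst p) (snd p)) B"
    by (auto simp: inj_on_def cell_eq_iff)
  have finB: "finite B" using finite_imageD[OF _ inj] assms(1) img by simp
  define L where "L = sorted_list_of_set B"
  define r where "r = length L"
  have setL: "set L = B" and distL: "distinct L" and sortL: "sorted L"
    using finB by (simp_all add: L_def)
  have r: "r = card \<C>"
    using distinct_card[OF distL] card_image[OF inj] img setL by (simp add: r_def)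
  have lessL: "L ! j < L ! i" if "j < i" "i < r" for i j
    using sorted_nth_mono[OF sortL, of j i] that nth_eq_iff_index_eq[OF distL, of j i] by (simp add: r_def order_less_le)
  define f :: "nat \<Rightarrow> (point, 'k) mpoly" where "f i = adjacent_minor (fst (L ! i)) (snd (L ! i))" for i
  define k :: "nat \<Rightarrow> point \<Rightarrow>\<^sub>0 nat" where
    "k i = e2 (L ! i) (fst (L ! i) + 1, snd (L ! i) + 1)" for i
  define w :: "nat \<Rightarrow> point \<Rightarrow> nat" where
    "w i v = (if v = (fst (L ! i) + 1, snd (L ! i) + 1) then 1 else 0)" for i v
  have cellV: "cell (fst (L ! i)) (snd (L ! i)) \<subseteq> V" if "i < r" for i
  proof -
    have "L ! i \<in> B" using nth_mem[of i L] that setL by (simp add: r_def)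
    then show ?thesis by (auto simp: B_def V_def vertices_def)
  qed
  have "I = genideal S (f ` {..<r})"
  proof -
    have "f ` {..<r} = (\<lambda>p. adjacent_minor (fst p) (snd p)) ` B"
      unfolding f_def setL[symmetric] by (force simp: r_def set_conv_nth)
    also have "\<dots> = {adjacent_minor i j | i j. cell i j \<in> \<C>}"
    proof (intro equalityI subsetI)
      fix p assume "p \<in> {adjacent_minor i j :: (point, 'k) mpoly | i j. cell i j \<in> \<C>}"
      then obtain i j where "p = adjacent_minor i j" "cell i j \<in> \<C>" by blast
      then show "p \<in> (\<lambda>p. adjacent_minor (fst p) (snd p)) ` B"
        by (intro image_eqI[of _ _ "(i, j)"]) (simp_all add: B_def)
    qed (auto simp: B_def)
    finally show ?thesis by (simp add: I_def adjacent_ideal_def S_def V_def)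
  qed
  moreover have fA: "f i \<in> polys V" if "i < r" for i
    using cellV[OF that] by (auto simp: f_def adjacent_minor_eq cell_def intro!: polys_diff)
  ultimately have I: "I = gid f r" using genideal_gid[of r f] by (simp add: S_def)
  have main: "(complete_intersection (mpoly_ring V) I \<longleftrightarrow> gorenstein V I) \<and> (gorenstein V I \<longleftrightarrow> level V I) \<and>
    (level V I \<longleftrightarrow> cohen_macaulay V I) \<and> (cohen_macaulay V I \<longleftrightarrow> unmixed (mpoly_ring V) I) \<and>
    (unmixed (mpoly_ring V) I \<longrightarrow> height (mpoly_ring V) I = enat r)"
  proof (rule quadrics_equivalences[of r f k w])
    have hd: "hdeg 2 (mon (e2 a b) :: (point, 'k) mpoly)" for a b
      using unit_wt_mult[of a "Suc 0"] unit_wt_mult[of b "Suc 0"] by (simp add: whom_def)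
    show "f i \<in> polys V \<and> hdeg 2 (f i)" if "i < r" for i
      using fA[OF that] unfolding f_def adjacent_minor_eq by (intro conjI whom_diff hd)
    show "cf (f i) (k j) = (if i = j then 1 else 0)" if "i < r" "j < r" for i j
      using cf_adjacent_minor[of "fst (L ! i)" "snd (L ! i)" "fst (L ! j)" "snd (L ! j)", where 'k = 'k]
        nth_eq_iff_index_eq[OF distL, of i j] that by (simp add: f_def k_def r_def prod_eq_iff)
    show "ev (f i) = 0" if "i < r" for i
    proof -
      have "ev (f i) + ev (mon (e2 (fst (L ! i), snd (L ! i) + 1) (fst (L ! i) + 1, snd (L ! i)))) =
          ev (mon (e2 (L ! i) (fst (L ! i) + 1, snd (L ! i) + 1)))"
        unfolding ev_add[symmetric] by (simp add: f_def adjacent_minor_eq)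
      then show ?thesis by simp
    qed
    show "\<exists>e. whom (w i) e (f j)" if "j < i" "i < r" for i j
    proof -
      \<comment> \<open>An earlier corner has a smaller first coordinate, or the same first and a
        smaller second one. In either case its cell does not reach the point shifted by (1, 1) from
        the corner \<open>L ! i\<close>.\<close>
      have "w i v = 0" if "v \<in> cell (fst (L ! j)) (snd (L ! j))" for v
        using that lessL[OF \<open>j < i\<close> \<open>i < r\<close>]
        by (cases "L ! i"; cases "L ! j") (auto simp: w_def cell_def less_prod_def)
      then have "whom (w i) 0 (f j)"
        unfolding f_def adjacent_minor_eq by (intro whom_diff) (auto simp: whom_def cell_def)
      then show ?thesis by blast
    qed
    show "\<exists>d m. wcomp (w i) d (f i) = mon m" if "i < r" for i
    proof -
      let ?m = "e2 (fst (L ! i), snd (L ! i)) (fst (L ! i) + 1, snd (L ! i) + 1)"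
      let ?m' = "e2 (fst (L ! i), snd (L ! i) + 1) (fst (L ! i) + 1, snd (L ! i))"
      \<comment> \<open>Only the diagonal monomial contains the upper right corner, so it alone is
        the component of weight 1.\<close>
      have "whom (w i) 1 (mon ?m :: (point, 'k) mpoly)" "whom (w i) 0 (mon ?m' :: (point, 'k) mpoly)"
        by (simp_all add: whom_def w_def prod_eq_iff)
      then have "wcomp (w i) 1 (mon ?m :: (point, 'k) mpoly) = mon ?m" "wcomp (w i) 1 (mon ?m' :: (point, 'k) mpoly) = 0"
        using wcomp_whom[of "w i" 1 "mon ?m" 1] wcomp_whom[of "w i" 0 "mon ?m'" 1] by simp_all
      then have "wcomp (w i) 1 (f i) = mon ?m" unfolding f_def adjacent_minor_eq by (simp add: restr_diff)
      then show ?thesis by blast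
    qed
  qed (rule I)
  then show ?thesis unfolding S_def r .
qed

end
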